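(* Let $\mathscr H$ denote any of the groups $\mathrm{Diff}_G(T^*Q)$, $\mathrm{Diff}_J(T^*Q)$ or $\mathrm{Diff}_{G,J}(T^*Q)$, and let $\mathfrak h$ denote the corresponding subalgebra of vector fields, i.e. $\mathfrak X_G(T^*Q)$, $\mathfrak X_J(T^*Q)$ or $\mathfrak X_{G,J}(T^*Q)$ respectively. If $X_T,Y,X_V\in\mathfrak h$, then the maps $$\Phi_{3S}^h=\exp(\tfrac h2\varepsilon Y)\circ\exp(\tfrac h2X_T)\circ\exp(hX_V)\circ\exp(\tfrac h2X_T)\circ\exp(\tfrac h2\varepsilon Y),$$ $$\Phi_{2S}^h=\exp(\tfrac h2X_T)\circ\exp\big(h(X_V+\varepsilon Y)\big)\circ\exp(\tfrac h2X_T),$$ $$\Phi_{RKS}^h=\exp(\tfrac h2X_T)\circ\Psi^h_{X_V+\varepsilon Y}\circ\exp(\tfrac h2X_T),$$ where $\Psi^h$ is a Runge–Kutta method, belong to $\mathscr H$.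
   Context: Setting. $(Q,\mathsf g)$ is an $n$-dimensional Riemannian manifold, $V$ a smooth real function on $Q$, $\mathsf d$ a symmetric positive semi-definite type $(0,2)$ tensor field on $Q$ of constant rank, $\varepsilon\ge 0$ a parameter and $h>0$ a step size. Points of $T^*Q$ are written $z=(q,p)$; for $p\in T_q^*Q$ the vector $p^\sharp\in T_qQ$ is defined by $\mathsf g_q(p^\sharp,\cdot)=p$. Put $T(q,p)=\tfrac12\mathsf g_q(p^\sharp,p^\sharp)$. For a smooth function $F$ on $T^*Q$, $X_F$ is its canonical Hamiltonian vector field ($\dot q=\partial F/\partial p$, $\dot p=-\partial F/\partial q$). $Y$ is the vector field on $T^*Q$ given by $Y(q,p)=(0,-\mathsf d_q(p^\sharp,\cdot))$. $\exp(tX)$ is the time-$t$ flow of $X$ (flows are treated as diffeomorphisms). The vector field $X_V+\varepsilon Y$ has trivial dynamics in $q$, so it restricts, for each fixed $q$, to an affine vector field on the linear space $T_q^*Q$; $\Psi^h_{X_V+\varepsilon Y}$ is one step of size $h$ of the Runge–Kutta method applied on each such fibre. Symmetry. $G$ is a Lie group with Lie algebra $\mathfrak g$ acting on $Q$ by $\phi_g(q)=g\cdot q$, with lifted action $\phi_{*g}(z)=(T^*_{g\cdot q}\phi_{g^{-1}})(z)$ on $T^*Q$. For $\xi\in\mathfrak g$, $\xi_Q$ and $\xi_{T^*Q}$ are the infinitesimal generators on $Q$ and $T^*Q$, e.g. $\xi_Q(q)=\frac{d}{dt}|_{t=0}\exp(t\xi)\cdot q$. The momentum map $\mathsf J:T^*Q\to\mathfrak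 g^*$ is $\langle\mathsf J(q,p),\xi\rangle=\langle p,\xi_Q(q)\rangle$, and $J(\xi)=\langle\mathsf J(\cdot),\xi\rangle$. Define $\mathrm{Diff}_G(T^*Q)=\{\varphi\in\mathrm{Diff}(T^*Q):\varphi\circ\phi_{*g}=\phi_{*g}\circ\varphi\ \forall g\in G\}$, $\mathfrak X_G(T^*Q)=\{X\in\mathfrak X(T^*Q):[X,\xi_{T^*Q}]=0\ \forall\xi\in\mathfrak g\}$, $\mathrm{Diff}_J(T^*Q)=\{\varphi\in\mathrm{Diff}(T^*Q):J(\xi)\circ\varphi=J(\xi)\ \forall\xi\in\mathfrak g\}$, $\mathfrak X_J(T^*Q)=\{X\in\mathfrak X(T^*Q):\pounds_XJ(\xi)=0\ \forall\xi\in\mathfrak g\}$, $\mathrm{Diff}_{G,J}(T^*Q)=\mathrm{Diff}_G(T^*Q)\cap\mathrm{Diff}_J(T^*Q)$, $\mathfrak X_{G,J}(T^*Q)=\mathfrak X_G(T^*Q)\cap\mathfrak X_J(T^*Q)$.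
   Formalization: For Diff_G and Diff_{G,J} the group G is assumed connected (the claim fails e.g. for Z/2 acting on R by q→−q with V=q), and for Φ_RKS the Runge–Kutta step is assumed well defined and a diffeomorphism of T*Q (explicit Euler can fail to be injective). *)

theory Defs
  imports "HOL-Analysis.Analysis" "HOL-Algebra.Group"
begin

section \<open>Smooth manifolds\<close>

(* Iterated directional derivatives.  On an open subset of a finite-dimensional space this
   is the usual notion of C^k. *)
primrec Ck_on :: "nat \<Rightarrow> 'a::real_normed_vector set \<Rightarrow> ('a \<Rightarrow> 'b::real_normed_vector) \<Rightarrow> bool" where
  "Ck_on 0 S f \<longleftrightarrow> continuous_on S f"
| "Ck_on (Suc k) S f \<longleftrightarrow> (\<forall>x\<in>S. f differentiable (at x)) \<and>
     (\<forall>v. Ck_on k S (\<lambda>x. frechet_derivative f (at x) v))"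

definition smooth_on :: "'a::real_normed_vector set \<Rightarrow> ('a \<Rightarrow> 'b::real_normed_vector) \<Rightarrow> bool" where
  "smooth_on S f \<longleftrightarrow> (\<forall>k. Ck_on k S f)"

(* A chart is a pair of a domain and a coordinate map; the values of the map outside the
   domain are irrelevant.  The manifold is the union of the chart domains. *)
type_synonym ('m, 'e) chart = "'m set \<times> ('m \<Rightarrow> 'e)"
type_synonym ('m, 'e) atlas = "('m, 'e) chart set"

abbreviation dom_of :: "('m, 'e) chart \<Rightarrow> 'm set" where
  "dom_of c \<equiv> fst c"

abbreviation coords :: "('m, 'e) chart \<Rightarrow> 'm \<Rightarrow> 'e" where
  "coords c \<equiv> snd c"

definition point_of :: "('m, 'e) chart \<Rightarrow> 'e \<Rightarrow> 'm" where
  "point_of c = inv_into (dom_of c) (coords c)"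

definition points :: "('m, 'e) atlas \<Rightarrow> 'm set" where
  "points A = (\<Union>c\<in>A. dom_of c)"

definition charts_at :: "('m, 'e) atlas \<Rightarrow> 'm \<Rightarrow> ('m, 'e) chart set" where
  "charts_at A x = {c \<in> A. x \<in> dom_of c}"

definition manifold_topology :: "('m, 'e::topological_space) atlas \<Rightarrow> 'm topology" where
  "manifold_topology A = topology (\<lambda>W. W \<subseteq> points A \<and> (\<forall>c\<in>A. open (coords c ` (W \<inter> dom_of c))))"

definition second_countable_space :: "'a topology \<Rightarrow> bool" where
  "second_countable_space X \<longleftrightarrow>
     (\<exists>\<B>. countable \<B> \<and> (\<forall>B\<in>\<B>. openin X B) \<and>
        (\<forall>W x. openin X W \<and> x \<in> W \<longrightarrow> (\<exists>B\<in>\<B>. x \<in> B \<and> B \<subseteq> W)))"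

definition smooth_manifold :: "('m, 'e::real_normed_vector) atlas \<Rightarrow> bool" where
  "smooth_manifold A \<longleftrightarrow>
     (\<exists>B::'e set. finite B \<and> span B = UNIV) \<and>
     (\<forall>c\<in>A. inj_on (coords c) (dom_of c) \<and> open (coords c ` dom_of c)) \<and>
     (\<forall>c\<in>A. \<forall>c'\<in>A. open (coords c ` (dom_of c \<inter> dom_of c')) \<and>
        smooth_on (coords c ` (dom_of c \<inter> dom_of c')) (coords c' \<circ> point_of c)) \<and>
     Hausdorff_space (manifold_topology A) \<and>
     second_countable_space (manifold_topology A)"

definition euclid_atlas :: "('a, 'a) atlas" where
  "euclid_atlas = {(UNIV, \<lambda>x. x)}"

definition prod_atlas :: "('m, 'e) atlas \<Rightarrow> ('n, 'f) atlas \<Rightarrow> ('m \<times> 'n, 'e \<times> 'f) atlas" where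
  "prod_atlas A B =
     {(dom_of c \<times> dom_of c', \<lambda>(x, y). (coords c x, coords c' y)) | c c'. c \<in> A \<and> c' \<in> B}"

definition smooth_map ::
  "('m, 'e::real_normed_vector) atlas \<Rightarrow> ('n, 'f::real_normed_vector) atlas \<Rightarrow> ('m \<Rightarrow> 'n) \<Rightarrow> bool" where
  "smooth_map A B F \<longleftrightarrow> F ` points A \<subseteq> points B \<and>
     (\<forall>x\<in>points A. \<exists>c\<in>charts_at A x. \<exists>c'\<in>charts_at B (F x). \<exists>W.
        open W \<and> coords c x \<in> W \<and> W \<subseteq> coords c ` dom_of c \<and>
        F ` (point_of c ` W) \<subseteq> dom_of c' \<and>
        smooth_on W (coords c' \<circ> F \<circ> point_of c))"

definition Diff :: "('m, 'e::real_normed_vector) atlas \<Rightarrow> ('m \<Rightarrow> 'm) set" where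
  "Diff A = {F. bij_betw F (points A) (points A) \<and> smooth_map A A F \<and>
     smooth_map A A (inv_into (points A) F)}"

section \<open>Tangent vectors and vector fields\<close>

(* A tangent vector at x is the family of its components in all the charts around x, the
   families being those that transform by the derivatives of the coordinate changes.  The
   component at any other chart is 0, so that equality of tangent vectors is equality of
   functions. *)
type_synonym ('m, 'e) tvec = "('m, 'e) chart \<Rightarrow> 'e"

definition tangent_space :: "('m, 'e::real_normed_vector) atlas \<Rightarrow> 'm \<Rightarrow> ('m, 'e) tvec set" where
  "tangent_space A x = {v.
     (\<forall>c\<in>charts_at A x. \<forall>c'\<in>charts_at A x.
        v c' = frechet_derivative (coords c' \<circ> point_of c) (at (coords c x)) (v c)) \<and>
     (\<forall>c. c \<notin> charts_at A x \<longrightarrow> v c = 0)}"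

(* the tangent vector at x with components w in the chart c *)
definition coord_vec ::
  "('m, 'e::real_normed_vector) atlas \<Rightarrow> ('m, 'e) chart \<Rightarrow> 'm \<Rightarrow> 'e \<Rightarrow> ('m, 'e) tvec" where
  "coord_vec A c x w = (\<lambda>c'. if c' \<in> charts_at A x
     then frechet_derivative (coords c' \<circ> point_of c) (at (coords c x)) w else 0)"

definition velocity ::
  "('m, 'e::real_normed_vector) atlas \<Rightarrow> (real \<Rightarrow> 'm) \<Rightarrow> real \<Rightarrow> ('m, 'e) tvec" where
  "velocity A \<gamma> t = (\<lambda>c. if c \<in> charts_at A (\<gamma> t)
     then vector_derivative (coords c \<circ> \<gamma>) (at t) else 0)"

definition tangent_map ::
  "('m, 'e::real_normed_vector) atlas \<Rightarrow> ('n, 'f::real_normed_vector) atlas \<Rightarrow>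
   ('m \<Rightarrow> 'n) \<Rightarrow> 'm \<Rightarrow> ('m, 'e) tvec \<Rightarrow> ('n, 'f) tvec" where
  "tangent_map A B F x v = (let c = (SOME c. c \<in> charts_at A x) in
     (\<lambda>c'. if c' \<in> charts_at B (F x)
        then frechet_derivative (coords c' \<circ> F \<circ> point_of c) (at (coords c x)) (v c) else 0))"

type_synonym ('m, 'e) vfield = "'m \<Rightarrow> ('m, 'e) tvec"

definition vector_fields :: "('m, 'e::real_normed_vector) atlas \<Rightarrow> ('m, 'e) vfield set" where
  "vector_fields A = {X. (\<forall>x\<in>points A. X x \<in> tangent_space A x) \<and>
     (\<forall>c\<in>A. smooth_on (coords c ` dom_of c) (\<lambda>u. X (point_of c u) c))}"

definition vf_add ::
  "('m, 'e::real_vector) vfield \<Rightarrow> ('m, 'e) vfield \<Rightarrow> ('m, 'e) vfield" where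
  "vf_add X Y = (\<lambda>x c. X x c + Y x c)"

definition vf_scale :: "real \<Rightarrow> ('m, 'e::real_vector) vfield \<Rightarrow> ('m, 'e) vfield" where
  "vf_scale r X = (\<lambda>x c. r *\<^sub>R X x c)"

definition lie_bracket ::
  "('m, 'e::real_normed_vector) atlas \<Rightarrow> ('m, 'e) vfield \<Rightarrow> ('m, 'e) vfield \<Rightarrow> ('m, 'e) vfield" where
  "lie_bracket A X Y x = (\<lambda>c. if c \<in> charts_at A x
     then frechet_derivative (\<lambda>u. Y (point_of c u) c) (at (coords c x)) (X x c)
        - frechet_derivative (\<lambda>u. X (point_of c u) c) (at (coords c x)) (Y x c)
     else 0)"

definition lie_deriv ::
  "('m, 'e::real_normed_vector) atlas \<Rightarrow> ('m, 'e) vfield \<Rightarrow> ('m \<Rightarrow> real) \<Rightarrow> 'm \<Rightarrow> real" where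
  "lie_deriv A X f x = (let c = (SOME c. c \<in> charts_at A x) in
     frechet_derivative (f \<circ> point_of c) (at (coords c x)) (X x c))"

definition integral_curve ::
  "('m, 'e::real_normed_vector) atlas \<Rightarrow> ('m, 'e) vfield \<Rightarrow> (real \<Rightarrow> 'm) \<Rightarrow> bool" where
  "integral_curve A X \<gamma> \<longleftrightarrow>
     smooth_map euclid_atlas A \<gamma> \<and> (\<forall>t. velocity A \<gamma> t = X (\<gamma> t))"

(* exp (t X); the integral curve through x is unique when X is smooth *)
definition flow ::
  "('m, 'e::real_normed_vector) atlas \<Rightarrow> ('m, 'e) vfield \<Rightarrow> real \<Rightarrow> 'm \<Rightarrow> 'm" where
  "flow A X t x = (THE \<gamma>. integral_curve A X \<gamma> \<and> \<gamma> 0 = x) t"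

definition flow_of_diffeos ::
  "('m, 'e::real_normed_vector) atlas \<Rightarrow> ('m, 'e) vfield \<Rightarrow> bool" where
  "flow_of_diffeos A X \<longleftrightarrow>
     (\<forall>x\<in>points A. \<exists>\<gamma>. integral_curve A X \<gamma> \<and> \<gamma> 0 = x) \<and> (\<forall>t. flow A X t \<in> Diff A)"

section \<open>The cotangent bundle\<close>

type_synonym ('m, 'e) covec = "('m, 'e) tvec \<Rightarrow> real"

definition cotangent_space :: "('m, 'e::real_normed_vector) atlas \<Rightarrow> 'm \<Rightarrow> ('m, 'e) covec set" where
  "cotangent_space A x = {p.
     (\<forall>v\<in>tangent_space A x. \<forall>w\<in>tangent_space A x. \<forall>r s.
        p (\<lambda>c. r *\<^sub>R v c + s *\<^sub>R w c) = r * p v + s * p w) \<and>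
     (\<forall>v. v \<notin> tangent_space A x \<longrightarrow> p v = 0)}"

(* The canonical coordinates (q^i, p_i), where p_i = p (\<partial>/\<partial>q^i). *)
definition cot_chart ::
  "('m, 'e::euclidean_space) atlas \<Rightarrow> ('m, 'e) chart \<Rightarrow> ('m \<times> ('m, 'e) covec, 'e \<times> 'e) chart" where
  "cot_chart A c =
     ({(q, p). q \<in> dom_of c \<and> p \<in> cotangent_space A q},
      \<lambda>(q, p). (coords c q, \<Sum>b\<in>Basis. p (coord_vec A c q b) *\<^sub>R b))"

definition cot_atlas ::
  "('m, 'e::euclidean_space) atlas \<Rightarrow> ('m \<times> ('m, 'e) covec, 'e \<times> 'e) atlas" where
  "cot_atlas A = cot_chart A ` A"

type_synonym ('m, 'e) cot_vfield = "('m \<times> ('m, 'e) covec, 'e \<times> 'e) vfield"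

(* q' = \<partial>F/\<partial>p, p' = - \<partial>F/\<partial>q in canonical coordinates *)
definition ham_vf ::
  "('m, 'e::euclidean_space) atlas \<Rightarrow> ('m \<times> ('m, 'e) covec \<Rightarrow> real) \<Rightarrow> ('m, 'e) cot_vfield" where
  "ham_vf A F z = (\<lambda>C. if C \<in> charts_at (cot_atlas A) z
     then let D = frechet_derivative (F \<circ> point_of C) (at (coords C z)) in
       (\<Sum>b\<in>Basis. D (0, b) *\<^sub>R b, - (\<Sum>b\<in>Basis. D (b, 0) *\<^sub>R b))
     else 0)"

(* the vector (0, \<beta>) at z *)
definition vert ::
  "('m, 'e::euclidean_space) atlas \<Rightarrow> 'm \<times> ('m, 'e) covec \<Rightarrow> ('m, 'e) covec \<Rightarrow>
   ('m \<times> ('m, 'e) covec, 'e \<times> 'e) tvec" where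
  "vert A z \<beta> = velocity (cot_atlas A) (\<lambda>t. (fst z, \<lambda>v. snd z v + t * \<beta> v)) 0"

section \<open>The vector fields of the system\<close>

type_synonym ('m, 'e) tensor2 = "'m \<Rightarrow> ('m, 'e) tvec \<Rightarrow> ('m, 'e) tvec \<Rightarrow> real"

definition sym_tensor_field ::
  "('m, 'e::real_normed_vector) atlas \<Rightarrow> ('m, 'e) tensor2 \<Rightarrow> bool" where
  "sym_tensor_field A \<beta> \<longleftrightarrow>
     (\<forall>x\<in>points A. \<forall>u\<in>tangent_space A x. \<forall>v\<in>tangent_space A x.
        \<beta> x u v = \<beta> x v u \<and>
        (\<forall>w\<in>tangent_space A x. \<forall>r s.
           \<beta> x (\<lambda>c. r *\<^sub>R u c + s *\<^sub>R v c) w = r * \<beta> x u w + s * \<beta> x v w)) \<and>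
     (\<forall>c\<in>A. \<forall>w w'. smooth_on (coords c ` dom_of c)
        (\<lambda>y. \<beta> (point_of c y) (coord_vec A c (point_of c y) w) (coord_vec A c (point_of c y) w')))"

definition riemannian_metric ::
  "('m, 'e::real_normed_vector) atlas \<Rightarrow> ('m, 'e) tensor2 \<Rightarrow> bool" where
  "riemannian_metric A g \<longleftrightarrow> sym_tensor_field A g \<and>
     (\<forall>x\<in>points A. \<forall>v\<in>tangent_space A x. v \<noteq> (\<lambda>c. 0) \<longrightarrow> 0 < g x v v)"

definition positive_semidefinite ::
  "('m, 'e::real_normed_vector) atlas \<Rightarrow> ('m, 'e) tensor2 \<Rightarrow> bool" where
  "positive_semidefinite A d \<longleftrightarrow> (\<forall>x\<in>points A. \<forall>v\<in>tangent_space A x. 0 \<le> d x v v)"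

(* the rank of v \<mapsto> d(v, _), computed in some chart *)
definition tensor_rank ::
  "('m, 'e::euclidean_space) atlas \<Rightarrow> ('m, 'e) tensor2 \<Rightarrow> 'm \<Rightarrow> nat" where
  "tensor_rank A d x = (let c = (SOME c. c \<in> charts_at A x) in
     dim (range (\<lambda>w. \<Sum>b\<in>Basis. d x (coord_vec A c x w) (coord_vec A c x b) *\<^sub>R b)))"

definition constant_rank ::
  "('m, 'e::euclidean_space) atlas \<Rightarrow> ('m, 'e) tensor2 \<Rightarrow> bool" where
  "constant_rank A d \<longleftrightarrow> (\<exists>r. \<forall>x\<in>points A. tensor_rank A d x = r)"

definition sharp ::
  "('m, 'e::real_normed_vector) atlas \<Rightarrow> ('m, 'e) tensor2 \<Rightarrow> 'm \<Rightarrow> ('m, 'e) covec \<Rightarrow> ('m, 'e) tvec" where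
  "sharp A g q p = (THE v. v \<in> tangent_space A q \<and> (\<forall>w\<in>tangent_space A q. g q v w = p w))"

definition kinetic_energy ::
  "('m, 'e::real_normed_vector) atlas \<Rightarrow> ('m, 'e) tensor2 \<Rightarrow> 'm \<times> ('m, 'e) covec \<Rightarrow> real" where
  "kinetic_energy A g = (\<lambda>(q, p). 1/2 * g q (sharp A g q p) (sharp A g q p))"

definition X_T :: "('m, 'e::euclidean_space) atlas \<Rightarrow> ('m, 'e) tensor2 \<Rightarrow> ('m, 'e) cot_vfield" where
  "X_T A g = ham_vf A (kinetic_energy A g)"

definition X_V :: "('m, 'e::euclidean_space) atlas \<Rightarrow> ('m \<Rightarrow> real) \<Rightarrow> ('m, 'e) cot_vfield" where
  "X_V A V = ham_vf A (\<lambda>(q, p). V q)"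

definition Y_diss ::
  "('m, 'e::euclidean_space) atlas \<Rightarrow> ('m, 'e) tensor2 \<Rightarrow> ('m, 'e) tensor2 \<Rightarrow> ('m, 'e) cot_vfield" where
  "Y_diss A g d = (\<lambda>(q, p). vert A (q, p)
     (\<lambda>v. if v \<in> tangent_space A q then - d q (sharp A g q p) v else 0))"

definition X_VY ::
  "('m, 'e::euclidean_space) atlas \<Rightarrow> ('m, 'e) tensor2 \<Rightarrow> ('m, 'e) tensor2 \<Rightarrow> ('m \<Rightarrow> real) \<Rightarrow>
   real \<Rightarrow> ('m, 'e) cot_vfield" where
  "X_VY A g d V eps = vf_add (X_V A V) (vf_scale eps (Y_diss A g d))"

section \<open>Runge--Kutta methods on the fibres\<close>

(* the restriction to the linear space T*_q of a vector field with trivial dynamics in q *)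
definition fibre_field ::
  "('m, 'e::euclidean_space) atlas \<Rightarrow> ('m, 'e) cot_vfield \<Rightarrow> 'm \<Rightarrow> ('m, 'e) covec \<Rightarrow> ('m, 'e) covec" where
  "fibre_field A X q p = (THE \<beta>. \<beta> \<in> cotangent_space A q \<and> X (q, p) = vert A (q, p) \<beta>)"

(* s stages, coefficients a i j and weights b i; the method may be implicit *)
definition rk_result ::
  "('m, 'e::euclidean_space) atlas \<Rightarrow> nat \<Rightarrow> (nat \<Rightarrow> nat \<Rightarrow> real) \<Rightarrow> (nat \<Rightarrow> real) \<Rightarrow> real \<Rightarrow>
   ('m, 'e) cot_vfield \<Rightarrow> 'm \<Rightarrow> ('m, 'e) covec \<Rightarrow> ('m, 'e) covec \<Rightarrow> bool" where
  "rk_result A s a b h X q p p' \<longleftrightarrow> (\<exists>k.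
     (\<forall>i<s. k i \<in> cotangent_space A q \<and>
        k i = fibre_field A X q (\<lambda>v. p v + h * (\<Sum>j<s. a i j * k j v))) \<and>
     p' = (\<lambda>v. p v + h * (\<Sum>i<s. b i * k i v)))"

definition rk_step ::
  "('m, 'e::euclidean_space) atlas \<Rightarrow> nat \<Rightarrow> (nat \<Rightarrow> nat \<Rightarrow> real) \<Rightarrow> (nat \<Rightarrow> real) \<Rightarrow> real \<Rightarrow>
   ('m, 'e) cot_vfield \<Rightarrow> 'm \<times> ('m, 'e) covec \<Rightarrow> 'm \<times> ('m, 'e) covec" where
  "rk_step A s a b h X = (\<lambda>(q, p). (q, THE p'. rk_result A s a b h X q p p'))"

(* For a given step size the stage equations of an implicit method need not be solvable, and
   the step, affine on each fibre, need not be invertible: explicit Euler is not for every h. *)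
definition rk_diffeo ::
  "('m, 'e::euclidean_space) atlas \<Rightarrow> nat \<Rightarrow> (nat \<Rightarrow> nat \<Rightarrow> real) \<Rightarrow> (nat \<Rightarrow> real) \<Rightarrow> real \<Rightarrow>
   ('m, 'e) cot_vfield \<Rightarrow> bool" where
  "rk_diffeo A s a b h X \<longleftrightarrow>
     (\<forall>(q, p) \<in> points (cot_atlas A). \<exists>!p'. rk_result A s a b h X q p p') \<and>
     rk_step A s a b h X \<in> Diff (cot_atlas A)"

section \<open>The splitting methods\<close>

definition Phi_3S ::
  "('m, 'e::euclidean_space) atlas \<Rightarrow> ('m, 'e) tensor2 \<Rightarrow> ('m, 'e) tensor2 \<Rightarrow> ('m \<Rightarrow> real) \<Rightarrow>
   real \<Rightarrow> real \<Rightarrow> 'm \<times> ('m, 'e) covec \<Rightarrow> 'm \<times> ('m, 'e) covec" where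
  "Phi_3S A g d V eps h =
     flow (cot_atlas A) (vf_scale eps (Y_diss A g d)) (h/2) \<circ>
     flow (cot_atlas A) (X_T A g) (h/2) \<circ>
     flow (cot_atlas A) (X_V A V) h \<circ>
     flow (cot_atlas A) (X_T A g) (h/2) \<circ>
     flow (cot_atlas A) (vf_scale eps (Y_diss A g d)) (h/2)"

definition Phi_2S ::
  "('m, 'e::euclidean_space) atlas \<Rightarrow> ('m, 'e) tensor2 \<Rightarrow> ('m, 'e) tensor2 \<Rightarrow> ('m \<Rightarrow> real) \<Rightarrow>
   real \<Rightarrow> real \<Rightarrow> 'm \<times> ('m, 'e) covec \<Rightarrow> 'm \<times> ('m, 'e) covec" where
  "Phi_2S A g d V eps h =
     flow (cot_atlas A) (X_T A g) (h/2) \<circ>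
     flow (cot_atlas A) (X_VY A g d V eps) h \<circ>
     flow (cot_atlas A) (X_T A g) (h/2)"

definition Phi_RKS ::
  "('m, 'e::euclidean_space) atlas \<Rightarrow> ('m, 'e) tensor2 \<Rightarrow> ('m, 'e) tensor2 \<Rightarrow> ('m \<Rightarrow> real) \<Rightarrow>
   real \<Rightarrow> nat \<Rightarrow> (nat \<Rightarrow> nat \<Rightarrow> real) \<Rightarrow> (nat \<Rightarrow> real) \<Rightarrow> real \<Rightarrow>
   'm \<times> ('m, 'e) covec \<Rightarrow> 'm \<times> ('m, 'e) covec" where
  "Phi_RKS A g d V eps s a b h =
     flow (cot_atlas A) (X_T A g) (h/2) \<circ>
     rk_step A s a b h (X_VY A g d V eps) \<circ>
     flow (cot_atlas A) (X_T A g) (h/2)"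

section \<open>Symmetries\<close>

definition lie_group ::
  "('g, 'x) monoid_scheme \<Rightarrow> ('g, 'k::real_normed_vector) atlas \<Rightarrow> bool" where
  "lie_group G AG \<longleftrightarrow> group G \<and> smooth_manifold AG \<and> points AG = carrier G \<and>
     smooth_map (prod_atlas AG AG) AG (\<lambda>(x, y). x \<otimes>\<^bsub>G\<^esub> y) \<and>
     smooth_map AG AG (\<lambda>x. inv\<^bsub>G\<^esub> x)"

definition lie_algebra ::
  "('g, 'x) monoid_scheme \<Rightarrow> ('g, 'k::real_normed_vector) atlas \<Rightarrow> ('g, 'k) tvec set" where
  "lie_algebra G AG = tangent_space AG \<one>\<^bsub>G\<^esub>"

definition one_parameter_subgroup ::
  "('g, 'x) monoid_scheme \<Rightarrow> ('g, 'k::real_normed_vector) atlas \<Rightarrow> (real \<Rightarrow> 'g) \<Rightarrow> bool" where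
  "one_parameter_subgroup G AG \<gamma> \<longleftrightarrow> smooth_map euclid_atlas AG \<gamma> \<and>
     \<gamma> 0 = \<one>\<^bsub>G\<^esub> \<and> (\<forall>s t. \<gamma> (s + t) = \<gamma> s \<otimes>\<^bsub>G\<^esub> \<gamma> t)"

definition lie_exp ::
  "('g, 'x) monoid_scheme \<Rightarrow> ('g, 'k::real_normed_vector) atlas \<Rightarrow> ('g, 'k) tvec \<Rightarrow> 'g" where
  "lie_exp G AG \<xi> = (THE \<gamma>. one_parameter_subgroup G AG \<gamma> \<and> velocity AG \<gamma> 0 = \<xi>) 1"

definition smooth_action ::
  "('g, 'x) monoid_scheme \<Rightarrow> ('g, 'k::real_normed_vector) atlas \<Rightarrow>
   ('m, 'e::real_normed_vector) atlas \<Rightarrow> ('g \<Rightarrow> 'm \<Rightarrow> 'm) \<Rightarrow> bool" where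
  "smooth_action G AG A \<phi> \<longleftrightarrow>
     smooth_map (prod_atlas AG A) A (\<lambda>(g, q). \<phi> g q) \<and>
     (\<forall>q\<in>points A. \<phi> \<one>\<^bsub>G\<^esub> q = q) \<and>
     (\<forall>g\<in>carrier G. \<forall>g'\<in>carrier G. \<forall>q\<in>points A. \<phi> (g \<otimes>\<^bsub>G\<^esub> g') q = \<phi> g (\<phi> g' q))"

definition lifted_action ::
  "('g, 'x) monoid_scheme \<Rightarrow> ('m, 'e::real_normed_vector) atlas \<Rightarrow> ('g \<Rightarrow> 'm \<Rightarrow> 'm) \<Rightarrow>
   'g \<Rightarrow> 'm \<times> ('m, 'e) covec \<Rightarrow> 'm \<times> ('m, 'e) covec" where
  "lifted_action G A \<phi> g = (\<lambda>(q, p).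
     (\<phi> g q, \<lambda>v. if v \<in> tangent_space A (\<phi> g q)
        then p (tangent_map A A (\<phi> (inv\<^bsub>G\<^esub> g)) (\<phi> g q) v) else 0))"

definition generator ::
  "('g, 'x) monoid_scheme \<Rightarrow> ('g, 'k::real_normed_vector) atlas \<Rightarrow>
   ('m, 'e::real_normed_vector) atlas \<Rightarrow> ('g \<Rightarrow> 'm \<Rightarrow> 'm) \<Rightarrow> ('g, 'k) tvec \<Rightarrow> ('m, 'e) vfield" where
  "generator G AG A \<phi> \<xi> x = velocity A (\<lambda>t. \<phi> (lie_exp G AG (\<lambda>c. t *\<^sub>R \<xi> c)) x) 0"

definition momentum ::
  "('g, 'x) monoid_scheme \<Rightarrow> ('g, 'k::real_normed_vector) atlas \<Rightarrow>
   ('m, 'e::real_normed_vector) atlas \<Rightarrow> ('g \<Rightarrow> 'm \<Rightarrow> 'm) \<Rightarrow> ('g, 'k) tvec \<Rightarrow>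
   'm \<times> ('m, 'e) covec \<Rightarrow> real" where
  "momentum G AG A \<phi> \<xi> = (\<lambda>(q, p). p (generator G AG A \<phi> \<xi> q))"

definition Diff_G ::
  "('g, 'x) monoid_scheme \<Rightarrow> ('m, 'e::euclidean_space) atlas \<Rightarrow> ('g \<Rightarrow> 'm \<Rightarrow> 'm) \<Rightarrow>
   ('m \<times> ('m, 'e) covec \<Rightarrow> 'm \<times> ('m, 'e) covec) set" where
  "Diff_G G A \<phi> = {F \<in> Diff (cot_atlas A). \<forall>g\<in>carrier G. \<forall>z\<in>points (cot_atlas A).
     F (lifted_action G A \<phi> g z) = lifted_action G A \<phi> g (F z)}"

definition vf_G ::
  "('g, 'x) monoid_scheme \<Rightarrow> ('g, 'k::real_normed_vector) atlas \<Rightarrow>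
   ('m, 'e::euclidean_space) atlas \<Rightarrow> ('g \<Rightarrow> 'm \<Rightarrow> 'm) \<Rightarrow> ('m, 'e) cot_vfield set" where
  "vf_G G AG A \<phi> = {X \<in> vector_fields (cot_atlas A).
     \<forall>\<xi>\<in>lie_algebra G AG. \<forall>z\<in>points (cot_atlas A).
       lie_bracket (cot_atlas A) X
         (generator G AG (cot_atlas A) (lifted_action G A \<phi>) \<xi>) z = (\<lambda>c. 0)}"

definition Diff_J ::
  "('g, 'x) monoid_scheme \<Rightarrow> ('g, 'k::real_normed_vector) atlas \<Rightarrow>
   ('m, 'e::euclidean_space) atlas \<Rightarrow> ('g \<Rightarrow> 'm \<Rightarrow> 'm) \<Rightarrow>
   ('m \<times> ('m, 'e) covec \<Rightarrow> 'm \<times> ('m, 'e) covec) set" where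
  "Diff_J G AG A \<phi> = {F \<in> Diff (cot_atlas A).
     \<forall>\<xi>\<in>lie_algebra G AG. \<forall>z\<in>points (cot_atlas A).
       momentum G AG A \<phi> \<xi> (F z) = momentum G AG A \<phi> \<xi> z}"

definition vf_J ::
  "('g, 'x) monoid_scheme \<Rightarrow> ('g, 'k::real_normed_vector) atlas \<Rightarrow>
   ('m, 'e::euclidean_space) atlas \<Rightarrow> ('g \<Rightarrow> 'm \<Rightarrow> 'm) \<Rightarrow> ('m, 'e) cot_vfield set" where
  "vf_J G AG A \<phi> = {X \<in> vector_fields (cot_atlas A).
     \<forall>\<xi>\<in>lie_algebra G AG. \<forall>z\<in>points (cot_atlas A).
       lie_deriv (cot_atlas A) X (momentum G AG A \<phi> \<xi>) z = 0}"

definition Diff_GJ ::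
  "('g, 'x) monoid_scheme \<Rightarrow> ('g, 'k::real_normed_vector) atlas \<Rightarrow>
   ('m, 'e::euclidean_space) atlas \<Rightarrow> ('g \<Rightarrow> 'm \<Rightarrow> 'm) \<Rightarrow>
   ('m \<times> ('m, 'e) covec \<Rightarrow> 'm \<times> ('m, 'e) covec) set" where
  "Diff_GJ G AG A \<phi> = Diff_G G A \<phi> \<inter> Diff_J G AG A \<phi>"

definition vf_GJ ::
  "('g, 'x) monoid_scheme \<Rightarrow> ('g, 'k::real_normed_vector) atlas \<Rightarrow>
   ('m, 'e::euclidean_space) atlas \<Rightarrow> ('g \<Rightarrow> 'm \<Rightarrow> 'm) \<Rightarrow> ('m, 'e) cot_vfield set" where
  "vf_GJ G AG A \<phi> = vf_G G AG A \<phi> \<inter> vf_J G AG A \<phi>"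

end

theory Submission
  imports Defs
begin

text \<open>
  A vector field that commutes with the generators of a connected group is invariant under the whole
  group: the pull-back \<open>g \<mapsto> (T\<Phi>\<^sub>g)\<^sup>-\<^sup>1 X(\<Phi>\<^sub>g x)\<close> takes values in the fixed vector space
  \<open>T\<^sub>x M\<close>, its derivative at the identity along \<open>exp (t \<xi>)\<close> is the bracket of the generator with \<open>X\<close>,
  and translation moves this to every group element, so it is constant. By uniqueness of integral
  curves the flow of an invariant field is equivariant; this argument needs no smooth dependence of
  the flow of \<open>X\<close> on the initial point, only the smoothness of the action. If instead \<open>J(\<xi>)\<close> has zero
  derivative along \<open>X\<close>, it is constant on integral curves. For the Runge--Kutta step, \<open>X\<^sub>V + \<epsilon> Y\<close> is
  vertical: an invariant vertical field has equivariant fibre restrictions, and since the lifted action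
  is linear on the fibres it maps stages to stages; and as \<open>J(\<xi>)\<close> is linear on the fibres,
  \<open>\<pounds>\<^sub>X J(\<xi>) = 0\<close> says that every stage annihilates \<open>\<xi>\<^sub>Q\<close>.
\<close>

text \<open>Connectedness carries the passage from the Lie algebra to the group: a discrete group
  has zero Lie algebra, so the bracket condition in \<open>vf_G\<close> then holds for every field,
  while \<open>Diff_G\<close> asks for equivariance under each element. It enters through the fact
  that a function with vanishing derivative on a connected manifold is constant, so generation of
  the group by exponentials is never invoked. The price is that the pull-back must be differentiable
  in \<open>g\<close>, not merely along curves: it is shown smooth near the identity, and its
  derivative is then evaluated along one-parameter subgroups, which realise every tangent vector
  there. \<open>lie_exp\<close> and \<open>flow\<close> are definite descriptions, so nothing can be
  said about generators or flows before existence and uniqueness of one-parameter subgroups and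
  uniqueness of integral curves are known. This is why local ODE theory is developed; existence of
  complete integral curves on the cotangent bundle is part of \<open>flow_of_diffeos\<close>.
  Moreover \<open>Ck_on\<close> speaks of derivatives in fixed directions only, which is why vectors
  are expanded in a finite basis so often.\<close>

section \<open>Finite-dimensional normed spaces\<close>

text \<open>The model space of the group is a finite-dimensional space with an arbitrary norm, so a
  finite family of bounded coordinate functionals replaces an orthonormal basis.\<close>
definition finite_dim :: "'a::real_normed_vector itself \<Rightarrow> bool" where
  "finite_dim _ \<longleftrightarrow> (\<exists>(B::'a set) \<phi>. finite B \<and> (\<forall>b\<in>B. bounded_linear (\<phi> b)) \<and>
     (\<forall>x. x = (\<Sum>b\<in>B. \<phi> b x *\<^sub>R b)))"

lemma finite_dimE:
  assumes "finite_dim TYPE('a::real_normed_vector)"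
  obtains B :: "'a::real_normed_vector set" and \<phi> where "finite B" "\<And>b. b \<in> B \<Longrightarrow> bounded_linear (\<phi> b)"
    "\<And>x. (\<Sum>b\<in>B. \<phi> b x *\<^sub>R b) = x"
  using assms unfolding finite_dim_def by metis

lemma finite_dim_euclidean: "finite_dim TYPE('a::euclidean_space)"
  unfolding finite_dim_def
  by (rule exI[of _ Basis], rule exI[of _ "\<lambda>b x. x \<bullet> b"])
     (auto simp: bounded_linear_inner_left euclidean_representation)

lemma finite_dim_prod:
  assumes "finite_dim TYPE('a::real_normed_vector)" "finite_dim TYPE('b::real_normed_vector)"
  shows "finite_dim TYPE('a \<times> 'b)"
proof -
  obtain B :: "'a set" and \<phi> where B: "finite B" "\<And>b. b \<in> B \<Longrightarrow> bounded_linear (\<phi> b)"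
    "\<And>x. (\<Sum>b\<in>B. \<phi> b x *\<^sub>R b) = x" using assms(1) by (rule finite_dimE) (rule that)
  obtain C :: "'b set" and \<psi> where C: "finite C" "\<And>b. b \<in> C \<Longrightarrow> bounded_linear (\<psi> b)"
    "\<And>x. (\<Sum>b\<in>C. \<psi> b x *\<^sub>R b) = x" using assms(2) by (rule finite_dimE) (rule that)
  \<comment> \<open>Dropping 0 from \<open>B\<close> lets \<open>?\<chi>\<close> recognise by
    \<open>b \<noteq> 0\<close> which factor a pair comes from; otherwise (0, 0) could come from
    both.\<close>
  have B0: "(\<Sum>b\<in>B - {0}. \<phi> b x *\<^sub>R b) = x" for x
    using sum.mono_neutral_left[of B "B - {0}" "\<lambda>b. \<phi> b x *\<^sub>R b"] B(1) B(3)[of x] by auto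
  let ?D = "(\<lambda>b. (b, 0)) ` (B - {0}) \<union> (\<lambda>c. (0, c)) ` C"
  let ?\<chi> = "\<lambda>(b, c) x. if b \<noteq> 0 then \<phi> b (fst x) else \<psi> c (snd x)"
  show ?thesis unfolding finite_dim_def
  proof (intro exI[of _ ?D] exI[of _ ?\<chi>] conjI ballI allI)
    show "finite ?D" using B(1) C(1) by simp
    fix d assume "d \<in> ?D"
    then consider b where "d = (b, 0)" "b \<in> B" "b \<noteq> 0" | c where "d = (0, c)" "c \<in> C" by auto
    then show "bounded_linear (?\<chi> d)"
    proof cases
      case 1
      then show ?thesis using bounded_linear_compose[OF B(2) bounded_linear_fst] by simp
    next
      case 2
      then show ?thesis using bounded_linear_compose[OF C(2) bounded_linear_snd] by simp
    qed
  next
    fix x :: "'a \<times> 'b"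
    have "(\<Sum>d\<in>?D. ?\<chi> d x *\<^sub>R d) =
      (\<Sum>d\<in>(\<lambda>b. (b, 0)) ` (B - {0}). ?\<chi> d x *\<^sub>R d) + (\<Sum>d\<in>(\<lambda>c. (0, c)) ` C. ?\<chi> d x *\<^sub>R d)"
      by (rule sum.union_disjoint) (use B(1) C(1) in auto)
    also have "(\<Sum>d\<in>(\<lambda>b. (b, 0)) ` (B - {0}). ?\<chi> d x *\<^sub>R d) =
        (\<Sum>b\<in>B - {0}. (\<phi> b (fst x) *\<^sub>R b, 0))"
      by (subst sum.reindex) (auto simp: inj_on_def intro!: sum.cong)
    also have "\<dots> = (fst x, 0)" using B0[of "fst x"]
      by (simp add: prod_eq_iff fst_sum snd_sum)
    also have "(\<Sum>d\<in>(\<lambda>c. (0, c)) ` C. ?\<chi> d x *\<^sub>R d) =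
        (\<Sum>c\<in>C. (0, \<psi> c (snd x) *\<^sub>R c))"
      by (subst sum.reindex) (auto simp: inj_on_def intro!: sum.cong)
    also have "\<dots> = (0, snd x)" using C(3)[of "snd x"]
      by (simp add: prod_eq_iff fst_sum snd_sum)
    finally show "x = (\<Sum>d\<in>?D. ?\<chi> d x *\<^sub>R d)" by simp
  qed
qed

text \<open>Induction on the basis: the bound for \<open>B\<close> makes the coordinates of a
  convergent sequence Cauchy, so \<open>span B\<close> is closed; a new vector outside it then has
  positive distance from the span, and this distance controls its coefficient.\<close>

lemma independent_coordinates_bounded:
  fixes B :: "'a::real_normed_vector set"
  assumes "finite B" "independent B"
  shows "\<exists>m>0. \<forall>x. m * (\<Sum>b\<in>B. \<bar>x b\<bar>) \<le> norm (\<Sum>b\<in>B. x b *\<^sub>R b)"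
  using assms
proof (induction B)
  case empty
  then show ?case by (auto intro: exI[of _ 1])
next
  case (insert b B)
  then obtain m where m: "m > 0" "\<And>x. m * (\<Sum>b\<in>B. \<bar>x b\<bar>) \<le> norm (\<Sum>b\<in>B. x b *\<^sub>R b)"
    by (auto simp: independent_insert)
  have bB: "b \<notin> span B" using insert by (auto simp: independent_insert)
  have spanB: "span B = {\<Sum>a\<in>B. x a *\<^sub>R a |x. True}"
    using span_finite[OF insert(1)] by auto
  have "closed (span B)"
    unfolding closed_sequential_limits
  proof (intro allI impI, elim conjE)
    fix w l assume w: "\<forall>n. w n \<in> span B" "w \<longlonglongrightarrow> l"
    then have "\<forall>n. \<exists>x. w n = (\<Sum>a\<in>B. x a *\<^sub>R a)" unfolding spanB by blast
    then obtain x where x: "\<And>n. w n = (\<Sum>a\<in>B. x n a *\<^sub>R a)" by metis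
    have "Cauchy (\<lambda>n. x n a)" if a: "a \<in> B" for a
    proof (rule metric_CauchyI)
      fix e :: real assume "e > 0"
      then have "m * e > 0" using m by simp
      then obtain M where M: "\<And>i j. i \<ge> M \<Longrightarrow> j \<ge> M \<Longrightarrow> dist (w i) (w j) < m * e"
        using LIMSEQ_imp_Cauchy[OF w(2)] unfolding Cauchy_def by meson
      have "dist (x i a) (x j a) < e" if "i \<ge> M" "j \<ge> M" for i j
      proof -
        have "m * \<bar>x i a - x j a\<bar> \<le> m * (\<Sum>a\<in>B. \<bar>x i a - x j a\<bar>)"
          using m(1) a insert(1) by (intro mult_left_mono member_le_sum) auto
        also have "\<dots> \<le> norm (\<Sum>a\<in>B. (x i a - x j a) *\<^sub>R a)" by (rule m(2))
        also have "\<dots> = dist (w i) (w j)"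
          unfolding x dist_norm by (simp add: scaleR_left_diff_distrib sum_subtractf)
        also have "\<dots> < m * e" using M that by blast
        finally show ?thesis using m(1) by (simp add: dist_real_def)
      qed
      then show "\<exists>M. \<forall>i\<ge>M. \<forall>j\<ge>M. dist (x i a) (x j a) < e" by blast
    qed
    then have "\<forall>a\<in>B. \<exists>y. (\<lambda>n. x n a) \<longlonglongrightarrow> y"
      by (meson real_Cauchy_convergent convergent_def)
    then obtain y where "\<And>a. a \<in> B \<Longrightarrow> (\<lambda>n. x n a) \<longlonglongrightarrow> y a" by metis
    then have "w \<longlonglongrightarrow> (\<Sum>a\<in>B. y a *\<^sub>R a)" unfolding x by (intro tendsto_intros)
    then have "l = (\<Sum>a\<in>B. y a *\<^sub>R a)" using w(2) LIMSEQ_unique by blast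
    then show "l \<in> span B" unfolding spanB by blast
  qed
  then have "open (- span B)" "b \<in> - span B" using bB by auto
  then obtain d where d0: "d > 0" "ball b d \<subseteq> - span B" unfolding open_contains_ball by blast
  then have d: "d > 0" "\<And>w. w \<in> span B \<Longrightarrow> d \<le> dist b w" by (auto simp: not_less[symmetric])
  \<comment> \<open>Scaling by \<open>t\<close> turns the distance \<open>d\<close> from
    \<open>b\<close> to the span into a bound on the coefficient of \<open>b\<close>.\<close>
  have key: "\<bar>t\<bar> * d \<le> norm (t *\<^sub>R b + w)" if w: "w \<in> span B" for t w
  proof (cases "t = 0")
    case False
    have "(- 1 / t) *\<^sub>R w \<in> span B" using w by (intro span_mul)
    then have "d \<le> norm (b - (- 1 / t) *\<^sub>R w)" using d(2) by (simp only: dist_norm)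
    then have "\<bar>t\<bar> * d \<le> norm (t *\<^sub>R (b - (- 1 / t) *\<^sub>R w))"
      by (simp only: norm_scaleR mult_left_mono abs_ge_zero)
    also have "t *\<^sub>R (b - (- 1 / t) *\<^sub>R w) = t *\<^sub>R b + w"
      using False by (simp add: scaleR_add_right)
    finally show ?thesis .
  qed simp
  \<comment> \<open>With \<open>N\<close> the norm of the whole combination, the coefficient of
    \<open>b\<close> is at most \<open>N / d\<close>, so the rest has norm at most
    \<open>N * (1 + norm b / d)\<close> and its coefficients sum to at most that divided by
    \<open>m\<close>.\<close>
  define C where "C = 1 / d + (1 + norm b / d) / m"
  have C: "C > 0" unfolding C_def using d m by (simp add: add_pos_nonneg)
  have "(\<Sum>a\<in>insert b B. \<bar>x a\<bar>) \<le> C * norm (\<Sum>a\<in>insert b B. x a *\<^sub>R a)" for x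
  proof -
    define w where "w = (\<Sum>a\<in>B. x a *\<^sub>R a)"
    define N where "N = norm (x b *\<^sub>R b + w)"
    have w: "w \<in> span B" unfolding w_def spanB by blast
    have 1: "\<bar>x b\<bar> \<le> N / d" using key[OF w, of "x b"] d(1) unfolding N_def by (simp add: field_simps)
    have "norm w = norm ((x b *\<^sub>R b + w) - x b *\<^sub>R b)" by simp
    also have "\<dots> \<le> N + norm (x b *\<^sub>R b)" unfolding N_def by (rule norm_triangle_ineq4)
    also have "\<dots> \<le> N + N / d * norm b" using mult_right_mono[OF 1, of "norm b"] by simp
    finally have 2: "norm w \<le> N * (1 + norm b / d)" by (simp add: algebra_simps)
    have "m * (\<Sum>a\<in>B. \<bar>x a\<bar>) \<le> N * (1 + norm b / d)"
      using m(2)[of x] 2 unfolding w_def by simp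
    then have "(\<Sum>a\<in>B. \<bar>x a\<bar>) \<le> N * (1 + norm b / d) / m" using m(1) by (simp add: field_simps)
    then show ?thesis using 1 insert(1,2) unfolding C_def N_def w_def
      by (simp add: algebra_simps)
  qed
  then have "\<And>x. 1 / C * (\<Sum>a\<in>insert b B. \<bar>x a\<bar>) \<le> norm (\<Sum>a\<in>insert b B. x a *\<^sub>R a)"
    using C by (simp add: field_simps)
  then show ?case using C by (intro exI[of _ "1 / C"]) simp
qed

text \<open>Coordinates in a spanning set are not unique, so an independent subset is extracted
  first; that its coordinate functionals are bounded is the previous lemma.\<close>

lemma finite_dim_if_span:
  fixes B :: "'a::real_normed_vector set"
  assumes "finite B" "span B = UNIV"
  shows "finite_dim TYPE('a)"
proof -
  obtain C where C: "C \<subseteq> B" "independent C" "B \<subseteq> span C"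
    using maximal_independent_subset[of B] by auto
  have fC: "finite C" using C(1) assms(1) finite_subset by blast
  have sC: "span C = UNIV"
    using span_mono[OF C(3)] assms(2) by (simp add: span_span top_unique)
  have rep: "(\<Sum>b\<in>C. representation C x b *\<^sub>R b) = x" for x
    using sum_representation_eq[OF C(2) _ fC, of x] sC by simp
  obtain m where m: "m > 0" "\<And>x. m * (\<Sum>b\<in>C. \<bar>x b\<bar>) \<le> norm (\<Sum>b\<in>C. x b *\<^sub>R b)"
    using independent_coordinates_bounded[OF fC C(2)] by blast
  have "bounded_linear (\<lambda>x. representation C x b)" if b: "b \<in> C" for b
  proof (rule bounded_linear_intro)
    show "representation C (x + y) b = representation C x b + representation C y b" for x y
      using representation_add[OF C(2)] sC by simp
    show "representation C (r *\<^sub>R x) b = r *\<^sub>R representation C x b" for r x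
      using representation_scale[OF C(2)] sC by simp
    show "norm (representation C x b) \<le> norm x * (1 / m)" for x
    proof -
      have "m * \<bar>representation C x b\<bar> \<le> m * (\<Sum>b\<in>C. \<bar>representation C x b\<bar>)"
        using m(1) b fC by (intro mult_left_mono member_le_sum) auto
      also have "\<dots> \<le> norm x" using m(2)[of "representation C x"] rep by simp
      finally show ?thesis using m(1) by (simp add: field_simps)
    qed
  qed
  then show ?thesis unfolding finite_dim_def
    using fC rep by (intro exI[of _ C] exI[of _ "\<lambda>b x. representation C x b"]) auto
qed

section \<open>Smooth functions\<close>

text \<open>The derivatives in \<open>Ck_on\<close> are taken in the full space, so equality on
  \<open>S\<close> passes to them because \<open>S\<close> is open.\<close>

lemma Ck_on_cong:
  assumes "open S" "\<And>x. x \<in> S \<Longrightarrow> f x = g x" "Ck_on k S f"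
  shows "Ck_on k S g"
  using assms
proof (induction k arbitrary: f g)
  case 0
  then show ?case using continuous_on_cong[of S S f g] by simp
next
  case (Suc k)
  have d: "(g has_derivative frechet_derivative f (at x)) (at x)" if "x \<in> S" for x
  proof -
    have "f differentiable at x" using Suc.prems(3) that by simp
    then have "(f has_derivative frechet_derivative f (at x)) (at x)" by (simp add: frechet_derivative_works)
    then show ?thesis by (rule has_derivative_transform_within_open[OF _ Suc.prems(1) that Suc.prems(2)])
  qed
  have "Ck_on k S (\<lambda>x. frechet_derivative g (at x) v)" for v
    by (rule Suc.IH[OF Suc.prems(1), of "\<lambda>x. frechet_derivative f (at x) v"])
       (use Suc.prems(3) in \<open>auto simp: frechet_derivative_at[OF d, symmetric]\<close>)
  then show ?case unfolding Ck_on.simps using d differentiableI by blast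
qed

text \<open>Lets the derivative be given by a formula on \<open>S\<close> instead of through the
  choice in \<open>frechet_derivative\<close>; the rules for sums, products and composites below go
  through it.\<close>

lemma Ck_on_SucI:
  assumes "open S" "\<And>x. x \<in> S \<Longrightarrow> (f has_derivative f' x) (at x)" "\<And>v. Ck_on k S (\<lambda>x. f' x v)"
  shows "Ck_on (Suc k) S f"
  unfolding Ck_on.simps
proof (intro conjI ballI allI)
  show "f differentiable at x" if "x \<in> S" for x using assms(2)[OF that] differentiableI by blast
  show "Ck_on k S (\<lambda>x. frechet_derivative f (at x) v)" for v
    by (rule Ck_on_cong[OF assms(1) _ assms(3)[of v]])
       (simp add: frechet_derivative_at[OF assms(2), symmetric])
qed

lemma Ck_on_SucD:
  assumes "Ck_on (Suc k) S f"
  shows "x \<in> S \<Longrightarrow> (f has_derivative frechet_derivative f (at x)) (at x)"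
    "Ck_on k S (\<lambda>x. frechet_derivative f (at x) v)"
  using assms frechet_derivative_works by auto

lemma Ck_on_Suc_imp: "Ck_on (Suc k) S f \<Longrightarrow> Ck_on k S f"
proof (induction k arbitrary: f)
  case 0
  then show ?case
    by (auto intro!: continuous_at_imp_continuous_on differentiable_imp_continuous_within)
next
  case (Suc k)
  then show ?case unfolding Ck_on.simps(2)[of _ S f] Ck_on.simps(2)[of "Suc _" S f] by blast
qed

lemma Ck_on_subset: "Ck_on k T f \<Longrightarrow> S \<subseteq> T \<Longrightarrow> Ck_on k S f"
proof (induction k arbitrary: f)
  case 0
  then show ?case using continuous_on_subset by auto
next
  case (Suc k)
  then show ?case by auto
qed

lemma Ck_on_local:
  assumes "\<And>x. x \<in> S \<Longrightarrow> \<exists>W. open W \<and> x \<in> W \<and> Ck_on k W f"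
  shows "Ck_on k S f"
  using assms
proof (induction k arbitrary: f)
  case 0
  show ?case
    unfolding Ck_on.simps
    by (rule continuous_at_imp_continuous_on)
       (use 0 continuous_on_eq_continuous_at in \<open>fastforce\<close>)
next
  case (Suc k)
  show ?case unfolding Ck_on.simps
  proof (intro conjI ballI allI)
    show "f differentiable at x" if "x \<in> S" for x using Suc.prems[OF that] by auto
    show "Ck_on k S (\<lambda>x. frechet_derivative f (at x) v)" for v
      by (rule Suc.IH) (use Suc.prems in \<open>fastforce simp: Ck_on.simps(2)\<close>)
  qed
qed

lemma Ck_on_const: "Ck_on k S (\<lambda>x. c)"
  by (induction k arbitrary: c) auto

lemma Ck_on_bounded_linear:
  assumes L: "bounded_linear L" and S: "open S"
  shows "Ck_on k S f \<Longrightarrow> Ck_on k S (\<lambda>x. L (f x))"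
proof (induction k arbitrary: f)
  case 0
  then show ?case using bounded_linear.continuous_on[OF L] by simp
next
  case (Suc k)
  show ?case
    by (rule Ck_on_SucI[OF S, where f' = "\<lambda>x v. L (frechet_derivative f (at x) v)"])
       (rule bounded_linear.has_derivative[OF L Ck_on_SucD(1)[OF Suc.prems]] Suc.IH
          Ck_on_SucD(2)[OF Suc.prems] | assumption)+
qed

lemma Ck_on_linear_id: "bounded_linear f \<Longrightarrow> open S \<Longrightarrow> Ck_on k S f"
proof (induction k)
  case 0
  then show ?case by (simp add: linear_continuous_on)
next
  case (Suc k)
  then show ?case
    by (intro Ck_on_SucI[where f' = "\<lambda>_. f"]) (auto intro: bounded_linear_imp_has_derivative Ck_on_const)
qed

lemma Ck_on_add:
  "open S \<Longrightarrow> Ck_on k S f \<Longrightarrow> Ck_on k S g \<Longrightarrow> Ck_on k S (\<lambda>x. f x + g x)"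
proof (induction k arbitrary: f g)
  case 0
  then show ?case by (auto intro: continuous_on_add)
next
  case (Suc k)
  show ?case
    by (rule Ck_on_SucI[OF Suc.prems(1),
          where f' = "\<lambda>x v. frechet_derivative f (at x) v + frechet_derivative g (at x) v"])
       (rule has_derivative_add Ck_on_SucD(1)[OF Suc.prems(2)] Ck_on_SucD(1)[OF Suc.prems(3)] Suc.IH
         Suc.prems(1) Ck_on_SucD(2)[OF Suc.prems(2)] Ck_on_SucD(2)[OF Suc.prems(3)] | assumption)+
qed

lemma Ck_on_sum:
  assumes "open S" "\<And>i. i \<in> I \<Longrightarrow> Ck_on k S (f i)"
  shows "Ck_on k S (\<lambda>x. \<Sum>i\<in>I. f i x)"
  using assms(2)
  by (induction I rule: infinite_finite_induct) (auto intro: Ck_on_const Ck_on_add assms(1))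

text \<open>Leibniz rule: the derivative is a sum of two products with one factor differentiated in
  each, so the induction also needs the undifferentiated factors one order lower.\<close>

lemma Ck_on_bilinear:
  assumes P: "bounded_bilinear P" and S: "open S"
  shows "Ck_on k S f \<Longrightarrow> Ck_on k S g \<Longrightarrow> Ck_on k S (\<lambda>x. P (f x) (g x))"
proof (induction k arbitrary: f g)
  case 0
  then show ?case using bounded_bilinear.continuous_on[OF P] by simp
next
  case (Suc k)
  show ?case
  proof (rule Ck_on_SucI[OF S, where f' = "\<lambda>x v. P (f x) (frechet_derivative g (at x) v) +
      P (frechet_derivative f (at x) v) (g x)"])
    show "((\<lambda>x. P (f x) (g x)) has_derivative (\<lambda>v. P (f x) (frechet_derivative g (at x) v) +
      P (frechet_derivative f (at x) v) (g x))) (at x)" if "x \<in> S" for x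
      using bounded_bilinear.FDERIV[OF P Ck_on_SucD(1)[OF Suc.prems(1) that] Ck_on_SucD(1)[OF Suc.prems(2) that]] .
    show "Ck_on k S (\<lambda>x. P (f x) (frechet_derivative g (at x) v) +
      P (frechet_derivative f (at x) v) (g x))" for v
      by (intro Ck_on_add S Suc.IH Ck_on_SucD(2)[OF Suc.prems(1)] Ck_on_SucD(2)[OF Suc.prems(2)]
          Ck_on_Suc_imp[OF Suc.prems(1)] Ck_on_Suc_imp[OF Suc.prems(2)])
  qed
qed

lemma Ck_on_Pair:
  assumes S: "open S"
  shows "Ck_on k S f \<Longrightarrow> Ck_on k S g \<Longrightarrow> Ck_on k S (\<lambda>x. (f x, g x))"
proof (induction k arbitrary: f g)
  case 0
  then show ?case by (auto intro: continuous_on_Pair)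
next
  case (Suc k)
  show ?case
    by (rule Ck_on_SucI[OF S,
          where f' = "\<lambda>x v. (frechet_derivative f (at x) v, frechet_derivative g (at x) v)"])
       (rule has_derivative_Pair Ck_on_SucD(1)[OF Suc.prems(1)] Ck_on_SucD(1)[OF Suc.prems(2)] Suc.IH
         Ck_on_SucD(2)[OF Suc.prems(1)] Ck_on_SucD(2)[OF Suc.prems(2)] | assumption)+
qed

text \<open>The directional derivatives of the outer function are only known along fixed vectors, so
  \<open>Df x v\<close> is expanded in a basis of the middle space.\<close>
lemma Ck_on_compose:
  fixes f :: "'a::real_normed_vector \<Rightarrow> 'b::real_normed_vector"
    and g :: "'b \<Rightarrow> 'c::real_normed_vector"
  assumes fd: "finite_dim TYPE('b)" and S: "open S" and T: "open T" and ST: "f ` S \<subseteq> T"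
  shows "Ck_on k S f \<Longrightarrow> Ck_on k T g \<Longrightarrow> Ck_on k S (\<lambda>x. g (f x))"
proof (induction k arbitrary: g)
  case 0
  then show ?case using continuous_on_compose2 ST by simp blast
next
  case (Suc k)
  obtain B :: "'b set" and \<phi> where B: "finite B" "\<And>b. b \<in> B \<Longrightarrow> bounded_linear (\<phi> b)"
    "\<And>x. (\<Sum>b\<in>B. \<phi> b x *\<^sub>R b) = x" using fd by (rule finite_dimE) (rule that)
  let ?D = "\<lambda>x v. \<Sum>b\<in>B. \<phi> b (frechet_derivative f (at x) v) *\<^sub>R frechet_derivative g (at (f x)) b"
  show ?case
  proof (rule Ck_on_SucI[OF S, where f' = ?D])
    show "((\<lambda>x. g (f x)) has_derivative ?D x) (at x)" if x: "x \<in> S" for x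
    proof -
      have g: "(g has_derivative frechet_derivative g (at (f x))) (at (f x))"
        using Ck_on_SucD(1)[OF Suc.prems(2)] ST x by blast
      have "((\<lambda>x. g (f x)) has_derivative (\<lambda>v. frechet_derivative g (at (f x)) (frechet_derivative f (at x) v))) (at x)"
        by (rule has_derivative_compose[OF Ck_on_SucD(1)[OF Suc.prems(1) x] g])
      also have "(\<lambda>v. frechet_derivative g (at (f x)) (frechet_derivative f (at x) v)) = ?D x"
      proof
        fix v
        have l: "linear (frechet_derivative g (at (f x)))" using g has_derivative_linear by blast
        have "frechet_derivative g (at (f x)) (frechet_derivative f (at x) v) =
          frechet_derivative g (at (f x)) (\<Sum>b\<in>B. \<phi> b (frechet_derivative f (at x) v) *\<^sub>R b)"
          by (simp only: B(3))
        also have "\<dots> = ?D x v" by (simp add: linear_sum[OF l] linear_scale[OF l])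
        finally show "frechet_derivative g (at (f x)) (frechet_derivative f (at x) v) = ?D x v" .
      qed
      finally show ?thesis .
    qed
    show "Ck_on k S (\<lambda>x. ?D x v)" for v
    proof (rule Ck_on_sum[OF S])
      fix b assume b: "b \<in> B"
      show "Ck_on k S (\<lambda>x. \<phi> b (frechet_derivative f (at x) v) *\<^sub>R frechet_derivative g (at (f x)) b)"
        by (rule Ck_on_bilinear[OF bounded_bilinear_scaleR S])
           (rule Ck_on_bounded_linear[OF B(2)[OF b] S] Ck_on_SucD(2)[OF Suc.prems(1)] Suc.IH
              Ck_on_SucD(2)[OF Suc.prems(2)] Ck_on_Suc_imp[OF Suc.prems(1)])+
    qed
  qed
qed

lemma smooth_onD: "smooth_on S f \<Longrightarrow> Ck_on k S f"
  by (simp add: smooth_on_def)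

lemma smooth_on_cong: "open S \<Longrightarrow> (\<And>x. x \<in> S \<Longrightarrow> f x = g x) \<Longrightarrow> smooth_on S f \<Longrightarrow> smooth_on S g"
  unfolding smooth_on_def using Ck_on_cong by blast

lemma smooth_on_subset: "smooth_on T f \<Longrightarrow> S \<subseteq> T \<Longrightarrow> smooth_on S f"
  unfolding smooth_on_def using Ck_on_subset by blast

lemma smooth_on_local:
  assumes "\<And>x. x \<in> S \<Longrightarrow> \<exists>W. open W \<and> x \<in> W \<and> smooth_on W f"
  shows "smooth_on S f"
  unfolding smooth_on_def by (intro allI Ck_on_local) (use assms in \<open>auto simp: smooth_on_def\<close>)

lemma smooth_on_const: "smooth_on S (\<lambda>x. c)"
  unfolding smooth_on_def by (simp add: Ck_on_const)

lemma smooth_on_linear: "bounded_linear f \<Longrightarrow> open S \<Longrightarrow> smooth_on S f"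
  unfolding smooth_on_def by (simp add: Ck_on_linear_id)

lemma smooth_on_bounded_linear:
  "bounded_linear L \<Longrightarrow> open S \<Longrightarrow> smooth_on S f \<Longrightarrow> smooth_on S (\<lambda>x. L (f x))"
  unfolding smooth_on_def by (simp add: Ck_on_bounded_linear)

lemma smooth_on_add:
  "open S \<Longrightarrow> smooth_on S f \<Longrightarrow> smooth_on S g \<Longrightarrow> smooth_on S (\<lambda>x. f x + g x)"
  unfolding smooth_on_def by (simp add: Ck_on_add)

lemma smooth_on_sum:
  "open S \<Longrightarrow> (\<And>i. i \<in> I \<Longrightarrow> smooth_on S (f i)) \<Longrightarrow> smooth_on S (\<lambda>x. \<Sum>i\<in>I. f i x)"
  unfolding smooth_on_def by (simp add: Ck_on_sum)

lemma smooth_on_scaleR: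
  "open S \<Longrightarrow> smooth_on S f \<Longrightarrow> smooth_on S g \<Longrightarrow> smooth_on S (\<lambda>x. f x *\<^sub>R g x)"
  unfolding smooth_on_def by (simp add: Ck_on_bilinear[OF bounded_bilinear_scaleR])

lemma smooth_on_Pair:
  "open S \<Longrightarrow> smooth_on S f \<Longrightarrow> smooth_on S g \<Longrightarrow> smooth_on S (\<lambda>x. (f x, g x))"
  unfolding smooth_on_def by (simp add: Ck_on_Pair)

lemma smooth_on_compose:
  fixes f :: "'a::real_normed_vector \<Rightarrow> 'b::real_normed_vector"
  assumes "finite_dim TYPE('b)" "open S" "open T" "f ` S \<subseteq> T" "smooth_on S f" "smooth_on T g"
  shows "smooth_on S (\<lambda>x. g (f x))"
  unfolding smooth_on_def
  by (rule allI) (rule Ck_on_compose[OF assms(1-4) smooth_onD[OF assms(5)] smooth_onD[OF assms(6)]])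

lemma smooth_on_frechet:
  assumes "smooth_on S f"
  shows "smooth_on S (\<lambda>x. frechet_derivative f (at x) v)"
  unfolding smooth_on_def
  by (rule allI) (rule Ck_on_SucD(2)[OF smooth_onD[OF assms]])

lemma smooth_on_has_derivative:
  assumes "smooth_on S f" "x \<in> S"
  shows "(f has_derivative frechet_derivative f (at x)) (at x)"
  by (rule Ck_on_SucD(1)[where k = 0, OF smooth_onD[OF assms(1)] assms(2)])

lemma smooth_on_differentiable: "smooth_on S f \<Longrightarrow> x \<in> S \<Longrightarrow> f differentiable at x"
  using smooth_on_has_derivative differentiableI by blast

lemma smooth_on_continuous: "smooth_on S f \<Longrightarrow> continuous_on S f"
  unfolding smooth_on_def by (metis Ck_on.simps(1))

text \<open>\<open>smooth_on_frechet\<close> differentiates in a fixed direction; a direction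
  varying with \<open>x\<close> is expanded in a finite basis with smooth coefficients. The use is
  the derivative of a group action applied to a vector field.\<close>

lemma smooth_on_frechet_field:
  fixes w :: "'a::real_normed_vector \<Rightarrow> 'b::real_normed_vector"
  assumes fd: "finite_dim TYPE('b)" and S: "open S" and T: "open T" and ST: "f ` S \<subseteq> T"
    and "smooth_on S f" "smooth_on S w" "smooth_on T g"
  shows "smooth_on S (\<lambda>x. frechet_derivative g (at (f x)) (w x))"
proof -
  obtain B :: "'b set" and \<phi> where B: "finite B" "\<And>b. b \<in> B \<Longrightarrow> bounded_linear (\<phi> b)"
    "\<And>x. (\<Sum>b\<in>B. \<phi> b x *\<^sub>R b) = x" using fd by (rule finite_dimE) (rule that)
  have "smooth_on S (\<lambda>x. \<Sum>b\<in>B. \<phi> b (w x) *\<^sub>R frechet_derivative g (at (f x)) b)"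
  proof (intro smooth_on_sum smooth_on_scaleR S)
    fix b assume b: "b \<in> B"
    show "smooth_on S (\<lambda>x. \<phi> b (w x))" by (rule smooth_on_bounded_linear[OF B(2)[OF b] S assms(6)])
    show "smooth_on S (\<lambda>x. frechet_derivative g (at (f x)) b)"
      by (rule smooth_on_compose[OF fd S T ST assms(5) smooth_on_frechet[OF assms(7)]])
  qed
  then show ?thesis
  proof (rule smooth_on_cong[OF S, rotated])
    fix x assume "x \<in> S"
    then have l: "linear (frechet_derivative g (at (f x)))"
      using smooth_on_has_derivative[OF assms(7)] ST has_derivative_linear by blast
    have "frechet_derivative g (at (f x)) (w x) =
          frechet_derivative g (at (f x)) (\<Sum>b\<in>B. \<phi> b (w x) *\<^sub>R b)"
      by (simp only: B(3))
    also have "\<dots> = (\<Sum>b\<in>B. \<phi> b (w x) *\<^sub>R frechet_derivative g (at (f x)) b)"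
      by (simp add: linear_sum[OF l] linear_scale[OF l])
    finally show "(\<Sum>b\<in>B. \<phi> b (w x) *\<^sub>R frechet_derivative g (at (f x)) b) =
      frechet_derivative g (at (f x)) (w x)" by simp
  qed
qed

lemma open_preimage_on:
  "continuous_on S f \<Longrightarrow> open S \<Longrightarrow> open T \<Longrightarrow> open {x \<in> S. f x \<in> T}"
  using continuous_open_preimage[of S f T] by (simp add: vimage_def Int_def)

section \<open>Atlases and smooth maps\<close>

text \<open>Both sides choose from the same set of derivatives, so equality holds even where that
  set is empty.\<close>

lemma frechet_derivative_cong:
  assumes "open S" "x \<in> S" "\<And>y. y \<in> S \<Longrightarrow> f y = g y"
  shows "frechet_derivative f (at x) = frechet_derivative g (at x)"
proof -
  have "(f has_derivative D) (at x) \<longleftrightarrow> (g has_derivative D) (at x)" for D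
    using has_derivative_transform_within_open[of f D x UNIV S g]
      has_derivative_transform_within_open[of g D x UNIV S f] assms by auto
  then show ?thesis unfolding frechet_derivative_def by presburger
qed

lemma charts_at_iff: "c \<in> charts_at A x \<longleftrightarrow> c \<in> A \<and> x \<in> dom_of c"
  by (simp add: charts_at_def)

lemma points_iff: "x \<in> points A \<longleftrightarrow> (\<exists>c. c \<in> charts_at A x)"
  unfolding points_def charts_at_def by blast

text \<open>The chart-level content of \<open>smooth_manifold\<close>, which products and cotangent
  bundles inherit by computation in charts. The Hausdorff property travels separately as a
  hypothesis on \<open>manifold_topology\<close>.\<close>

definition smooth_atlas :: "('m, 'e::real_normed_vector) atlas \<Rightarrow> bool" where
  "smooth_atlas A \<longleftrightarrow> finite_dim TYPE('e) \<and>
     (\<forall>c\<in>A. inj_on (coords c) (dom_of c) \<and> open (coords c ` dom_of c)) \<and>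
     (\<forall>c\<in>A. \<forall>c'\<in>A. open (coords c ` (dom_of c \<inter> dom_of c')) \<and>
        smooth_on (coords c ` (dom_of c \<inter> dom_of c')) (\<lambda>u. coords c' (point_of c u)))"

lemma smooth_manifold_atlas: "smooth_manifold A \<Longrightarrow> smooth_atlas A"
  unfolding smooth_manifold_def smooth_atlas_def using finite_dim_if_span by (auto simp: o_def)

lemma smooth_atlasD:
  fixes A :: "('m, 'e::real_normed_vector) atlas"
  assumes "smooth_atlas A"
  shows "finite_dim TYPE('e)"
    "c \<in> A \<Longrightarrow> inj_on (coords c) (dom_of c)"
    "c \<in> A \<Longrightarrow> open (coords c ` dom_of c)"
    "c \<in> A \<Longrightarrow> c' \<in> A \<Longrightarrow> open (coords c ` (dom_of c \<inter> dom_of c'))"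
    "c \<in> A \<Longrightarrow> c' \<in> A \<Longrightarrow>
      smooth_on (coords c ` (dom_of c \<inter> dom_of c')) (\<lambda>u. coords c' (point_of c u))"
  using assms unfolding smooth_atlas_def by auto

lemma point_of_coords:
  assumes "smooth_atlas A" "c \<in> A" "x \<in> dom_of c"
  shows "point_of c (coords c x) = x"
  unfolding point_of_def using smooth_atlasD(2)[OF assms(1,2)] assms(3) by (rule inv_into_f_f)

lemma coords_point_of: "u \<in> coords c ` dom_of c \<Longrightarrow> coords c (point_of c u) = u"
  unfolding point_of_def by (rule f_inv_into_f)

lemma point_of_in_dom: "u \<in> coords c ` dom_of c \<Longrightarrow> point_of c u \<in> dom_of c"
  unfolding point_of_def by (rule inv_into_into)

text \<open>Smoothness is localised at a point because velocities and tangent maps live there, and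
  because the one-parameter subgroups first obtained from an ODE are smooth only near 0.\<close>

definition smooth_at ::
  "('m, 'e::real_normed_vector) atlas \<Rightarrow> ('n, 'f::real_normed_vector) atlas \<Rightarrow> ('m \<Rightarrow> 'n) \<Rightarrow> 'm \<Rightarrow> bool" where
  "smooth_at A B F x \<longleftrightarrow> (\<exists>c\<in>charts_at A x. \<exists>c'\<in>charts_at B (F x). \<exists>W.
        open W \<and> coords c x \<in> W \<and> W \<subseteq> coords c ` dom_of c \<and>
        F ` (point_of c ` W) \<subseteq> dom_of c' \<and>
        smooth_on W (\<lambda>u. coords c' (F (point_of c u))))"

lemma smooth_map_iff:
  "smooth_map A B F \<longleftrightarrow> F ` points A \<subseteq> points B \<and> (\<forall>x\<in>points A. smooth_at A B F x)"
  by (simp add: smooth_map_def smooth_at_def o_def)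

lemma smooth_mapD: "smooth_map A B F \<Longrightarrow> x \<in> points A \<Longrightarrow> smooth_at A B F x"
  "smooth_map A B F \<Longrightarrow> x \<in> points A \<Longrightarrow> F x \<in> points B"
  by (auto simp: smooth_map_iff)

lemma smooth_at_points: "smooth_at A B F x \<Longrightarrow> x \<in> points A \<and> F x \<in> points B"
  unfolding smooth_at_def points_iff by blast

lemma smooth_mapI: "(\<And>x. x \<in> points A \<Longrightarrow> smooth_at A B F x) \<Longrightarrow> smooth_map A B F"
  using smooth_at_points by (fastforce simp: smooth_map_iff)

text \<open>Smoothness witnessed in charts \<open>d\<close>, \<open>d'\<close> is moved to any other
  pair around the same points by composing with coordinate changes on both sides. The neighbourhood
  shrinks twice: to \<open>W1\<close>, where the change from \<open>c\<close> to \<open>d\<close>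
  lands in the original \<open>W0\<close>, and to \<open>W\<close>, where the values also lie in the
  overlap of \<open>d'\<close> with \<open>c'\<close>.\<close>

lemma smooth_at_chart:
  fixes A :: "('m, 'e::real_normed_vector) atlas" and B :: "('n, 'f::real_normed_vector) atlas"
  assumes A: "smooth_atlas A" and B: "smooth_atlas B" and F: "smooth_at A B F x"
    and c: "c \<in> charts_at A x" and c': "c' \<in> charts_at B (F x)"
  obtains W where "open W" "coords c x \<in> W" "W \<subseteq> coords c ` dom_of c"
    "\<And>u. u \<in> W \<Longrightarrow> F (point_of c u) \<in> dom_of c'"
    "smooth_on W (\<lambda>u. coords c' (F (point_of c u)))"
proof -
  obtain d d' W0 where d: "d \<in> charts_at A x" "d' \<in> charts_at B (F x)"
    and W0: "open W0" "coords d x \<in> W0" "W0 \<subseteq> coords d ` dom_of d" "F ` (point_of d ` W0) \<subseteq> dom_of d'"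
      "smooth_on W0 (\<lambda>u. coords d' (F (point_of d u)))"
    using F unfolding smooth_at_def by blast
  have cA: "c \<in> A" "x \<in> dom_of c" "d \<in> A" "x \<in> dom_of d"
    and cB: "c' \<in> B" "F x \<in> dom_of c'" "d' \<in> B" "F x \<in> dom_of d'"
    using c c' d by (auto simp: charts_at_iff)
  let ?D = "coords c ` (dom_of c \<inter> dom_of d)" and ?D' = "coords d' ` (dom_of d' \<inter> dom_of c')"
  let ?\<tau> = "\<lambda>u. coords d (point_of c u)" and ?f = "\<lambda>u. coords d' (F (point_of c u))"
  let ?g = "\<lambda>u. coords d' (F (point_of d u))"
  note \<tau> = smooth_atlasD(4,5)[OF A cA(1,3)] and \<sigma> = smooth_atlasD(4,5)[OF B cB(3,1)]
  define W1 where "W1 = {u \<in> ?D. ?\<tau> u \<in> W0}"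
  have W1: "open W1" unfolding W1_def
    by (rule open_preimage_on[OF smooth_on_continuous[OF \<tau>(2)] \<tau>(1) W0(1)])
  have pt: "point_of d (?\<tau> u) = point_of c u" if "u \<in> ?D" for u
    using that point_of_coords[OF A cA(1)] point_of_coords[OF A cA(3)] by auto
  have "smooth_on W1 (\<lambda>u. ?g (?\<tau> u))"
    by (rule smooth_on_compose[OF smooth_atlasD(1)[OF A] W1 W0(1) _ _ W0(5)])
       (auto simp: W1_def intro: smooth_on_subset[OF \<tau>(2)])
  then have f: "smooth_on W1 ?f"
    by (rule smooth_on_cong[OF W1, rotated]) (use pt in \<open>auto simp: W1_def\<close>)
  define W where "W = {u \<in> W1. ?f u \<in> ?D'}"
  have W: "open W" unfolding W_def
    by (rule open_preimage_on[OF smooth_on_continuous[OF f] W1 \<sigma>(1)])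
  have Fd: "F (point_of c u) \<in> dom_of d'" if "u \<in> W1" for u
    using that W0(4) pt[of u] unfolding W1_def by force
  \<comment> \<open>The definition of \<open>W\<close> only places the coordinates in the image of
    the overlap; injectivity of \<open>coords d'\<close> places the point itself there.\<close>
  have FW: "F (point_of c u) \<in> dom_of c'" if u: "u \<in> W" for u
  proof -
    obtain y where "y \<in> dom_of d'" "y \<in> dom_of c'" "?f u = coords d' y" using u unfolding W_def by blast
    moreover have "F (point_of c u) \<in> dom_of d'" using Fd u unfolding W_def by blast
    ultimately show ?thesis using smooth_atlasD(2)[OF B cB(3)] by (metis inj_onD)
  qed
  have "smooth_on W (\<lambda>u. coords c' (point_of d' (?f u)))"
    by (rule smooth_on_compose[OF smooth_atlasD(1)[OF B] W \<sigma>(1) _ _ \<sigma>(2)])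
       (auto simp: W_def intro: smooth_on_subset[OF f])
  then have s: "smooth_on W (\<lambda>u. coords c' (F (point_of c u)))"
    by (rule smooth_on_cong[OF W, rotated])
       (use point_of_coords[OF B cB(3)] Fd in \<open>auto simp: W_def\<close>)
  have x1: "coords c x \<in> W1" "point_of c (coords c x) = x"
    using cA W0(2) point_of_coords[OF A cA(1,2)] unfolding W1_def by auto
  then have "coords c x \<in> W" using cB unfolding W_def by auto
  moreover have "W \<subseteq> coords c ` dom_of c" unfolding W_def W1_def by auto
  ultimately show thesis by (rule that[OF W _ _ FW s])
qed

text \<open>The local representatives patch together on the whole set where the representative makes
  sense; openness of that set is the continuity of \<open>F\<close> in chart form.\<close>

lemma smooth_rep:
  assumes A: "smooth_atlas A" and B: "smooth_atlas B" and c: "c \<in> A" and c': "c' \<in> B"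
    and F: "\<And>x. x \<in> dom_of c \<Longrightarrow> F x \<in> dom_of c' \<Longrightarrow> smooth_at A B F x"
  shows "open {u \<in> coords c ` dom_of c. F (point_of c u) \<in> dom_of c'}"
    "smooth_on {u \<in> coords c ` dom_of c. F (point_of c u) \<in> dom_of c'} (\<lambda>u. coords c' (F (point_of c u)))"
proof -
  let ?S = "{u \<in> coords c ` dom_of c. F (point_of c u) \<in> dom_of c'}"
  have *: "\<exists>W. open W \<and> u \<in> W \<and> W \<subseteq> ?S \<and> smooth_on W (\<lambda>u. coords c' (F (point_of c u)))"
    if u: "u \<in> ?S" for u
  proof -
    let ?x = "point_of c u"
    have x: "?x \<in> dom_of c" "F ?x \<in> dom_of c'" "coords c ?x = u"
      using u point_of_in_dom[of u c] coords_point_of[of u c] by auto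
    then have cx: "c \<in> charts_at A ?x" "c' \<in> charts_at B (F ?x)" using c c' by (auto simp: charts_at_iff)
    obtain W where "open W" "coords c ?x \<in> W" "W \<subseteq> coords c ` dom_of c"
      "\<And>u. u \<in> W \<Longrightarrow> F (point_of c u) \<in> dom_of c'"
      "smooth_on W (\<lambda>u. coords c' (F (point_of c u)))" by (rule smooth_at_chart[OF A B F[OF x(1,2)] cx]) (rule that)
    then show ?thesis using x(3) by (intro exI[of _ W]) auto
  qed
  show "open ?S" by (subst open_subopen) (use * in blast)
  show "smooth_on ?S (\<lambda>u. coords c' (F (point_of c u)))"
    by (rule smooth_on_local) (use * in blast)
qed

lemma smooth_atI:
  assumes "c \<in> charts_at A x" "c' \<in> charts_at B (F x)" "open W" "coords c x \<in> W"
    "\<And>u. u \<in> W \<Longrightarrow> u \<in> coords c ` dom_of c" "\<And>u. u \<in> W \<Longrightarrow> F (point_of c u) \<in> dom_of c'"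
    "smooth_on W (\<lambda>u. coords c' (F (point_of c u)))"
  shows "smooth_at A B F x"
  unfolding smooth_at_def using assms
  by (intro bexI[of _ c] bexI[of _ c'] exI[of _ W]) auto

lemma smooth_at_compose:
  fixes A :: "('m, 'e::real_normed_vector) atlas" and B :: "('n, 'f::real_normed_vector) atlas"
    and C :: "('k, 'g::real_normed_vector) atlas"
  assumes A: "smooth_atlas A" and B: "smooth_atlas B" and C: "smooth_atlas C"
    and F: "smooth_at A B F x" and G: "smooth_at B C G (F x)"
  shows "smooth_at A C (\<lambda>x. G (F x)) x"
proof -
  obtain c where c: "c \<in> charts_at A x" using F unfolding smooth_at_def by blast
  obtain c' c'' where c': "c' \<in> charts_at B (F x)" and c'': "c'' \<in> charts_at C (G (F x))"
    using G unfolding smooth_at_def by blast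
  obtain W where W: "open W" "coords c x \<in> W" "W \<subseteq> coords c ` dom_of c"
    "\<And>u. u \<in> W \<Longrightarrow> F (point_of c u) \<in> dom_of c'" "smooth_on W (\<lambda>u. coords c' (F (point_of c u)))"
    by (rule smooth_at_chart[OF A B F c c']) (rule that)
  obtain V where V: "open V" "coords c' (F x) \<in> V" "V \<subseteq> coords c' ` dom_of c'"
    "\<And>u. u \<in> V \<Longrightarrow> G (point_of c' u) \<in> dom_of c''" "smooth_on V (\<lambda>u. coords c'' (G (point_of c' u)))"
    by (rule smooth_at_chart[OF B C G c' c'']) (rule that)
  let ?f = "\<lambda>u. coords c' (F (point_of c u))"
  define U where "U = {u \<in> W. ?f u \<in> V}"
  have U: "open U" unfolding U_def by (rule open_preimage_on[OF smooth_on_continuous[OF W(5)] W(1) V(1)])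
  have pt: "point_of c' (?f u) = F (point_of c u)" if "u \<in> U" for u
    using that W(4) point_of_coords[OF B] c' by (auto simp: charts_at_iff U_def)
  have "smooth_on U (\<lambda>u. coords c'' (G (point_of c' (?f u))))"
    by (rule smooth_on_compose[OF smooth_atlasD(1)[OF B] U V(1) _ _ V(5)])
       (auto simp: U_def intro: smooth_on_subset[OF W(5)])
  then have s: "smooth_on U (\<lambda>u. coords c'' (G (F (point_of c u))))"
    by (rule smooth_on_cong[OF U, rotated]) (use pt in auto)
  show ?thesis
  proof (rule smooth_atI[OF c c'' U _ _ _ s])
    show "coords c x \<in> U" using W(2) V(2) c point_of_coords[OF A] by (auto simp: U_def charts_at_iff)
    show "G (F (point_of c u)) \<in> dom_of c''" if "u \<in> U" for u
      using V(4)[of "?f u"] pt[OF that] that by (auto simp: U_def)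
  qed (use W(3) in \<open>auto simp: U_def\<close>)
qed

lemma smooth_map_compose:
  assumes "smooth_atlas A" "smooth_atlas B" "smooth_atlas C" "smooth_map A B F" "smooth_map B C G"
  shows "smooth_map A C (\<lambda>x. G (F x))"
  by (rule smooth_mapI, rule smooth_at_compose[OF assms(1-3)])
    (use assms(4,5) in \<open>auto dest: smooth_mapD\<close>)

lemma smooth_at_cong:
  assumes A: "smooth_atlas A" and B: "smooth_atlas B" and F: "smooth_at A B F x" and c: "c \<in> charts_at A x"
    and U: "open U" "coords c x \<in> U"
    and eq: "\<And>y. y \<in> dom_of c \<Longrightarrow> coords c y \<in> U \<Longrightarrow> F y = G y"
  shows "smooth_at A B G x"
proof -
  obtain c' where c': "c' \<in> charts_at B (F x)" using F unfolding smooth_at_def by blast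
  obtain W where W: "open W" "coords c x \<in> W" "W \<subseteq> coords c ` dom_of c"
    "\<And>u. u \<in> W \<Longrightarrow> F (point_of c u) \<in> dom_of c'" "smooth_on W (\<lambda>u. coords c' (F (point_of c u)))"
    by (rule smooth_at_chart[OF A B F c c']) (rule that)
  have eq': "F (point_of c u) = G (point_of c u)" if "u \<in> U \<inter> W" for u
  proof -
    have "u \<in> coords c ` dom_of c" "u \<in> U" using that W(3) by auto
    then show ?thesis using eq[OF point_of_in_dom[of u c]] coords_point_of[of u c] by simp
  qed
  have s: "smooth_on (U \<inter> W) (\<lambda>u. coords c' (G (point_of c u)))"
    by (rule smooth_on_cong[OF _ _ smooth_on_subset[OF W(5)]]) (use U W(1) eq' in auto)
  have "G x = F x" using eq[of x] U c by (auto simp: charts_at_iff)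
  then have "c' \<in> charts_at B (G x)" using c' by simp
  moreover have "G (point_of c u) \<in> dom_of c'" if "u \<in> U \<inter> W" for u
    using W(4)[of u] eq'[OF that] that by simp
  ultimately show ?thesis
    by (intro smooth_atI[OF c _ _ _ _ _ s]) (use U W(1-3) in auto)
qed

lemma smooth_at_cong_points:
  assumes "smooth_atlas A" "smooth_atlas B" "smooth_at A B F x" "\<And>y. y \<in> points A \<Longrightarrow> F y = G y"
  shows "smooth_at A B G x"
proof -
  obtain c where "c \<in> charts_at A x" using assms(3) unfolding smooth_at_def by blast
  then show ?thesis
  proof (rule smooth_at_cong[OF assms(1-3) _ open_UNIV UNIV_I])
    fix y assume "y \<in> dom_of c"
    then have "y \<in> points A" using \<open>c \<in> charts_at A x\<close> unfolding points_iff charts_at_iff by blast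
    then show "F y = G y" by (rule assms(4))
  qed
qed

lemma smooth_map_cong:
  assumes "smooth_atlas A" "smooth_atlas B" "smooth_map A B F" "\<And>y. y \<in> points A \<Longrightarrow> F y = G y"
  shows "smooth_map A B G"
  by (rule smooth_mapI, rule smooth_at_cong_points[of A B F]) (use assms in \<open>auto dest: smooth_mapD\<close>)

lemma smooth_at_id: "smooth_atlas A \<Longrightarrow> x \<in> points A \<Longrightarrow> smooth_at A A (\<lambda>x. x) x"
proof -
  assume A: "smooth_atlas A" and "x \<in> points A"
  then obtain c where c: "c \<in> A" "x \<in> dom_of c" by (auto simp: points_def)
  have "smooth_on (coords c ` dom_of c) (\<lambda>u. coords c (point_of c u))"
    by (rule smooth_on_cong[OF _ _ smooth_on_linear[OF bounded_linear_ident]])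
       (use smooth_atlasD(3)[OF A c(1)] coords_point_of[of _ c] in auto)
  then show ?thesis
    by (intro smooth_atI[of c A x c A "\<lambda>x. x" "coords c ` dom_of c"])
       (use c smooth_atlasD(3)[OF A c(1)] point_of_in_dom[of _ c] in \<open>auto simp: charts_at_iff\<close>)
qed

lemma smooth_at_const:
  assumes A: "smooth_atlas A" and B: "smooth_atlas B" and x: "x \<in> points A" and y: "y \<in> points B"
  shows "smooth_at A B (\<lambda>_. y) x"
proof -
  obtain c where c: "c \<in> A" "x \<in> dom_of c" using x by (auto simp: points_def)
  obtain c' where c': "c' \<in> B" "y \<in> dom_of c'" using y by (auto simp: points_def)
  show ?thesis
    by (intro smooth_atI[of c A x c' B "\<lambda>x. y" "coords c ` dom_of c"])
       (use c c' smooth_atlasD(3)[OF A c(1)] smooth_on_const in \<open>auto simp: charts_at_iff\<close>)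
qed

section \<open>Vector spaces as manifolds, curves and functions\<close>

lemma points_euclid [simp]: "points euclid_atlas = UNIV"
  by (simp add: points_def euclid_atlas_def)

lemma charts_at_euclid [simp]: "charts_at euclid_atlas x = {(UNIV, \<lambda>x. x)}"
  by (auto simp: charts_at_def euclid_atlas_def)

lemma point_of_euclid [simp]: "point_of (UNIV, \<lambda>x. x) = (\<lambda>u. u)"
  by (rule ext) (metis coords_point_of fst_conv image_ident iso_tuple_UNIV_I snd_conv)

lemma smooth_atlas_euclid: "finite_dim TYPE('a::real_normed_vector) \<Longrightarrow> smooth_atlas (euclid_atlas :: ('a, 'a) atlas)"
  by (auto simp: smooth_atlas_def euclid_atlas_def smooth_on_linear)

lemma smooth_atlas_real: "smooth_atlas (euclid_atlas :: (real, real) atlas)"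
  by (rule smooth_atlas_euclid[OF finite_dim_euclidean])

lemma smooth_at_curveE:
  fixes \<gamma> :: "'a::real_normed_vector \<Rightarrow> 'm"
  assumes "finite_dim TYPE('a)" "smooth_atlas A" "smooth_at euclid_atlas A \<gamma> t" "c \<in> charts_at A (\<gamma> t)"
  obtains W where "open W" "t \<in> W" "\<And>s. s \<in> W \<Longrightarrow> \<gamma> s \<in> dom_of c" "smooth_on W (\<lambda>s. coords c (\<gamma> s))"
  using smooth_at_chart[OF smooth_atlas_euclid[OF assms(1)] assms(2,3) _ assms(4), of "(UNIV, \<lambda>x. x)"] by auto

lemma smooth_at_curveI:
  assumes "c \<in> charts_at A (\<gamma> t)" "open W" "t \<in> W" "\<And>s. s \<in> W \<Longrightarrow> \<gamma> s \<in> dom_of c"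
    "smooth_on W (\<lambda>s. coords c (\<gamma> s))"
  shows "smooth_at euclid_atlas A \<gamma> t"
  by (rule smooth_atI[of "(UNIV, \<lambda>x. x)" _ _ c]) (use assms in auto)

lemma smooth_at_fun:
  fixes f :: "'m \<Rightarrow> 'b::real_normed_vector"
  assumes "c \<in> charts_at A x" "open W" "coords c x \<in> W" "W \<subseteq> coords c ` dom_of c"
    "smooth_on W (\<lambda>u. f (point_of c u))"
  shows "smooth_at A euclid_atlas f x"
  by (rule smooth_atI[of c _ _ "(UNIV, \<lambda>x. x)"]) (use assms in auto)

section \<open>Product atlases\<close>

definition prod_chart :: "('m, 'e) chart \<Rightarrow> ('n, 'f) chart \<Rightarrow> ('m \<times> 'n, 'e \<times> 'f) chart" where
  "prod_chart c c' = (dom_of c \<times> dom_of c', \<lambda>(x, y). (coords c x, coords c' y))"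

lemma prod_chart_simps [simp]:
  "dom_of (prod_chart c c') = dom_of c \<times> dom_of c'"
  "coords (prod_chart c c') = (\<lambda>(x, y). (coords c x, coords c' y))"
  by (simp_all add: prod_chart_def)

lemma prod_atlas_alt: "prod_atlas A B = {prod_chart c c' | c c'. c \<in> A \<and> c' \<in> B}"
  by (simp add: prod_atlas_def prod_chart_def)

lemma image_prod_chart:
  "(\<lambda>(x, y). (f x, g y)) ` (S \<times> T) = f ` S \<times> g ` T"
  by auto

lemma points_prod [simp]: "points (prod_atlas A B) = points A \<times> points B"
  by (force simp: points_def prod_atlas_alt)

lemma prod_chart_in: "c \<in> charts_at A x \<Longrightarrow> c' \<in> charts_at B y \<Longrightarrow>
  prod_chart c c' \<in> charts_at (prod_atlas A B) (x, y)"
  unfolding charts_at_iff prod_atlas_alt prod_chart_simps by blast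

lemma point_of_prod:
  assumes "smooth_atlas A" "smooth_atlas B" "c \<in> A" "c' \<in> B"
    and u: "u \<in> coords c ` dom_of c" and v: "v \<in> coords c' ` dom_of c'"
  shows "point_of (prod_chart c c') (u, v) = (point_of c u, point_of c' v)"
proof -
  have "inj_on (coords (prod_chart c c')) (dom_of (prod_chart c c'))"
    using smooth_atlasD(2)[OF assms(1,3)] smooth_atlasD(2)[OF assms(2,4)] by (auto simp: inj_on_def)
  from inv_into_f_f[OF this, of "(point_of c u, point_of c' v)"]
  show ?thesis using point_of_in_dom[OF u] point_of_in_dom[OF v] coords_point_of[OF u] coords_point_of[OF v]
    by (simp add: point_of_def[of "prod_chart c c'"])
qed

lemma smooth_atlas_prod:
  fixes A :: "('m, 'e::real_normed_vector) atlas" and B :: "('n, 'f::real_normed_vector) atlas"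
  assumes A: "smooth_atlas A" and B: "smooth_atlas B"
  shows "smooth_atlas (prod_atlas A B)"
  unfolding smooth_atlas_def
proof (intro conjI ballI)
  show "finite_dim TYPE('e \<times> 'f)" using smooth_atlasD(1)[OF A] smooth_atlasD(1)[OF B] by (rule finite_dim_prod)
  fix k assume "k \<in> prod_atlas A B"
  then obtain c c' where k: "k = prod_chart c c'" and c: "c \<in> A" "c' \<in> B" by (auto simp: prod_atlas_alt)
  show "inj_on (coords k) (dom_of k)"
    using smooth_atlasD(2)[OF A c(1)] smooth_atlasD(2)[OF B c(2)] by (auto simp: k inj_on_def)
  show "open (coords k ` dom_of k)"
    using smooth_atlasD(3)[OF A c(1)] smooth_atlasD(3)[OF B c(2)] by (simp add: k image_prod_chart open_Times)
  fix l assume "l \<in> prod_atlas A B"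
  then obtain d d' where l: "l = prod_chart d d'" and d: "d \<in> A" "d' \<in> B" by (auto simp: prod_atlas_alt)
  let ?S = "coords c ` (dom_of c \<inter> dom_of d)" and ?T = "coords c' ` (dom_of c' \<inter> dom_of d')"
  note 1 = smooth_atlasD(4,5)[OF A c(1) d(1)] and 2 = smooth_atlasD(4,5)[OF B c(2) d(2)]
  have img: "coords k ` (dom_of k \<inter> dom_of l) = ?S \<times> ?T"
    by (simp add: k l Times_Int_Times image_prod_chart)
  show op: "open (coords k ` (dom_of k \<inter> dom_of l))" unfolding img by (intro open_Times 1 2)
  have op': "open (?S \<times> ?T)" using op img by simp
  have "smooth_on (?S \<times> ?T) (\<lambda>u. coords d (point_of c (fst u)))"
    by (rule smooth_on_compose[OF smooth_atlasD(1)[OF A] op' 1(1) _ _ 1(2)])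
       (auto intro!: smooth_on_linear[OF bounded_linear_fst] op')
  moreover have "smooth_on (?S \<times> ?T) (\<lambda>u. coords d' (point_of c' (snd u)))"
    by (rule smooth_on_compose[OF smooth_atlasD(1)[OF B] op' 2(1) _ _ 2(2)])
       (auto intro!: smooth_on_linear[OF bounded_linear_snd] op')
  ultimately have "smooth_on (?S \<times> ?T) (\<lambda>u. (coords d (point_of c (fst u)), coords d' (point_of c' (snd u))))"
    using smooth_on_Pair op' by blast
  then show "smooth_on (coords k ` (dom_of k \<inter> dom_of l)) (\<lambda>u. coords l (point_of k u))"
    unfolding img
  proof (rule smooth_on_cong[OF op', rotated])
    fix u assume "u \<in> ?S \<times> ?T"
    then have "point_of k (fst u, snd u) = (point_of c (fst u), point_of c' (snd u))"
      unfolding k by (intro point_of_prod[OF A B c]) auto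
    then show "(coords d (point_of c (fst u)), coords d' (point_of c' (snd u))) = coords l (point_of k u)"
      by (simp add: l)
  qed
qed

lemma smooth_at_fst:
  assumes A: "smooth_atlas A" and B: "smooth_atlas B" and "x \<in> points A" "y \<in> points B"
  shows "smooth_at (prod_atlas A B) A fst (x, y)"
proof -
  obtain c c' where c: "c \<in> charts_at A x" "c' \<in> charts_at B y" using assms(3,4) points_iff by metis
  then have cA: "c \<in> A" "c' \<in> B" by (auto simp: charts_at_iff)
  let ?W = "coords (prod_chart c c') ` dom_of (prod_chart c c')"
  have W: "open ?W" using smooth_atlasD(3)[OF smooth_atlas_prod[OF A B]] prod_chart_in[OF c]
    unfolding charts_at_iff by blast
  have pt: "point_of (prod_chart c c') u = (point_of c (fst u), point_of c' (snd u))" if "u \<in> ?W" for u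
    using point_of_prod[OF A B cA, of "fst u" "snd u"] that by (auto simp: image_prod_chart)
  have s: "smooth_on ?W (\<lambda>u. coords c (fst (point_of (prod_chart c c') u)))"
    by (rule smooth_on_cong[OF W _ smooth_on_linear[OF bounded_linear_fst W]])
       (use pt in \<open>auto simp: image_prod_chart coords_point_of\<close>)
  show ?thesis
    by (rule smooth_atI[OF prod_chart_in[OF c] _ W _ _ _ s])
       (use prod_chart_in[OF c] c pt point_of_in_dom[of _ c] point_of_in_dom[of _ c'] in \<open>auto simp: charts_at_iff image_prod_chart\<close>)
qed

lemma smooth_at_snd:
  assumes A: "smooth_atlas A" and B: "smooth_atlas B" and "x \<in> points A" "y \<in> points B"
  shows "smooth_at (prod_atlas A B) B snd (x, y)"
proof -
  obtain c c' where c: "c \<in> charts_at A x" "c' \<in> charts_at B y" using assms(3,4) points_iff by metis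
  then have cA: "c \<in> A" "c' \<in> B" by (auto simp: charts_at_iff)
  let ?W = "coords (prod_chart c c') ` dom_of (prod_chart c c')"
  have W: "open ?W" using smooth_atlasD(3)[OF smooth_atlas_prod[OF A B]] prod_chart_in[OF c]
    unfolding charts_at_iff by blast
  have pt: "point_of (prod_chart c c') u = (point_of c (fst u), point_of c' (snd u))" if "u \<in> ?W" for u
    using point_of_prod[OF A B cA, of "fst u" "snd u"] that by (auto simp: image_prod_chart)
  have s: "smooth_on ?W (\<lambda>u. coords c' (snd (point_of (prod_chart c c') u)))"
    by (rule smooth_on_cong[OF W _ smooth_on_linear[OF bounded_linear_snd W]])
       (use pt in \<open>auto simp: image_prod_chart coords_point_of\<close>)
  show ?thesis
    by (rule smooth_atI[OF prod_chart_in[OF c] _ W _ _ _ s])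
       (use prod_chart_in[OF c] c pt point_of_in_dom[of _ c] point_of_in_dom[of _ c'] in \<open>auto simp: charts_at_iff image_prod_chart\<close>)
qed

lemma smooth_at_Pair:
  assumes P: "smooth_atlas P" and A: "smooth_atlas A" and B: "smooth_atlas B"
    and f: "smooth_at P A f x" and g: "smooth_at P B g x"
  shows "smooth_at P (prod_atlas A B) (\<lambda>x. (f x, g x)) x"
proof -
  obtain c c' where c: "c \<in> charts_at P x" "c' \<in> charts_at A (f x)"
    using f unfolding smooth_at_def by blast
  obtain c'' where c'': "c'' \<in> charts_at B (g x)" using g unfolding smooth_at_def by blast
  obtain W where W: "open W" "coords c x \<in> W" "W \<subseteq> coords c ` dom_of c"
    "\<And>u. u \<in> W \<Longrightarrow> f (point_of c u) \<in> dom_of c'" "smooth_on W (\<lambda>u. coords c' (f (point_of c u)))"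
    by (rule smooth_at_chart[OF P A f c]) (rule that)
  obtain V where V: "open V" "coords c x \<in> V" "V \<subseteq> coords c ` dom_of c"
    "\<And>u. u \<in> V \<Longrightarrow> g (point_of c u) \<in> dom_of c''" "smooth_on V (\<lambda>u. coords c'' (g (point_of c u)))"
    by (rule smooth_at_chart[OF P B g c(1) c'']) (rule that)
  have "smooth_on (W \<inter> V) (\<lambda>u. (coords c' (f (point_of c u)), coords c'' (g (point_of c u))))"
    using W V by (intro smooth_on_Pair smooth_on_subset[OF W(5)] smooth_on_subset[OF V(5)]) auto
  then show ?thesis
    by (intro smooth_atI[where c = c and c' = "prod_chart c' c''" and W = "W \<inter> V"])
       (use W V c(1) prod_chart_in[OF c(2) c''] in auto)
qed

section \<open>Tangent vectors\<close>

lemma rep_derivative: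
  assumes A: "smooth_atlas A" and B: "smooth_atlas B" and F: "smooth_at A B F x"
    and c: "c \<in> charts_at A x" and c': "c' \<in> charts_at B (F x)"
  shows "((\<lambda>u. coords c' (F (point_of c u))) has_derivative
     frechet_derivative (\<lambda>u. coords c' (F (point_of c u))) (at (coords c x))) (at (coords c x))"
proof -
  obtain W where W: "open W" "coords c x \<in> W" "W \<subseteq> coords c ` dom_of c"
    "\<And>u. u \<in> W \<Longrightarrow> F (point_of c u) \<in> dom_of c'" "smooth_on W (\<lambda>u. coords c' (F (point_of c u)))"
    by (rule smooth_at_chart[OF A B F c c']) (rule that)
  show ?thesis by (rule smooth_on_has_derivative[OF W(5,2)])
qed

lemma rep_derivative_linear:
  assumes "smooth_atlas A" "smooth_atlas B" "smooth_at A B F x" "c \<in> charts_at A x" "c' \<in> charts_at B (F x)"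
  shows "bounded_linear (frechet_derivative (\<lambda>u. coords c' (F (point_of c u))) (at (coords c x)))"
  using rep_derivative[OF assms] has_derivative_bounded_linear by blast

text \<open>The chain rule with a free choice of the three charts. With \<open>F\<close> or
  \<open>G\<close> the identity it becomes the transformation law of components, and the
  independence-of-chart arguments below are such instances.\<close>

lemma rep_derivative_compose:
  assumes A: "smooth_atlas A" and B: "smooth_atlas B" and C: "smooth_atlas C"
    and F: "smooth_at A B F x" and G: "smooth_at B C G (F x)"
    and c: "c \<in> charts_at A x" and c': "c' \<in> charts_at B (F x)" and c'': "c'' \<in> charts_at C (G (F x))"
  shows "frechet_derivative (\<lambda>u. coords c'' (G (F (point_of c u)))) (at (coords c x)) w =
    frechet_derivative (\<lambda>u. coords c'' (G (point_of c' u))) (at (coords c' (F x)))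
      (frechet_derivative (\<lambda>u. coords c' (F (point_of c u))) (at (coords c x)) w)"
proof -
  let ?f = "\<lambda>u. coords c' (F (point_of c u))" and ?g = "\<lambda>u. coords c'' (G (point_of c' u))"
  obtain W where W: "open W" "coords c x \<in> W" "W \<subseteq> coords c ` dom_of c"
    "\<And>u. u \<in> W \<Longrightarrow> F (point_of c u) \<in> dom_of c'" "smooth_on W ?f"
    by (rule smooth_at_chart[OF A B F c c']) (rule that)
  have cx: "point_of c (coords c x) = x" using point_of_coords[OF A] c by (auto simp: charts_at_iff)
  have "(?g has_derivative frechet_derivative ?g (at (?f (coords c x)))) (at (?f (coords c x)))"
    using rep_derivative[OF B C G c' c''] cx by simp
  with rep_derivative[OF A B F c c']
  have "((\<lambda>u. ?g (?f u)) has_derivative (\<lambda>w. frechet_derivative ?g (at (?f (coords c x)))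
      (frechet_derivative ?f (at (coords c x)) w))) (at (coords c x))"
    by (rule has_derivative_compose)
  then have "((\<lambda>u. coords c'' (G (F (point_of c u)))) has_derivative
      (\<lambda>w. frechet_derivative ?g (at (?f (coords c x)))
      (frechet_derivative ?f (at (coords c x)) w))) (at (coords c x))"
    by (rule has_derivative_transform_within_open[OF _ W(1,2)])
       (use W(4) point_of_coords[OF B] c' in \<open>auto simp: charts_at_iff\<close>)
  from frechet_derivative_at[OF this] cx show ?thesis by metis
qed

lemma transition_derivative_id:
  assumes A: "smooth_atlas A" and c: "c \<in> charts_at A x"
  shows "frechet_derivative (\<lambda>u. coords c (point_of c u)) (at (coords c x)) w = w"
proof -
  have "open (coords c ` dom_of c)" "coords c x \<in> coords c ` dom_of c"
    using smooth_atlasD(3)[OF A] c by (auto simp: charts_at_iff)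
  then have "frechet_derivative (\<lambda>u. coords c (point_of c u)) (at (coords c x)) =
      frechet_derivative (\<lambda>u. u) (at (coords c x))"
    by (rule frechet_derivative_cong) (rule coords_point_of)
  then show ?thesis by simp
qed

section \<open>Tangent spaces and tangent maps\<close>

lemma tangent_spaceD:
  assumes "v \<in> tangent_space A x" "c \<in> charts_at A x" "c' \<in> charts_at A x"
  shows "v c' = frechet_derivative (\<lambda>u. coords c' (point_of c u)) (at (coords c x)) (v c)"
  using assms unfolding tangent_space_def mem_Collect_eq o_def by blast

lemma tangent_space_outside: "v \<in> tangent_space A x \<Longrightarrow> c \<notin> charts_at A x \<Longrightarrow> v c = 0"
  unfolding tangent_space_def by blast

lemma tangent_eqI:
  assumes "v \<in> tangent_space A x" "w \<in> tangent_space A x" "c \<in> charts_at A x" "v c = w c"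
  shows "v = w"
proof
  fix c' show "v c' = w c'"
    using tangent_spaceD[OF assms(1,3), of c'] tangent_spaceD[OF assms(2,3), of c'] assms(4)
      tangent_space_outside[OF assms(1), of c'] tangent_space_outside[OF assms(2), of c']
    by (cases "c' \<in> charts_at A x") auto
qed

lemma charts_at_points: "c \<in> charts_at A x \<Longrightarrow> x \<in> points A"
  unfolding points_iff by blast

text \<open>Components generated from a single chart transform correctly between any two charts by
  the chain rule, so it is enough to compare with one chart.\<close>

lemma tangent_spaceI:
  assumes A: "smooth_atlas A" and c: "c \<in> charts_at A x"
    and v: "\<And>c'. c' \<in> charts_at A x \<Longrightarrow>
      v c' = frechet_derivative (\<lambda>u. coords c' (point_of c u)) (at (coords c x)) w"
    and "\<And>c'. c' \<notin> charts_at A x \<Longrightarrow> v c' = 0"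
  shows "v \<in> tangent_space A x"
  unfolding tangent_space_def mem_Collect_eq o_def
proof (intro conjI ballI allI impI)
  have id: "smooth_at A A (\<lambda>x. x) x" using smooth_at_id[OF A charts_at_points[OF c]] .
  fix d d' assume d: "d \<in> charts_at A x" "d' \<in> charts_at A x"
  show "v d' = frechet_derivative (\<lambda>u. coords d' (point_of d u)) (at (coords d x)) (v d)"
    unfolding v[OF d(1)] v[OF d(2)]
    by (rule rep_derivative_compose[OF A A A id id c d])
qed (rule assms(4))

lemma coord_vec_in:
  assumes "smooth_atlas A" "c \<in> charts_at A x"
  shows "coord_vec A c x w \<in> tangent_space A x"
  by (rule tangent_spaceI[OF assms]) (auto simp: coord_vec_def o_def)

lemma coord_vec_self:
  assumes "smooth_atlas A" "c \<in> charts_at A x"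
  shows "coord_vec A c x w c = w"
  using transition_derivative_id[OF assms] assms(2) by (simp add: coord_vec_def o_def)

lemma coord_vec_of_tangent:
  assumes "smooth_atlas A" "c \<in> charts_at A x" "v \<in> tangent_space A x"
  shows "coord_vec A c x (v c) = v"
  by (rule tangent_eqI[OF coord_vec_in[OF assms(1,2)] assms(3,2)]) (rule coord_vec_self[OF assms(1,2)])

lemma tangent_space_combination:
  assumes A: "smooth_atlas A" and x: "x \<in> points A"
    and v: "v \<in> tangent_space A x" and w: "w \<in> tangent_space A x"
  shows "(\<lambda>c. r *\<^sub>R v c + s *\<^sub>R w c) \<in> tangent_space A x"
proof -
  obtain c where c: "c \<in> charts_at A x" using x points_iff by metis
  show ?thesis
  proof (rule tangent_spaceI[OF A c])
    fix c' assume c': "c' \<in> charts_at A x"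
    have "linear (frechet_derivative (\<lambda>u. coords c' (point_of c u)) (at (coords c x)))"
      using rep_derivative_linear[OF A A smooth_at_id[OF A x] c c'] bounded_linear.linear by blast
    then show "r *\<^sub>R v c' + s *\<^sub>R w c' =
      frechet_derivative (\<lambda>u. coords c' (point_of c u)) (at (coords c x)) (r *\<^sub>R v c + s *\<^sub>R w c)"
      by (simp add: tangent_spaceD[OF v c c'] tangent_spaceD[OF w c c'] linear_add linear_scale)
  qed (simp add: tangent_space_outside[OF v] tangent_space_outside[OF w])
qed

text \<open>\<open>tangent_map\<close> is computed in an arbitrarily chosen source chart; the
  transformation law of \<open>v\<close> cancels that choice.\<close>

lemma tangent_map_chart:
  assumes A: "smooth_atlas A" and B: "smooth_atlas B" and F: "smooth_at A B F x"
    and v: "v \<in> tangent_space A x" and c: "c \<in> charts_at A x" and c': "c' \<in> charts_at B (F x)"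
  shows "tangent_map A B F x v c' =
    frechet_derivative (\<lambda>u. coords c' (F (point_of c u))) (at (coords c x)) (v c)"
proof -
  define c0 where "c0 = (SOME c. c \<in> charts_at A x)"
  have c0: "c0 \<in> charts_at A x" unfolding c0_def using c by (rule someI)
  have id: "smooth_at A A (\<lambda>x. x) x" using smooth_at_id[OF A charts_at_points[OF c]] .
  have "tangent_map A B F x v c' =
      frechet_derivative (\<lambda>u. coords c' (F (point_of c0 u))) (at (coords c0 x)) (v c0)"
    using c' by (simp add: tangent_map_def c0_def o_def Let_def)
  also have "v c0 = frechet_derivative (\<lambda>u. coords c0 (point_of c u)) (at (coords c x)) (v c)"
    by (rule tangent_spaceD[OF v c c0])
  also have "frechet_derivative (\<lambda>u. coords c' (F (point_of c0 u))) (at (coords c0 x)) \<dots> =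
      frechet_derivative (\<lambda>u. coords c' (F (point_of c u))) (at (coords c x)) (v c)"
    by (rule rep_derivative_compose[OF A A B id F c c0 c', symmetric])
  finally show ?thesis .
qed

lemma tangent_map_outside: "c' \<notin> charts_at B (F x) \<Longrightarrow> tangent_map A B F x v c' = 0"
  by (simp add: tangent_map_def Let_def)

lemma tangent_map_in:
  assumes A: "smooth_atlas A" and B: "smooth_atlas B" and F: "smooth_at A B F x"
    and v: "v \<in> tangent_space A x"
  shows "tangent_map A B F x v \<in> tangent_space B (F x)"
proof -
  obtain c c' where c: "c \<in> charts_at A x" and c': "c' \<in> charts_at B (F x)"
    using F unfolding smooth_at_def by blast
  have id: "smooth_at B B (\<lambda>x. x) (F x)" using smooth_at_id[OF B charts_at_points[OF c']] .
  show ?thesis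
  proof (rule tangent_spaceI[OF B c'])
    fix d assume d: "d \<in> charts_at B (F x)"
    show "tangent_map A B F x v d = frechet_derivative (\<lambda>u. coords d (point_of c' u))
        (at (coords c' (F x))) (frechet_derivative (\<lambda>u. coords c' (F (point_of c u))) (at (coords c x)) (v c))"
      unfolding tangent_map_chart[OF A B F v c d]
      by (rule rep_derivative_compose[OF A B B F id c c' d])
  qed (rule tangent_map_outside)
qed

lemma tangent_map_compose:
  assumes A: "smooth_atlas A" and B: "smooth_atlas B" and C: "smooth_atlas C"
    and F: "smooth_at A B F x" and G: "smooth_at B C G (F x)" and v: "v \<in> tangent_space A x"
  shows "tangent_map A C (\<lambda>x. G (F x)) x v = tangent_map B C G (F x) (tangent_map A B F x v)"
proof
  fix d
  obtain c c' where c: "c \<in> charts_at A x" and c': "c' \<in> charts_at B (F x)"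
    using F unfolding smooth_at_def by blast
  show "tangent_map A C (\<lambda>x. G (F x)) x v d = tangent_map B C G (F x) (tangent_map A B F x v) d"
  proof (cases "d \<in> charts_at C (G (F x))")
    case True
    show ?thesis
      unfolding tangent_map_chart[OF A C smooth_at_compose[OF A B C F G] v c True]
        tangent_map_chart[OF B C G tangent_map_in[OF A B F v] c' True] tangent_map_chart[OF A B F v c c']
      by (rule rep_derivative_compose[OF A B C F G c c' True])
  qed (simp add: tangent_map_outside)
qed

lemma tangent_map_id:
  assumes A: "smooth_atlas A" and x: "x \<in> points A" and v: "v \<in> tangent_space A x"
  shows "tangent_map A A (\<lambda>x. x) x v = v"
proof -
  obtain c where c: "c \<in> charts_at A x" using x points_iff by metis
  note id = smooth_at_id[OF A x]
  show ?thesis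
    by (rule tangent_eqI[OF tangent_map_in[OF A A id v] v c])
       (simp add: tangent_map_chart[OF A A id v c c] transition_derivative_id[OF A c])
qed

text \<open>Identities of an action, such as \<open>\<Phi> \<one>\<close> being the identity, hold
  on \<open>points A\<close> only, so a map inside \<open>tangent_map\<close> cannot be rewritten by
  an equality of functions.\<close>

lemma tangent_map_cong:
  assumes A: "smooth_atlas A" and x: "x \<in> points A" and eq: "\<And>y. y \<in> points A \<Longrightarrow> F y = G y"
  shows "tangent_map A B F x v = tangent_map A B G x v"
proof -
  define c where "c = (SOME c. c \<in> charts_at A x)"
  have c: "c \<in> charts_at A x" unfolding c_def using x points_iff[of x A] someI_ex by metis
  then have c': "c \<in> A" "x \<in> dom_of c" by (auto simp: charts_at_iff)
  have "frechet_derivative (\<lambda>u. coords c' (F (point_of c u))) (at (coords c x)) =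
      frechet_derivative (\<lambda>u. coords c' (G (point_of c u))) (at (coords c x))" for c' :: "('c, 'd) chart"
  proof (rule frechet_derivative_cong[of "coords c ` dom_of c"])
    fix u assume "u \<in> coords c ` dom_of c"
    then have "point_of c u \<in> points A" using point_of_in_dom[of u c] c'(1) unfolding points_def by blast
    then show "coords c' (F (point_of c u)) = coords c' (G (point_of c u))" by (simp add: eq)
  qed (use smooth_atlasD(3)[OF A] c' in auto)
  then show ?thesis
    by (rule_tac ext) (simp add: tangent_map_def Let_def o_def eq[OF x] flip: c_def)
qed

section \<open>Velocities of curves\<close>

lemma velocity_chart:
  assumes A: "smooth_atlas A" and \<gamma>: "smooth_at euclid_atlas A \<gamma> t" and c: "c \<in> charts_at A (\<gamma> t)"
  shows "((\<lambda>s. coords c (\<gamma> s)) has_vector_derivative velocity A \<gamma> t c) (at t)"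
proof -
  have "((\<lambda>s. coords c (\<gamma> s)) has_derivative frechet_derivative (\<lambda>s. coords c (\<gamma> s)) (at t)) (at t)"
    using rep_derivative[OF smooth_atlas_real A \<gamma> _ c, of "(UNIV, \<lambda>x. x)"] by simp
  then have "(\<lambda>s. coords c (\<gamma> s)) differentiable at t" by (rule differentiableI)
  then show ?thesis using c by (simp add: vector_derivative_works velocity_def o_def)
qed

lemma velocity_eqI:
  assumes A: "smooth_atlas A" and \<gamma>: "smooth_at euclid_atlas A \<gamma> t" and c: "c \<in> charts_at A (\<gamma> t)"
    and "((\<lambda>s. coords c (\<gamma> s)) has_vector_derivative w) (at t)"
  shows "velocity A \<gamma> t c = w"
  using vector_derivative_unique_at[OF velocity_chart[OF A \<gamma> c] assms(4)] .

lemma velocity_frechet: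
  assumes "smooth_atlas A" "smooth_at euclid_atlas A \<gamma> t" "c \<in> charts_at A (\<gamma> t)"
  shows "velocity A \<gamma> t c = frechet_derivative (\<lambda>s. coords c (\<gamma> s)) (at t) 1"
  using frechet_derivative_at[OF velocity_chart[OF assms, unfolded has_vector_derivative_def]]
  by (metis scaleR_one)

lemma velocity_outside: "c \<notin> charts_at A (\<gamma> t) \<Longrightarrow> velocity A \<gamma> t c = 0"
  by (simp add: velocity_def)

lemma velocity_in:
  assumes A: "smooth_atlas A" and \<gamma>: "smooth_at euclid_atlas A \<gamma> t"
  shows "velocity A \<gamma> t \<in> tangent_space A (\<gamma> t)"
proof -
  obtain c where c: "c \<in> charts_at A (\<gamma> t)" using \<gamma> unfolding smooth_at_def by blast
  have id: "smooth_at A A (\<lambda>x. x) (\<gamma> t)" using smooth_at_id[OF A charts_at_points[OF c]] .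
  show ?thesis
  proof (rule tangent_spaceI[OF A c])
    fix d assume d: "d \<in> charts_at A (\<gamma> t)"
    show "velocity A \<gamma> t d = frechet_derivative (\<lambda>u. coords d (point_of c u)) (at (coords c (\<gamma> t)))
      (frechet_derivative (\<lambda>s. coords c (\<gamma> s)) (at t) 1)"
      using rep_derivative_compose[OF smooth_atlas_real A A \<gamma> id _ c d, of "(UNIV, \<lambda>x. x)" 1]
      by (simp add: velocity_frechet[OF A \<gamma> d])
  qed (rule velocity_outside)
qed

lemma velocity_map:
  assumes A: "smooth_atlas A" and B: "smooth_atlas B"
    and \<gamma>: "smooth_at euclid_atlas A \<gamma> t" and F: "smooth_at A B F (\<gamma> t)"
  shows "velocity B (\<lambda>t. F (\<gamma> t)) t = tangent_map A B F (\<gamma> t) (velocity A \<gamma> t)"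
proof
  fix d
  obtain c where c: "c \<in> charts_at A (\<gamma> t)" using \<gamma> unfolding smooth_at_def by blast
  show "velocity B (\<lambda>t. F (\<gamma> t)) t d = tangent_map A B F (\<gamma> t) (velocity A \<gamma> t) d"
  proof (cases "d \<in> charts_at B (F (\<gamma> t))")
    case True
    show ?thesis
      unfolding velocity_frechet[OF B smooth_at_compose[OF smooth_atlas_real A B \<gamma> F] True]
        tangent_map_chart[OF A B F velocity_in[OF A \<gamma>] c True] velocity_frechet[OF A \<gamma> c]
      using rep_derivative_compose[OF smooth_atlas_real A B \<gamma> F _ c True, of "(UNIV, \<lambda>x. x)" 1] by simp
  qed (simp add: velocity_outside tangent_map_outside)
qed

lemma velocity_cong:
  fixes A :: "('m, 'e::real_normed_vector) atlas"
  assumes "open S" "t \<in> S" "\<And>s. s \<in> S \<Longrightarrow> \<gamma> s = \<delta> s"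
  shows "velocity A \<gamma> t = velocity A \<delta> t"
proof
  fix c :: "('m, 'e) chart"
  have "vector_derivative (\<lambda>s. coords c (\<gamma> s)) (at t) =
    vector_derivative (\<lambda>s. coords c (\<delta> s)) (at t)"
  proof (rule vector_derivative_cong_eq)
    show "\<forall>\<^sub>F s in nhds t. s \<in> UNIV \<longrightarrow> coords c (\<gamma> s) = coords c (\<delta> s)"
      unfolding eventually_nhds using assms by (intro exI[of _ S]) auto
  qed simp_all
  then show "velocity A \<gamma> t c = velocity A \<delta> t c" using assms(3)[OF assms(2)] by (simp add: velocity_def o_def)
qed

section \<open>The topology of an atlas\<close>

text \<open>The predicate must be a topology before \<open>openin\<close> can be unfolded. Closure
  under intersection rests on injectivity of the charts: otherwise the image of an intersection may
  be smaller than the intersection of the images.\<close>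

lemma openin_manifold_topology:
  assumes A: "smooth_atlas A"
  shows "openin (manifold_topology A) W \<longleftrightarrow>
    W \<subseteq> points A \<and> (\<forall>c\<in>A. open (coords c ` (W \<inter> dom_of c)))"
proof -
  have "istopology (\<lambda>W. W \<subseteq> points A \<and> (\<forall>c\<in>A. open (coords c ` (W \<inter> dom_of c))))"
    unfolding istopology_def
  proof (intro conjI allI impI)
    fix S T assume S: "S \<subseteq> points A \<and> (\<forall>c\<in>A. open (coords c ` (S \<inter> dom_of c)))"
      and T: "T \<subseteq> points A \<and> (\<forall>c\<in>A. open (coords c ` (T \<inter> dom_of c)))"
    have "coords c ` (S \<inter> T \<inter> dom_of c) = coords c ` (S \<inter> dom_of c) \<inter> coords c ` (T \<inter> dom_of c)" if "c \<in> A" for c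
      using smooth_atlasD(2)[OF A that] unfolding inj_on_def by blast
    then show "\<forall>c\<in>A. open (coords c ` (S \<inter> T \<inter> dom_of c))" using S T by (metis open_Int)
    show "S \<inter> T \<subseteq> points A" using S by blast
  next
    fix K assume K: "\<forall>S\<in>K. S \<subseteq> points A \<and> (\<forall>c\<in>A. open (coords c ` (S \<inter> dom_of c)))"
    have "coords c ` (\<Union>K \<inter> dom_of c) = (\<Union>S\<in>K. coords c ` (S \<inter> dom_of c))" for c by blast
    then show "\<forall>c\<in>A. open (coords c ` (\<Union>K \<inter> dom_of c))" using K by (metis open_UN)
    show "\<Union>K \<subseteq> points A" using K by blast
  qed
  then show ?thesis unfolding manifold_topology_def by (simp add: topology_inverse')
qed

lemma topspace_manifold_topology:
  assumes A: "smooth_atlas A"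
  shows "topspace (manifold_topology A) = points A"
proof -
  have "coords c ` (points A \<inter> dom_of c) = coords c ` dom_of c" if "c \<in> A" for c
    using that by (auto simp: points_def)
  then have "openin (manifold_topology A) (points A)"
    unfolding openin_manifold_topology[OF A] using smooth_atlasD(3)[OF A] by (metis subset_refl)
  then show ?thesis
    using openin_manifold_topology[OF A] by (metis openin_subset openin_topspace subset_antisym)
qed

lemma openin_chart_preimage:
  assumes A: "smooth_atlas A" and c: "c \<in> A" and U: "open U"
  shows "openin (manifold_topology A) {x \<in> dom_of c. coords c x \<in> U}"
  unfolding openin_manifold_topology[OF A]
proof (intro conjI ballI)
  show "{x \<in> dom_of c. coords c x \<in> U} \<subseteq> points A" using c unfolding points_def by blast
  fix d assume d: "d \<in> A"
  have "coords d ` ({x \<in> dom_of c. coords c x \<in> U} \<inter> dom_of d) =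
     {u \<in> coords d ` (dom_of d \<inter> dom_of c). coords c (point_of d u) \<in> U}"
    using point_of_coords[OF A d] by auto
  also have "open \<dots>"
    by (rule open_preimage_on[OF smooth_on_continuous[OF smooth_atlasD(5)[OF A d c]] smooth_atlasD(4)[OF A d c] U])
  finally show "open (coords d ` ({x \<in> dom_of c. coords c x \<in> U} \<inter> dom_of d))" .
qed

text \<open>Continuity of curves for the topology of the atlas, needed where the Hausdorff property
  separates two integral curves.\<close>

lemma curve_preimage_open:
  assumes A: "smooth_atlas A" and \<gamma>: "smooth_map euclid_atlas A \<gamma>" and W: "openin (manifold_topology A) W"
  shows "open {t::real. \<gamma> t \<in> W}"
proof (subst open_subopen, intro ballI)
  fix t assume "t \<in> {t. \<gamma> t \<in> W}"
  then have t: "\<gamma> t \<in> W" by simp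
  have "\<gamma> t \<in> points A" using smooth_mapD(2)[OF \<gamma>] by simp
  then obtain c where c: "c \<in> charts_at A (\<gamma> t)" unfolding points_iff by blast
  have cA: "c \<in> A" "\<gamma> t \<in> dom_of c" using c by (auto simp: charts_at_iff)
  obtain V where V: "open V" "t \<in> V" "\<And>s. s \<in> V \<Longrightarrow> \<gamma> s \<in> dom_of c" "smooth_on V (\<lambda>s. coords c (\<gamma> s))"
    by (rule smooth_at_curveE[OF finite_dim_euclidean A smooth_mapD(1)[OF \<gamma>] c]) (simp, rule that)
  have o: "open (coords c ` (W \<inter> dom_of c))" using W cA unfolding openin_manifold_topology[OF A] by blast
  let ?S = "{s \<in> V. coords c (\<gamma> s) \<in> coords c ` (W \<inter> dom_of c)}"
  have "open ?S" by (rule open_preimage_on[OF smooth_on_continuous[OF V(4)] V(1) o])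
  moreover have "t \<in> ?S" using V(2) t cA by auto
  moreover have "?S \<subseteq> {t. \<gamma> t \<in> W}"
    using V(3) smooth_atlasD(2)[OF A cA(1)] unfolding inj_on_def by blast
  ultimately show "\<exists>T. open T \<and> t \<in> T \<and> T \<subseteq> {t. \<gamma> t \<in> W}" by blast
qed

text \<open>In a chart the function is constant on small balls, so every set cut out by its values
  is open; if \<open>f\<close> took two values, a level set and its complement would disconnect the
  space.\<close>

lemma constant_if_derivative_zero:
  fixes f :: "'m \<Rightarrow> 'b::real_normed_vector" and A :: "('m, 'e::real_normed_vector) atlas"
  assumes A: "smooth_atlas A" and conn: "connected_space (manifold_topology A)"
    and f: "\<And>c x. c \<in> charts_at A x \<Longrightarrow> ((\<lambda>u. f (point_of c u)) has_derivative (\<lambda>_. 0)) (at (coords c x))"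
    and x: "x \<in> points A" and y: "y \<in> points A"
  shows "f x = f y"
proof (rule ccontr)
  assume ne: "f x \<noteq> f y"
  \<comment> \<open>An arbitrary predicate \<open>P\<close> on values covers the level set of
    \<open>f x\<close> and its complement at once.\<close>
  have op: "openin (manifold_topology A) {z \<in> points A. P (f z)}" for P
    unfolding openin_manifold_topology[OF A]
  proof (intro conjI ballI)
    fix c assume c: "c \<in> A"
    let ?S = "coords c ` ({z \<in> points A. P (f z)} \<inter> dom_of c)"
    show "open ?S"
    proof (subst open_subopen, intro ballI)
      fix u assume "u \<in> ?S"
      then obtain z where z: "z \<in> dom_of c" "P (f z)" "u = coords c z" by blast
      have "open (coords c ` dom_of c)" "u \<in> coords c ` dom_of c" using smooth_atlasD(3)[OF A c] z by auto
      then obtain e where e: "e > 0" "ball u e \<subseteq> coords c ` dom_of c" unfolding open_contains_ball by blast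
      have "f (point_of c v) = f (point_of c u)" if v: "v \<in> ball u e" for v
      proof (rule has_derivative_zero_unique[where f = "\<lambda>w. f (point_of c w)" and s = "ball u e"])
        fix w assume "w \<in> ball u e"
        then have "w \<in> coords c ` dom_of c" using e by blast
        then have "point_of c w \<in> dom_of c" "coords c (point_of c w) = w"
          using point_of_in_dom[of w c] coords_point_of[of w c] by auto
        then have "((\<lambda>u. f (point_of c u)) has_derivative (\<lambda>_. 0)) (at w)"
          using f[of c "point_of c w"] c by (simp add: charts_at_iff)
        then show "((\<lambda>u. f (point_of c u)) has_derivative (\<lambda>_. 0)) (at w within ball u e)"
          by (rule has_derivative_at_withinI)
      qed (use e v in auto)
      then have Pf: "P (f (point_of c v))" if "v \<in> ball u e" for v
        using z point_of_coords[OF A c z(1)] that by simp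
      have "v \<in> ?S" if v: "v \<in> ball u e" for v
      proof (rule image_eqI[of _ _ "point_of c v"])
        have "v \<in> coords c ` dom_of c" using v e(2) by blast
        then have "point_of c v \<in> dom_of c" "coords c (point_of c v) = v"
          by (rule point_of_in_dom, rule coords_point_of)
        then show "v = coords c (point_of c v)" "point_of c v \<in> {z \<in> points A. P (f z)} \<inter> dom_of c"
          using c Pf[OF v] unfolding points_def by auto
      qed
      then show "\<exists>T. open T \<and> u \<in> T \<and> T \<subseteq> ?S" using e(1) by (intro exI[of _ "ball u e"]) auto
    qed
  qed auto
  have disj: "U = {} \<or> V = {}" if "openin (manifold_topology A) U" "openin (manifold_topology A) V"
    "topspace (manifold_topology A) \<subseteq> U \<union> V" "U \<inter> V = {}" for U V
    using conn that unfolding connected_space_def by blast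
  have "{z \<in> points A. f z = f x} = {} \<or> {z \<in> points A. f z \<noteq> f x} = {}"
    by (rule disj[OF op[of "\<lambda>w. w = f x"] op[of "\<lambda>w. w \<noteq> f x"]])
      (auto simp: topspace_manifold_topology[OF A])
  then show False
  proof
    assume "{z \<in> points A. f z = f x} = {}"
    then show False using x by blast
  next
    assume "{z \<in> points A. f z \<noteq> f x} = {}"
    then show False using y ne by (metis (mono_tags, lifting) empty_iff mem_Collect_eq)
  qed
qed

section \<open>Ordinary differential equations\<close>

lemma vector_derivative_bound:
  fixes h :: "real \<Rightarrow> 'a::real_normed_vector"
  assumes C: "convex C" and "\<And>t. t \<in> C \<Longrightarrow> (h has_vector_derivative h' t) (at t)"
    and B: "\<And>t. t \<in> C \<Longrightarrow> norm (h' t) \<le> B" and s: "s \<in> C" "t \<in> C"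
  shows "norm (h s - h t) \<le> B * \<bar>s - t\<bar>"
proof -
  have "norm (h s - h t) \<le> B * norm (s - t)"
  proof (rule differentiable_bound[OF C _ _ s])
    show "(h has_derivative (\<lambda>r. r *\<^sub>R h' x)) (at x within C)" if "x \<in> C" for x
      using assms(2)[OF that] has_derivative_at_withinI unfolding has_vector_derivative_def by blast
    show "onorm (\<lambda>r. r *\<^sub>R h' x) \<le> B" if "x \<in> C" for x
      by (rule onorm_le) (use mult_right_mono[OF B[OF that] abs_ge_zero] in \<open>simp add: mult.commute\<close>)
  qed
  then show ?thesis by simp
qed

text \<open>Smoothness gives continuity of the derivative along fixed vectors only. Bounding it on a
  finite basis near \<open>x\<close> and expanding a general vector bounds the operator norm; the
  mean value inequality on a convex ball finishes.\<close>

lemma smooth_on_locally_lipschitz: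
  fixes f :: "'a::real_normed_vector \<Rightarrow> 'b::real_normed_vector"
  assumes fd: "finite_dim TYPE('a)" and S: "open S" and f: "smooth_on S f" and x: "x \<in> S"
  obtains e L where "e > 0" "L \<ge> 0" "cball x e \<subseteq> S"
    "\<And>y z. y \<in> cball x e \<Longrightarrow> z \<in> cball x e \<Longrightarrow> norm (f y - f z) \<le> L * norm (y - z)"
proof -
  obtain B :: "'a set" and \<phi> where B: "finite B" "\<And>b. b \<in> B \<Longrightarrow> bounded_linear (\<phi> b)"
    "\<And>x. (\<Sum>b\<in>B. \<phi> b x *\<^sub>R b) = x" using fd by (rule finite_dimE) (rule that)
  let ?D = "\<lambda>y. frechet_derivative f (at y)"
  have "\<forall>\<^sub>F y in nhds x. y \<in> S" using S x by (rule eventually_nhds_in_open)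
  moreover have "\<forall>\<^sub>F y in nhds x. \<forall>b\<in>B. norm (?D y b) < norm (?D x b) + 1"
  proof (rule eventually_ball_finite[OF B(1)], rule ballI)
    fix b
    have "isCont (\<lambda>y. ?D y b) x"
      using smooth_on_continuous[OF smooth_on_frechet[OF f, of b]] S x continuous_on_eq_continuous_at by blast
    then have "((\<lambda>y. norm (?D y b)) \<longlongrightarrow> norm (?D x b)) (nhds x)"
      by (intro tendsto_norm) (simp add: isCont_def tendsto_nhds_iff)
    then show "\<forall>\<^sub>F y in nhds x. norm (?D y b) < norm (?D x b) + 1"
      by (rule order_tendstoD(2)) simp
  qed
  ultimately have "\<forall>\<^sub>F y in nhds x. y \<in> S \<and> (\<forall>b\<in>B. norm (?D y b) < norm (?D x b) + 1)"
    by (rule eventually_conj)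
  then obtain d where d: "d > 0" "\<And>y. dist y x < d \<Longrightarrow> y \<in> S \<and> (\<forall>b\<in>B. norm (?D y b) < norm (?D x b) + 1)"
    unfolding eventually_nhds_metric by blast
  \<comment> \<open>The coefficient of \<open>b\<close> in \<open>v\<close> is at most
    \<open>onorm (\<phi> b) * norm v\<close>, and near \<open>x\<close> the derivative along
    \<open>b\<close> has norm at most 1 more than at \<open>x\<close>.\<close>
  define L where "L = (\<Sum>b\<in>B. onorm (\<phi> b) * (norm (?D x b) + 1))"
  have L: "L \<ge> 0" unfolding L_def using onorm_pos_le[OF B(2)] by (intro sum_nonneg mult_nonneg_nonneg) auto
  have near: "y \<in> S" "\<And>b. b \<in> B \<Longrightarrow> norm (?D y b) \<le> norm (?D x b) + 1" if "y \<in> cball x (d / 2)" for y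
    using d(2)[of y] d(1) that by (auto simp: dist_commute less_imp_le)
  have "norm (f y - f z) \<le> L * norm (y - z)" if yz: "y \<in> cball x (d / 2)" "z \<in> cball x (d / 2)" for y z
  proof (rule differentiable_bound[OF convex_cball _ _ yz])
    fix w assume w: "w \<in> cball x (d / 2)"
    note Dw = smooth_on_has_derivative[OF f near(1)[OF w]]
    show "(f has_derivative ?D w) (at w within cball x (d / 2))"
      using Dw by (rule has_derivative_at_withinI)
    have l: "linear (?D w)" using Dw has_derivative_linear by blast
    show "onorm (?D w) \<le> L"
    proof (rule onorm_bound[OF L])
      fix v
      have "?D w v = ?D w (\<Sum>b\<in>B. \<phi> b v *\<^sub>R b)" by (simp only: B(3))
      also have "\<dots> = (\<Sum>b\<in>B. \<phi> b v *\<^sub>R ?D w b)" by (simp add: linear_sum[OF l] linear_scale[OF l])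
      finally have "norm (?D w v) \<le> (\<Sum>b\<in>B. norm (\<phi> b v *\<^sub>R ?D w b))" by (simp only: norm_sum)
      also have "\<dots> \<le> (\<Sum>b\<in>B. onorm (\<phi> b) * (norm (?D x b) + 1) * norm v)"
      proof (rule sum_mono)
        fix b assume b: "b \<in> B"
        have "norm (\<phi> b v) * norm (?D w b) \<le> (onorm (\<phi> b) * norm v) * (norm (?D x b) + 1)"
          using onorm[OF B(2)[OF b]] near(2)[OF w b] onorm_pos_le[OF B(2)[OF b]] by (intro mult_mono) auto
        then show "norm (\<phi> b v *\<^sub>R ?D w b) \<le> onorm (\<phi> b) * (norm (?D x b) + 1) * norm v"
          by (simp add: algebra_simps)
      qed
      also have "\<dots> = L * norm v" by (simp add: L_def sum_distrib_right)
      finally show "norm (?D w v) \<le> L * norm v" .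
    qed
  qed
  moreover have "cball x (d / 2) \<subseteq> S" using near(1) by blast
  ultimately show thesis using d(1) L by (intro that[of "d / 2" L]) auto
qed

text \<open>At a maximum of the distance between the solutions, the mean value inequality bounds the
  maximum by \<open>L * \<delta>\<close> times itself, hence by half of itself, so it vanishes. This
  takes the place of Gronwall's inequality.\<close>

lemma ode_unique_short:
  fixes u v :: "real \<Rightarrow> 'a::real_normed_vector"
  assumes lip: "\<And>y z. y \<in> D \<Longrightarrow> z \<in> D \<Longrightarrow> norm (f y - f z) \<le> L * norm (y - z)" and L: "L \<ge> 0"
    and \<delta>: "\<delta> \<ge> 0" "L * \<delta> \<le> 1 / 2"
    and u: "\<And>t. t \<in> cball t0 \<delta> \<Longrightarrow> u t \<in> D \<and> (u has_vector_derivative f (u t)) (at t)"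
    and v: "\<And>t. t \<in> cball t0 \<delta> \<Longrightarrow> v t \<in> D \<and> (v has_vector_derivative f (v t)) (at t)"
    and eq: "u t0 = v t0" and t: "t \<in> cball t0 \<delta>"
  shows "u t = v t"
proof -
  let ?w = "\<lambda>t. u t - v t"
  have w: "(?w has_vector_derivative f (u t) - f (v t)) (at t)" if "t \<in> cball t0 \<delta>" for t
    using u[OF that] v[OF that] by (intro has_vector_derivative_diff) auto
  have "continuous_on (cball t0 \<delta>) (\<lambda>t. norm (?w t))"
    using has_vector_derivative_continuous[OF w] by (intro continuous_on_norm continuous_at_imp_continuous_on) blast
  then obtain t1 where t1: "t1 \<in> cball t0 \<delta>" "\<And>t. t \<in> cball t0 \<delta> \<Longrightarrow> norm (?w t) \<le> norm (?w t1)"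
    using continuous_attains_sup[of "cball t0 \<delta>" "\<lambda>t. norm (?w t)"] \<delta>(1) by auto
  let ?M = "norm (?w t1)"
  have "norm (?w t1 - ?w t0) \<le> (L * ?M) * \<bar>t1 - t0\<bar>"
  proof (rule vector_derivative_bound[OF convex_cball w _ t1(1)])
    fix t assume t: "t \<in> cball t0 \<delta>"
    have "norm (f (u t) - f (v t)) \<le> L * norm (?w t)" using lip u[OF t] v[OF t] by blast
    also have "\<dots> \<le> L * ?M" using t1(2)[OF t] L by (rule mult_left_mono)
    finally show "norm (f (u t) - f (v t)) \<le> L * ?M" .
  qed (use \<delta> in auto)
  also have "\<dots> \<le> (L * ?M) * \<delta>"
    using t1(1) L by (intro mult_left_mono) (auto simp: dist_real_def)
  also have "\<dots> = (L * \<delta>) * ?M" by simp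
  also have "\<dots> \<le> 1 / 2 * ?M" using \<delta>(2) by (rule mult_right_mono) simp
  finally have "?M \<le> 0" using eq by simp
  then show ?thesis using t1(2)[OF t] by simp
qed

lemma ode_unique_near:
  fixes u v :: "real \<Rightarrow> 'a::real_normed_vector"
  assumes fd: "finite_dim TYPE('a)" and S: "open S" and f: "smooth_on S f" and I: "open I"
    and u: "\<And>t. t \<in> I \<Longrightarrow> u t \<in> S \<and> (u has_vector_derivative f (u t)) (at t)"
    and v: "\<And>t. t \<in> I \<Longrightarrow> v t \<in> S \<and> (v has_vector_derivative f (v t)) (at t)"
    and t0: "t0 \<in> I" "u t0 = v t0"
  shows "\<exists>\<delta>>0. \<forall>t\<in>cball t0 \<delta>. u t = v t"
proof -
  obtain e L where e: "e > 0" and L: "L \<ge> 0" and "cball (u t0) e \<subseteq> S"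
    and lip: "\<And>y z. y \<in> cball (u t0) e \<Longrightarrow> z \<in> cball (u t0) e \<Longrightarrow> norm (f y - f z) \<le> L * norm (y - z)"
    by (rule smooth_on_locally_lipschitz[OF fd S f conjunct1[OF u[OF t0(1)]]]) (rule that)
  have c: "continuous_on I u" "continuous_on I v"
    using has_vector_derivative_continuous u v by (blast intro: continuous_at_imp_continuous_on)+
  have "open {t \<in> {t \<in> I. u t \<in> ball (u t0) e}. v t \<in> ball (u t0) e}"
    by (intro open_preimage_on I c open_ball continuous_on_subset[OF c(2)]) auto
  moreover have "t0 \<in> {t \<in> {t \<in> I. u t \<in> ball (u t0) e}. v t \<in> ball (u t0) e}" using t0 e by auto
  ultimately obtain r where r: "r > 0" "cball t0 r \<subseteq> {t \<in> {t \<in> I. u t \<in> ball (u t0) e}. v t \<in> ball (u t0) e}"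
    unfolding open_contains_cball by blast
  \<comment> \<open>Chosen so that \<open>L * \<delta>\<close> is at most 1/2; adding 1 keeps the
    denominator positive when \<open>L = 0\<close>.\<close>
  define \<delta> where "\<delta> = min r (1 / (2 * (L + 1)))"
  have \<delta>: "\<delta> > 0" "\<delta> \<le> r" using r(1) L by (auto simp: \<delta>_def)
  have "L * \<delta> \<le> L * (1 / (2 * (L + 1)))" using L by (intro mult_left_mono) (auto simp: \<delta>_def)
  also have "\<dots> \<le> 1 / 2" using L by (simp add: field_simps)
  finally have L\<delta>: "L * \<delta> \<le> 1 / 2" .
  have sub: "t \<in> I \<and> u t \<in> cball (u t0) e \<and> v t \<in> cball (u t0) e" if "t \<in> cball t0 \<delta>" for t
  proof -
    have "t \<in> cball t0 r" using that \<delta>(2) by auto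
    then show ?thesis using r(2) by (auto simp: less_imp_le subset_iff)
  qed
  have "u t = v t" if "t \<in> cball t0 \<delta>" for t
    by (rule ode_unique_short[where u = u and v = v and D = "cball (u t0) e", OF lip L _ L\<delta> _ _ t0(2) that]) (use sub u v \<delta> in auto)
  then show ?thesis using \<delta>(1) by blast
qed

lemma connected_agree:
  fixes u v :: "real \<Rightarrow> 'a::t2_space"
  assumes I: "open I" "connected I" and c: "continuous_on I u" "continuous_on I v"
    and E: "\<And>t. t \<in> I \<Longrightarrow> u t = v t \<Longrightarrow> \<exists>\<delta>>0. \<forall>s\<in>cball t \<delta>. u s = v s"
    and t0: "t0 \<in> I" "u t0 = v t0" and t: "t \<in> I"
  shows "u t = v t"
proof (rule ccontr)
  assume ne: "u t \<noteq> v t"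
  have "open {s \<in> I. u s = v s}"
  proof (subst open_subopen, intro ballI)
    fix s assume "s \<in> {s \<in> I. u s = v s}"
    then obtain \<delta> where "\<delta> > 0" "\<forall>r\<in>cball s \<delta>. u r = v r" "s \<in> I" using E by blast
    then show "\<exists>T. open T \<and> s \<in> T \<and> T \<subseteq> {s \<in> I. u s = v s}"
      using I(1) by (intro exI[of _ "ball s \<delta> \<inter> I"]) auto
  qed
  moreover have "open {s \<in> I. u s \<noteq> v s}"
  proof -
    have "open {s \<in> I. (u s, v s) \<in> - {(x, y). x = y}}"
    proof (rule open_preimage_on[OF _ I(1)])
      show "open (- {(x::'a, y). x = y})" using closed_diagonal by (auto simp: open_closed elim: back_subst[of closed])
    qed (intro continuous_on_Pair c)
    then show ?thesis by simp
  qed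
  ultimately show False
    using connectedD[OF I(2), of "{s \<in> I. u s = v s}" "{s \<in> I. u s \<noteq> v s}"] t0 t ne by auto
qed

lemma ode_unique:
  fixes u v :: "real \<Rightarrow> 'a::real_normed_vector"
  assumes fd: "finite_dim TYPE('a)" and S: "open S" and f: "smooth_on S f" and I: "open I" "connected I"
    and u: "\<And>t. t \<in> I \<Longrightarrow> u t \<in> S \<and> (u has_vector_derivative f (u t)) (at t)"
    and v: "\<And>t. t \<in> I \<Longrightarrow> v t \<in> S \<and> (v has_vector_derivative f (v t)) (at t)"
    and t0: "t0 \<in> I" "u t0 = v t0" and t: "t \<in> I"
  shows "u t = v t"
proof (rule connected_agree[where u = u and v = v, OF I _ _ _ t0 t])
  show "continuous_on I u" "continuous_on I v"
    using has_vector_derivative_continuous u v by (blast intro: continuous_at_imp_continuous_on)+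
  show "\<exists>\<delta>>0. \<forall>s\<in>cball t \<delta>. u s = v s" if "t \<in> I" "u t = v t" for t
    by (rule ode_unique_near[OF fd S f I(1) u v that])
qed

text \<open>Bootstrapping: if \<open>u\<close> is of class \<open>k\<close> then so is its
  derivative \<open>f (u t)\<close>, hence \<open>u\<close> is of class
  \<open>k + 1\<close>.\<close>

lemma ode_solution_smooth:
  fixes u :: "real \<Rightarrow> 'a::real_normed_vector"
  assumes fd: "finite_dim TYPE('a)" and S: "open S" and f: "smooth_on S f" and I: "open I"
    and u: "\<And>t. t \<in> I \<Longrightarrow> u t \<in> S \<and> (u has_vector_derivative f (u t)) (at t)"
  shows "smooth_on I u"
  unfolding smooth_on_def
proof
  fix k show "Ck_on k I u"
  proof (induction k)
    case 0
    show ?case unfolding Ck_on.simps using has_vector_derivative_continuous u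
      by (blast intro: continuous_at_imp_continuous_on)
  next
    case (Suc k)
    show ?case
    proof (rule Ck_on_SucI[OF I, where f' = "\<lambda>t h. h *\<^sub>R f (u t)"])
      show "(u has_derivative (\<lambda>h. h *\<^sub>R f (u t))) (at t)" if "t \<in> I" for t
        using u[OF that] by (simp add: has_vector_derivative_def)
      show "Ck_on k I (\<lambda>t. h *\<^sub>R f (u t))" for h
      proof (rule Ck_on_bounded_linear[OF bounded_linear_scaleR_right I])
        show "Ck_on k I (\<lambda>t. f (u t))"
          by (rule Ck_on_compose[OF fd I S _ Suc smooth_onD[OF f]]) (use u in auto)
      qed
    qed
  qed
qed

text \<open>Picard iteration as a contraction on a closed set \<open>T\<close> of bounded continuous
  functions. Since these functions live on the whole line, time is clamped by \<open>cl\<close> to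
  \<open>{- \<delta>..\<delta>}\<close>; the clamping is invisible for the times in the
  conclusion.\<close>

lemma ode_exists:
  fixes f :: "'a::banach \<Rightarrow> 'a"
  assumes fd: "finite_dim TYPE('a)" and S: "open S" and f: "smooth_on S f" and x0: "x0 \<in> S"
  obtains \<delta> u where "\<delta> > 0" "u 0 = x0"
    "\<And>t::real. \<bar>t\<bar> < \<delta> \<Longrightarrow> u t \<in> S \<and> (u has_vector_derivative f (u t)) (at t)"
proof -
  obtain e L where e: "e > 0" and L: "L \<ge> 0" and eS: "cball x0 e \<subseteq> S"
    and lip: "\<And>y z. y \<in> cball x0 e \<Longrightarrow> z \<in> cball x0 e \<Longrightarrow> norm (f y - f z) \<le> L * norm (y - z)"
    by (rule smooth_on_locally_lipschitz[OF fd S f x0]) (rule that)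
  define M where "M = norm (f x0) + L * e"
  have M: "M \<ge> 0" unfolding M_def using L e by auto
  have fM: "norm (f y) \<le> M" if y: "y \<in> cball x0 e" for y
  proof -
    have "norm (f y - f x0) \<le> L * norm (y - x0)" using lip y e by auto
    also have "\<dots> \<le> L * e" using y L by (intro mult_left_mono) (auto simp: dist_norm norm_minus_commute)
    finally show ?thesis unfolding M_def using norm_triangle_sub[of "f y" "f x0"] by linarith
  qed
  \<comment> \<open>The operator \<open>Q\<close> below is a difference of integrals over lengths at
    most \<open>2 * \<delta>\<close> and \<open>\<delta>\<close>, so \<open>3 * \<delta>\<close> is
    the length that counts: times \<open>M\<close> it must not exceed \<open>e\<close>, to stay in
    the ball, and times \<open>L\<close> it must not exceed 1/2, for the contraction.\<close>
  define \<delta> where "\<delta> = min (e / (3 * (M + 1))) (1 / (6 * (L + 1)))"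
  have \<delta>: "\<delta> > 0" unfolding \<delta>_def using e M L by auto
  have "3 * \<delta> * M \<le> 3 * (e / (3 * (M + 1))) * M" using M by (intro mult_right_mono) (auto simp: \<delta>_def)
  also have "\<dots> \<le> e" using M e by (simp add: field_simps)
  finally have \<delta>M: "M * (2 * \<delta>) + M * \<delta> \<le> e" by (simp add: algebra_simps)
  have "3 * \<delta> * L \<le> 3 * (1 / (6 * (L + 1))) * L" using L by (intro mult_right_mono) (auto simp: \<delta>_def)
  also have "\<dots> \<le> 1 / 2" using L by (simp add: field_simps)
  finally have \<delta>L: "3 * \<delta> * L \<le> 1 / 2" .
  define cl where "cl t = max (- \<delta>) (min t \<delta>)" for t :: real
  have cl: "cl t \<in> {- \<delta>..\<delta>}" for t using \<delta> by (auto simp: cl_def)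
  have cl_cont: "continuous_on UNIV cl" unfolding cl_def by (intro continuous_intros)
  define T where "T = (PiC UNIV (\<lambda>_. cball x0 e) :: (real \<Rightarrow>\<^sub>C 'a) set)"
  have T: "u \<in> T \<longleftrightarrow> (\<forall>t. apply_bcontfun u t \<in> cball x0 e)" for u
    by (simp add: T_def mem_PiC_iff Pi_iff)
  have "complete T" unfolding T_def complete_eq_closed by (rule closed_PiC) simp
  have cont: "continuous_on R (\<lambda>t. f (apply_bcontfun u t))" if "u \<in> T" for u R
    using smooth_on_continuous[OF f] that eS unfolding T
    by (intro continuous_on_compose2[OF _ continuous_on_apply_bcontfun, of S]) auto
  \<comment> \<open>The integral from 0 to \<open>cl t\<close> is written as a difference of
    integrals from \<open>- \<delta>\<close>, because \<open>integral\<close> over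
    \<open>{0..cl t}\<close> is 0 when \<open>cl t\<close> is negative.\<close>
  define Q where "Q u t = x0 + (integral {- \<delta>..cl t} (\<lambda>s. f (apply_bcontfun u s)) -
    integral {- \<delta>..0} (\<lambda>s. f (apply_bcontfun u s)))" for u t
  have Qcont: "continuous_on UNIV (Q u)" if u: "u \<in> T" for u
  proof -
    have "continuous_on {- \<delta>..\<delta>} (\<lambda>t. integral {- \<delta>..t} (\<lambda>s. f (apply_bcontfun u s)))"
      by (intro indefinite_integral_continuous_1 integrable_continuous_real cont u)
    then have "continuous_on UNIV (\<lambda>t. integral {- \<delta>..cl t} (\<lambda>s. f (apply_bcontfun u s)))"
      by (rule continuous_on_compose2[OF _ cl_cont]) (use cl in blast)
    then show ?thesis unfolding Q_def by (intro continuous_intros)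
  qed
  have ib: "norm (integral {- \<delta>..s} g) \<le> B * (2 * \<delta>)" "norm (integral {- \<delta>..0} g) \<le> B * \<delta>"
    if g: "continuous_on {- \<delta>..\<delta>} g" "\<And>t. norm (g t) \<le> B" "s \<in> {- \<delta>..\<delta>}" for g :: "real \<Rightarrow> 'a" and B s
  proof -
    have B: "B \<ge> 0" using g(2)[of 0] norm_ge_zero order_trans by blast
    have "norm (integral {- \<delta>..s} g) \<le> B * (s - - \<delta>)"
      using g by (intro integral_bound continuous_on_subset[OF g(1)]) auto
    also have "\<dots> \<le> B * (2 * \<delta>)" using B g(3) by (intro mult_left_mono) auto
    finally show "norm (integral {- \<delta>..s} g) \<le> B * (2 * \<delta>)" .
    have "norm (integral {- \<delta>..0} g) \<le> B * (0 - - \<delta>)"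
      using g \<delta> by (intro integral_bound continuous_on_subset[OF g(1)]) auto
    then show "norm (integral {- \<delta>..0} g) \<le> B * \<delta>" by simp
  qed
  have QT: "Q u t \<in> cball x0 e" if u: "u \<in> T" for u t
  proof -
    have b: "norm (f (apply_bcontfun u s)) \<le> M" for s using fM u T by blast
    have "norm (Q u t - x0) \<le> M * (2 * \<delta>) + M * \<delta>"
      unfolding Q_def add_diff_cancel_left'
      by (rule order_trans[OF norm_triangle_ineq4 add_mono[OF ib[OF cont[OF u] b cl]]])
    then have "norm (Q u t - x0) \<le> e" using \<delta>M by linarith
    then show ?thesis by (simp add: dist_norm norm_minus_commute)
  qed
  have "\<exists>v. \<forall>t. apply_bcontfun v t = Q u t" if u: "u \<in> T" for u
  proof -
    have "Q u \<in> bcontfun"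
    proof (rule bcontfun_normI[OF Qcont[OF u]])
      show "norm (Q u t) \<le> norm x0 + e" for t
        using QT[OF u, of t] norm_triangle_sub[of "Q u t" x0] by (simp add: dist_norm norm_minus_commute)
    qed
    then show ?thesis using Bcontfun_inverse by metis
  qed
  then obtain P where P: "\<And>u t. u \<in> T \<Longrightarrow> apply_bcontfun (P u) t = Q u t" by metis
  have "\<exists>!u. u \<in> T \<and> P u = u"
  proof (rule Banach_fix[OF \<open>complete T\<close>])
    have "const_bcontfun x0 \<in> T" unfolding T using e by simp
    then show "T \<noteq> {}" by blast
    have "P u \<in> T" if "u \<in> T" for u using QT[OF that] unfolding T[of "P u"] P[OF that] by blast
    then show "P ` T \<subseteq> T" by blast
    show "dist (P u) (P v) \<le> 1 / 2 * dist u v" if u: "u \<in> T" and v: "v \<in> T" for u v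
    proof (rule dist_bound)
      fix t
      let ?g = "\<lambda>s. f (apply_bcontfun u s) - f (apply_bcontfun v s)"
      have int: "(\<lambda>s. f (apply_bcontfun w s)) integrable_on {a..b}" if "w \<in> T" for w and a b :: real
        by (intro integrable_continuous_real cont that)
      have b: "norm (?g s) \<le> L * dist u v" for s
      proof -
        have "norm (?g s) \<le> L * norm (apply_bcontfun u s - apply_bcontfun v s)"
          using lip u v T by blast
        also have "\<dots> \<le> L * dist u v"
          using dist_bounded[of u s v] L by (intro mult_left_mono) (auto simp: dist_norm)
        finally show ?thesis .
      qed
      have gc: "continuous_on {- \<delta>..\<delta>} ?g" by (intro continuous_on_diff cont u v)
      have "Q u t - Q v t = integral {- \<delta>..cl t} ?g - integral {- \<delta>..0} ?g"
        unfolding Q_def by (simp add: integral_diff[OF int[OF u] int[OF v]])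
      also have "norm \<dots> \<le> L * dist u v * (2 * \<delta>) + L * dist u v * \<delta>"
        by (rule order_trans[OF norm_triangle_ineq4 add_mono[OF ib[OF gc b cl]]])
      also have "\<dots> = 3 * \<delta> * L * dist u v" by (simp add: algebra_simps)
      also have "\<dots> \<le> 1 / 2 * dist u v" using \<delta>L by (rule mult_right_mono) simp
      finally show "dist (apply_bcontfun (P u) t) (apply_bcontfun (P v) t) \<le> 1 / 2 * dist u v"
        by (simp add: P u v dist_norm)
    qed
  qed auto
  then obtain w where w: "w \<in> T" "P w = w" by blast
  let ?u = "apply_bcontfun w"
  have wQ: "?u t = Q w t" for t using P[OF w(1), of t] w(2) by simp
  show thesis
  proof (rule that[OF \<delta>])
    show "?u 0 = x0" using \<delta> unfolding wQ[of 0] Q_def by (simp add: cl_def)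
    fix t :: real assume t: "\<bar>t\<bar> < \<delta>"
    have "((\<lambda>t. integral {- \<delta>..t} (\<lambda>s. f (?u s))) has_vector_derivative f (?u t)) (at t within {- \<delta>..\<delta>})"
      using t by (intro integral_has_vector_derivative cont w(1)) auto
    then have "((\<lambda>t. integral {- \<delta>..t} (\<lambda>s. f (?u s))) has_vector_derivative f (?u t)) (at t)"
      using t by (subst (asm) at_within_interior) auto
    then have "((\<lambda>t. x0 + (integral {- \<delta>..t} (\<lambda>s. f (?u s)) - integral {- \<delta>..0} (\<lambda>s. f (?u s))))
      has_vector_derivative f (?u t)) (at t)"
      by (rule has_vector_derivative_add[OF has_vector_derivative_const
            has_vector_derivative_diff[OF _ has_vector_derivative_const], simplified])
    then have "(?u has_vector_derivative f (?u t)) (at t)"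
    proof (rule has_vector_derivative_transform_within_open[of _ _ _ "{- \<delta><..<\<delta>}"])
      fix s assume "s \<in> {- \<delta><..<\<delta>}"
      then show "x0 + (integral {- \<delta>..s} (\<lambda>s. f (?u s)) - integral {- \<delta>..0} (\<lambda>s. f (?u s))) = ?u s"
        unfolding wQ[of s] Q_def by (simp add: cl_def)
    qed (use t in auto)
    moreover have "?u t \<in> S" using w(1) eS unfolding T by blast
    ultimately show "?u t \<in> S \<and> (?u has_vector_derivative f (?u t)) (at t)" by blast
  qed
qed

section \<open>Symmetry of second derivatives\<close>

text \<open>The mean value inequality is applied twice to remainders: to the derivative along
  \<open>v\<close> as the point moves along \<open>w\<close>, then to \<open>f\<close> as the point
  moves along \<open>v\<close>. One order of differentiation enters, so exchanging \<open>v\<close>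
  and \<open>w\<close> gives a second estimate of the same difference.\<close>

lemma second_difference:
  fixes f :: "'a::real_normed_vector \<Rightarrow> 'b::real_normed_vector"
  assumes S: "open S" and f: "smooth_on S f" and x: "x \<in> S" and e: "e > 0"
  shows "\<exists>d>0. \<forall>s. 0 < s \<and> s < d \<longrightarrow>
    norm (f (x + s *\<^sub>R v + s *\<^sub>R w) - f (x + s *\<^sub>R v) - f (x + s *\<^sub>R w) + f x
      - (s * s) *\<^sub>R frechet_derivative (\<lambda>z. frechet_derivative f (at z) v) (at x) w) \<le> e * s * s"
proof -
  let ?D = "\<lambda>z. frechet_derivative f (at z)"
  let ?a = "\<lambda>z. frechet_derivative (\<lambda>z. ?D z v) (at z) w"
  have "continuous_on S ?a" by (intro smooth_on_continuous smooth_on_frechet f)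
  then have "open {z \<in> S. ?a z \<in> ball (?a x) e}" by (intro open_preimage_on S open_ball)
  moreover have "x \<in> {z \<in> S. ?a z \<in> ball (?a x) e}" using x e by simp
  ultimately obtain r where r: "r > 0" "ball x r \<subseteq> {z \<in> S. ?a z \<in> ball (?a x) e}"
    unfolding open_contains_ball by blast
  \<comment> \<open>For \<open>s\<close> below \<open>d\<close> the whole parallelogram spanned at
    \<open>x\<close> by \<open>s *\<^sub>R v\<close> and \<open>s *\<^sub>R w\<close> lies in the
    ball; the added 1 covers \<open>v = w = 0\<close>.\<close>
  define d where "d = r / (norm v + norm w + 1)"
  have nz: "norm v + norm w + 1 > 0" by (simp add: add_nonneg_pos)
  have d: "d > 0" unfolding d_def using r(1) nz by simp
  have "norm (f (x + s *\<^sub>R v + s *\<^sub>R w) - f (x + s *\<^sub>R v) - f (x + s *\<^sub>R w) + f x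
      - (s * s) *\<^sub>R ?a x) \<le> e * s * s" if s: "0 < s" "s < d" for s
  proof -
    have near: "x + \<sigma> *\<^sub>R v + \<tau> *\<^sub>R w \<in> S" "norm (?a (x + \<sigma> *\<^sub>R v + \<tau> *\<^sub>R w) - ?a x) \<le> e"
      if "\<sigma> \<in> {0..s}" "\<tau> \<in> {0..s}" for \<sigma> \<tau>
    proof -
      have "norm (\<sigma> *\<^sub>R v + \<tau> *\<^sub>R w) \<le> \<sigma> * norm v + \<tau> * norm w"
        using norm_triangle_ineq[of "\<sigma> *\<^sub>R v" "\<tau> *\<^sub>R w"] that by simp
      also have "\<dots> \<le> s * norm v + s * norm w" using that by (intro add_mono mult_right_mono) auto
      also have "\<dots> < s * (norm v + norm w + 1)" using s by (simp add: algebra_simps)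
      also have "\<dots> \<le> d * (norm v + norm w + 1)" using s nz by (intro mult_right_mono) auto
      also have "\<dots> = r" using nz by (simp add: d_def)
      finally have "x + \<sigma> *\<^sub>R v + \<tau> *\<^sub>R w \<in> ball x r"
        using dist_norm[of "x + \<sigma> *\<^sub>R v + \<tau> *\<^sub>R w" x] by (simp add: dist_commute add.assoc)
      then have "x + \<sigma> *\<^sub>R v + \<tau> *\<^sub>R w \<in> {z \<in> S. ?a z \<in> ball (?a x) e}" using r(2) by blast
      then show "x + \<sigma> *\<^sub>R v + \<tau> *\<^sub>R w \<in> S" "norm (?a (x + \<sigma> *\<^sub>R v + \<tau> *\<^sub>R w) - ?a x) \<le> e"
        by (auto simp: dist_norm norm_minus_commute)
    qed
    have s0: "0 \<in> {0..s}" "s \<in> {0..s}" using s by auto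
    have 1: "norm (?D (x + \<sigma> *\<^sub>R v + s *\<^sub>R w) v - ?D (x + \<sigma> *\<^sub>R v) v - s *\<^sub>R ?a x) \<le> e * s"
      if \<sigma>: "\<sigma> \<in> {0..s}" for \<sigma>
    proof -
      let ?k = "\<lambda>\<tau>. ?D (x + \<sigma> *\<^sub>R v + \<tau> *\<^sub>R w) v - \<tau> *\<^sub>R ?a x"
      have "norm (?k s - ?k 0) \<le> e * \<bar>s - 0\<bar>"
      proof (rule vector_derivative_bound[of "{0..s}" ?k "\<lambda>\<tau>. ?a (x + \<sigma> *\<^sub>R v + \<tau> *\<^sub>R w) - ?a x"])
        fix \<tau> assume \<tau>: "\<tau> \<in> {0..s}"
        let ?z = "x + \<sigma> *\<^sub>R v + \<tau> *\<^sub>R w"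
        have D: "((\<lambda>z. ?D z v) has_derivative frechet_derivative (\<lambda>z. ?D z v) (at ?z)) (at ?z)"
          by (rule smooth_on_has_derivative[OF smooth_on_frechet[OF f] near(1)[OF \<sigma> \<tau>]])
        have "((\<lambda>\<tau>. x + \<sigma> *\<^sub>R v + \<tau> *\<^sub>R w) has_derivative (\<lambda>h. h *\<^sub>R w)) (at \<tau>)"
          by (auto intro!: derivative_eq_intros)
        from has_derivative_compose[OF this D]
        have "((\<lambda>\<tau>. ?D (x + \<sigma> *\<^sub>R v + \<tau> *\<^sub>R w) v) has_vector_derivative ?a ?z) (at \<tau>)"
          unfolding has_vector_derivative_def
          by (simp add: linear_scale[OF has_derivative_linear[OF D]])
        then show "(?k has_vector_derivative ?a ?z - ?a x) (at \<tau>)"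
          by (auto intro!: derivative_eq_intros)
        show "norm (?a ?z - ?a x) \<le> e" by (rule near(2)[OF \<sigma> \<tau>])
      qed (use s0 in auto)
      then show ?thesis using s by (simp add: algebra_simps)
    qed
    let ?h = "\<lambda>\<sigma>. f (x + \<sigma> *\<^sub>R v + s *\<^sub>R w) - f (x + \<sigma> *\<^sub>R v) - \<sigma> *\<^sub>R s *\<^sub>R ?a x"
    have "norm (?h s - ?h 0) \<le> (e * s) * \<bar>s - 0\<bar>"
    proof (rule vector_derivative_bound[of "{0..s}" ?h
          "\<lambda>\<sigma>. ?D (x + \<sigma> *\<^sub>R v + s *\<^sub>R w) v - ?D (x + \<sigma> *\<^sub>R v) v - s *\<^sub>R ?a x"])
      fix \<sigma> assume \<sigma>: "\<sigma> \<in> {0..s}"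
      have D: "((\<lambda>\<sigma>. f (x + \<sigma> *\<^sub>R v + \<tau> *\<^sub>R w)) has_vector_derivative ?D (x + \<sigma> *\<^sub>R v + \<tau> *\<^sub>R w) v) (at \<sigma>)"
        if \<tau>: "\<tau> \<in> {0..s}" for \<tau>
      proof -
        let ?z = "x + \<sigma> *\<^sub>R v + \<tau> *\<^sub>R w"
        have D: "(f has_derivative ?D ?z) (at ?z)" by (rule smooth_on_has_derivative[OF f near(1)[OF \<sigma> \<tau>]])
        have "((\<lambda>\<sigma>. x + \<sigma> *\<^sub>R v + \<tau> *\<^sub>R w) has_derivative (\<lambda>h. h *\<^sub>R v)) (at \<sigma>)"
          by (auto intro!: derivative_eq_intros)
        from has_derivative_compose[OF this D]
        show ?thesis unfolding has_vector_derivative_def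
          by (simp add: linear_scale[OF has_derivative_linear[OF D]])
      qed
      show "(?h has_vector_derivative
          ?D (x + \<sigma> *\<^sub>R v + s *\<^sub>R w) v - ?D (x + \<sigma> *\<^sub>R v) v - s *\<^sub>R ?a x) (at \<sigma>)"
        using D[OF s0(2)] D[OF s0(1)] by (auto intro!: derivative_eq_intros)
      show "norm (?D (x + \<sigma> *\<^sub>R v + s *\<^sub>R w) v - ?D (x + \<sigma> *\<^sub>R v) v - s *\<^sub>R ?a x) \<le> e * s"
        by (rule 1[OF \<sigma>])
    qed (use s0 in auto)
    then show ?thesis using s by (simp add: algebra_simps)
  qed
  then show ?thesis using d by blast
qed

lemma second_derivative_symmetric:
  fixes f :: "'a::real_normed_vector \<Rightarrow> 'b::real_normed_vector"
  assumes S: "open S" and f: "smooth_on S f" and x: "x \<in> S"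
  shows "frechet_derivative (\<lambda>z. frechet_derivative f (at z) v) (at x) w =
    frechet_derivative (\<lambda>z. frechet_derivative f (at z) w) (at x) v" (is "?a = ?b")
proof (rule ccontr)
  assume "?a \<noteq> ?b"
  \<comment> \<open>Both mixed derivatives approximate one and the same second difference within
    \<open>e * s * s\<close>, so they differ by at most \<open>2 * e\<close>, which is half of the
    assumed difference.\<close>
  define e where "e = norm (?a - ?b) / 4"
  have e: "e > 0" using \<open>?a \<noteq> ?b\<close> by (simp add: e_def)
  obtain d1 where d1: "d1 > 0" "\<And>s. 0 < s \<Longrightarrow> s < d1 \<Longrightarrow>
    norm (f (x + s *\<^sub>R v + s *\<^sub>R w) - f (x + s *\<^sub>R v) - f (x + s *\<^sub>R w) + f x - (s * s) *\<^sub>R ?a) \<le> e * s * s"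
    using second_difference[OF S f x e, of v w] by blast
  obtain d2 where d2: "d2 > 0" "\<And>s. 0 < s \<Longrightarrow> s < d2 \<Longrightarrow>
    norm (f (x + s *\<^sub>R w + s *\<^sub>R v) - f (x + s *\<^sub>R w) - f (x + s *\<^sub>R v) + f x - (s * s) *\<^sub>R ?b) \<le> e * s * s"
    using second_difference[OF S f x e, of w v] by blast
  define s where "s = min d1 d2 / 2"
  have s: "0 < s" "s < d1" "s < d2" using d1(1) d2(1) by (auto simp: s_def)
  let ?\<Delta> = "f (x + s *\<^sub>R v + s *\<^sub>R w) - f (x + s *\<^sub>R v) - f (x + s *\<^sub>R w) + f x"
  have 1: "norm (?\<Delta> - (s * s) *\<^sub>R ?a) \<le> e * s * s" using d1(2)[OF s(1,2)] .
  have "f (x + s *\<^sub>R w + s *\<^sub>R v) - f (x + s *\<^sub>R w) - f (x + s *\<^sub>R v) + f x = ?\<Delta>"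
    by (simp add: add.commute add.left_commute)
  then have 2: "norm (?\<Delta> - (s * s) *\<^sub>R ?b) \<le> e * s * s" using d2(2)[OF s(1,3)] by (simp only:)
  have "(s * s) * norm (?a - ?b) = norm ((?\<Delta> - (s * s) *\<^sub>R ?b) - (?\<Delta> - (s * s) *\<^sub>R ?a))"
    using s(1) by (simp flip: scaleR_diff_right)
  also have "\<dots> \<le> e * s * s + e * s * s" by (rule order_trans[OF norm_triangle_ineq4 add_mono[OF 2 1]])
  also have "\<dots> = (s * s) * (2 * e)" by simp
  finally have "norm (?a - ?b) \<le> 2 * e" using s(1) by (simp add: mult_le_cancel_left_pos)
  then show False using e by (simp add: e_def)
qed

section \<open>Integral curves and flows\<close>

lemma vector_fieldsD:
  assumes "X \<in> vector_fields A"
  shows "x \<in> points A \<Longrightarrow> X x \<in> tangent_space A x"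
    "c \<in> A \<Longrightarrow> smooth_on (coords c ` dom_of c) (\<lambda>u. X (point_of c u) c)"
  using assms unfolding vector_fields_def by blast+

lemma integral_curveD:
  assumes "integral_curve A X \<gamma>"
  shows "smooth_at euclid_atlas A \<gamma> t" "\<gamma> t \<in> points A" "velocity A \<gamma> t = X (\<gamma> t)"
    "smooth_map euclid_atlas A \<gamma>"
  using assms smooth_mapD[of euclid_atlas A \<gamma> t] unfolding integral_curve_def by auto

text \<open>Local uniqueness in a chart makes the coincidence set open, the Hausdorff property makes
  its complement open, and the line is connected. This is what makes the description in
  \<open>flow\<close> denote the integral curve.\<close>

lemma integral_curve_unique:
  fixes A :: "('m, 'e::real_normed_vector) atlas"
  assumes A: "smooth_atlas A" and T2: "Hausdorff_space (manifold_topology A)" and X: "X \<in> vector_fields A"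
    and \<gamma>: "integral_curve A X \<gamma>" and \<delta>: "integral_curve A X \<delta>" and eq: "\<gamma> 0 = \<delta> 0"
  shows "\<gamma> = \<delta>"
proof (rule ccontr)
  assume ne: "\<gamma> \<noteq> \<delta>"
  have "open {t. \<gamma> t = \<delta> t}"
  proof (subst open_subopen, intro ballI)
    fix t assume "t \<in> {t. \<gamma> t = \<delta> t}"
    then have t: "\<gamma> t = \<delta> t" by simp
    obtain c where c: "c \<in> charts_at A (\<gamma> t)" using integral_curveD(2)[OF \<gamma>] points_iff by metis
    then have cA: "c \<in> A" and c': "c \<in> charts_at A (\<delta> t)" using t by (auto simp: charts_at_iff)
    obtain V where V: "open V" "t \<in> V" "\<And>s. s \<in> V \<Longrightarrow> \<gamma> s \<in> dom_of c" "smooth_on V (\<lambda>s. coords c (\<gamma> s))"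
      by (rule smooth_at_curveE[OF finite_dim_euclidean A integral_curveD(1)[OF \<gamma>] c]) (rule that)
    obtain W where W: "open W" "t \<in> W" "\<And>s. s \<in> W \<Longrightarrow> \<delta> s \<in> dom_of c" "smooth_on W (\<lambda>s. coords c (\<delta> s))"
      by (rule smooth_at_curveE[OF finite_dim_euclidean A integral_curveD(1)[OF \<delta>] c']) (rule that)
    let ?f = "\<lambda>u. X (point_of c u) c"
    have sol: "coords c (\<beta> s) \<in> coords c ` dom_of c \<and>
        ((\<lambda>s. coords c (\<beta> s)) has_vector_derivative ?f (coords c (\<beta> s))) (at s)"
      if "integral_curve A X \<beta>" "\<beta> s \<in> dom_of c" for \<beta> s
    proof -
      have "c \<in> charts_at A (\<beta> s)" using that cA by (simp add: charts_at_iff)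
      from velocity_chart[OF A integral_curveD(1)[OF that(1)] this]
      show ?thesis using that(2) by (simp add: point_of_coords[OF A cA] integral_curveD(3)[OF that(1)])
    qed
    have "\<exists>\<epsilon>>0. \<forall>s\<in>cball t \<epsilon>. coords c (\<gamma> s) = coords c (\<delta> s)"
      by (rule ode_unique_near[OF smooth_atlasD(1)[OF A] smooth_atlasD(3)[OF A cA] vector_fieldsD(2)[OF X cA]
            open_Int[OF V(1) W(1)]])
         (use sol[OF \<gamma>] sol[OF \<delta>] V W t in auto)
    then obtain \<epsilon> where \<epsilon>: "\<epsilon> > 0" "\<And>s. s \<in> cball t \<epsilon> \<Longrightarrow> coords c (\<gamma> s) = coords c (\<delta> s)" by blast
    have "\<gamma> s = \<delta> s" if "s \<in> V \<inter> W \<inter> ball t \<epsilon>" for s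
      using that V(3) W(3) \<epsilon>(2)[of s] inj_onD[OF smooth_atlasD(2)[OF A cA], of "\<gamma> s" "\<delta> s"] by auto
    then show "\<exists>T. open T \<and> t \<in> T \<and> T \<subseteq> {t. \<gamma> t = \<delta> t}"
      using V W \<epsilon>(1) by (intro exI[of _ "V \<inter> W \<inter> ball t \<epsilon>"]) auto
  qed
  moreover have "open {t. \<gamma> t \<noteq> \<delta> t}"
  proof (subst open_subopen, intro ballI)
    fix t assume "t \<in> {t. \<gamma> t \<noteq> \<delta> t}"
    then have "\<gamma> t \<noteq> \<delta> t" by simp
    moreover have "\<gamma> t \<in> topspace (manifold_topology A)" "\<delta> t \<in> topspace (manifold_topology A)"
      using integral_curveD(2)[OF \<gamma>] integral_curveD(2)[OF \<delta>] by (simp_all add: topspace_manifold_topology[OF A])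
    ultimately obtain U V where U: "openin (manifold_topology A) U" "openin (manifold_topology A) V"
      "\<gamma> t \<in> U" "\<delta> t \<in> V" "disjnt U V"
      using T2 unfolding Hausdorff_space_def by meson
    have "open ({t. \<gamma> t \<in> U} \<inter> {t. \<delta> t \<in> V})"
      by (intro open_Int curve_preimage_open[OF A] integral_curveD(4)[OF \<gamma>] integral_curveD(4)[OF \<delta>] U(1,2))
    then show "\<exists>T. open T \<and> t \<in> T \<and> T \<subseteq> {t. \<gamma> t \<noteq> \<delta> t}"
      using U(3-5) by (intro exI[of _ "{t. \<gamma> t \<in> U} \<inter> {t. \<delta> t \<in> V}"]) (auto simp: disjnt_iff)
  qed
  moreover have "{t. \<gamma> t = \<delta> t} \<inter> {t. \<gamma> t \<noteq> \<delta> t} \<inter> UNIV = {}" by blast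
  moreover have "UNIV \<subseteq> {t. \<gamma> t = \<delta> t} \<union> {t. \<gamma> t \<noteq> \<delta> t}" by blast
  ultimately have "{t. \<gamma> t = \<delta> t} \<inter> UNIV = {} \<or> {t. \<gamma> t \<noteq> \<delta> t} \<inter> UNIV = {}"
    using connectedD[OF connected_UNIV] by metis
  then show False using ne eq by auto
qed

lemma flow_eq:
  assumes "smooth_atlas A" "Hausdorff_space (manifold_topology A)" "X \<in> vector_fields A"
    and \<gamma>: "integral_curve A X \<gamma>" "\<gamma> 0 = x"
  shows "flow A X t x = \<gamma> t"
proof -
  have "(THE \<gamma>. integral_curve A X \<gamma> \<and> \<gamma> 0 = x) = \<gamma>"
    by (rule the_equality) (use \<gamma> integral_curve_unique[OF assms(1-3)] in auto)
  then show ?thesis by (simp add: flow_def)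
qed

lemma integral_curve_map:
  assumes A: "smooth_atlas A" and \<gamma>: "integral_curve A X \<gamma>" and F: "smooth_map A A F"
    and inv: "\<And>x. x \<in> points A \<Longrightarrow> tangent_map A A F x (X x) = X (F x)"
  shows "integral_curve A X (\<lambda>t. F (\<gamma> t))"
  unfolding integral_curve_def
proof (intro conjI allI)
  show "smooth_map euclid_atlas A (\<lambda>t. F (\<gamma> t))"
    by (rule smooth_map_compose[OF smooth_atlas_real A A integral_curveD(4)[OF \<gamma>] F])
  fix t
  show "velocity A (\<lambda>t. F (\<gamma> t)) t = X (F (\<gamma> t))"
    using velocity_map[OF A A integral_curveD(1)[OF \<gamma>] smooth_mapD(1)[OF F integral_curveD(2)[OF \<gamma>]]]
      inv[OF integral_curveD(2)[OF \<gamma>]] by (simp add: integral_curveD(3)[OF \<gamma>])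
qed

lemma flow_equivariant:
  assumes A: "smooth_atlas A" and T2: "Hausdorff_space (manifold_topology A)" and X: "X \<in> vector_fields A"
    and fl: "flow_of_diffeos A X" and F: "smooth_map A A F"
    and inv: "\<And>x. x \<in> points A \<Longrightarrow> tangent_map A A F x (X x) = X (F x)" and x: "x \<in> points A"
  shows "flow A X t (F x) = F (flow A X t x)"
proof -
  obtain \<gamma> where \<gamma>: "integral_curve A X \<gamma>" "\<gamma> 0 = x" using fl x unfolding flow_of_diffeos_def by blast
  show ?thesis
    using flow_eq[OF A T2 X \<gamma>, of t] flow_eq[OF A T2 X integral_curve_map[OF A \<gamma>(1) F inv], of "F x" t] \<gamma>(2)
    by simp
qed

lemma flow_conserves:
  fixes f :: "'m \<Rightarrow> real"
  assumes A: "smooth_atlas A" and T2: "Hausdorff_space (manifold_topology A)" and X: "X \<in> vector_fields A"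
    and fl: "flow_of_diffeos A X" and f: "\<And>x. x \<in> points A \<Longrightarrow> smooth_at A euclid_atlas f x"
    and zero: "\<And>x. x \<in> points A \<Longrightarrow> lie_deriv A X f x = 0" and x: "x \<in> points A"
  shows "f (flow A X t x) = f x"
proof -
  obtain \<gamma> where \<gamma>: "integral_curve A X \<gamma>" "\<gamma> 0 = x" using fl x unfolding flow_of_diffeos_def by blast
  have "((\<lambda>s. f (\<gamma> s)) has_derivative (\<lambda>_. 0)) (at s)" for s
  proof -
    \<comment> \<open>The same choice as inside \<open>lie_deriv\<close>, so that the definition
      unfolds without a change of chart.\<close>
    define c where "c = (SOME c. c \<in> charts_at A (\<gamma> s))"
    have c: "c \<in> charts_at A (\<gamma> s)"
      unfolding c_def using integral_curveD(2)[OF \<gamma>(1), of s] points_iff[of "\<gamma> s" A] someI_ex by metis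
    note fs = f[OF integral_curveD(2)[OF \<gamma>(1)]]
    note comp = smooth_at_compose[OF smooth_atlas_real A smooth_atlas_real integral_curveD(1)[OF \<gamma>(1)] fs]
    have D: "((\<lambda>s. f (\<gamma> s)) has_derivative frechet_derivative (\<lambda>s. f (\<gamma> s)) (at s)) (at s)"
      using rep_derivative[where c = "(UNIV, \<lambda>x. x)" and c' = "(UNIV, \<lambda>x. x)",
          OF smooth_atlas_real smooth_atlas_real comp] by simp
    have "frechet_derivative (\<lambda>s. f (\<gamma> s)) (at s) 1 =
        frechet_derivative (\<lambda>u. f (point_of c u)) (at (coords c (\<gamma> s))) (velocity A \<gamma> s c)"
      using rep_derivative_compose[where c = "(UNIV, \<lambda>x. x)" and c'' = "(UNIV, \<lambda>x. x)" and w = 1,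
          OF smooth_atlas_real A smooth_atlas_real integral_curveD(1)[OF \<gamma>(1)] fs _ c]
      by (simp add: velocity_frechet[OF A integral_curveD(1)[OF \<gamma>(1)] c])
    also have "\<dots> = lie_deriv A X f (\<gamma> s)"
      by (simp add: lie_deriv_def Let_def o_def integral_curveD(3)[OF \<gamma>(1)] flip: c_def)
    also have "\<dots> = 0" by (rule zero[OF integral_curveD(2)[OF \<gamma>(1)]])
    finally have "frechet_derivative (\<lambda>s. f (\<gamma> s)) (at s) h = 0" for h
      using linear_scale[OF has_derivative_linear[OF D], of h 1] by simp
    then have "frechet_derivative (\<lambda>s. f (\<gamma> s)) (at s) = (\<lambda>_. 0)" by (rule ext)
    with D show ?thesis by (simp only:)
  qed
  then have "f (\<gamma> t) = f (\<gamma> 0)"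
    by (intro has_derivative_zero_unique[of UNIV "\<lambda>s. f (\<gamma> s)"]) auto
  then show ?thesis using flow_eq[OF A T2 X \<gamma>, of t] \<gamma>(2) by simp
qed

section \<open>One-parameter subgroups\<close>

text \<open>Product charts are taken apart once, here: multiplication, an action, and an action
  along a one-parameter subgroup all become smooth functions of two coordinate variables through
  it.\<close>

lemma prod_rep:
  fixes A :: "('m, 'e::real_normed_vector) atlas" and B :: "('n, 'f::real_normed_vector) atlas"
    and C :: "('k, 'g::real_normed_vector) atlas"
  assumes A: "smooth_atlas A" and B: "smooth_atlas B" and C: "smooth_atlas C"
    and F: "smooth_map (prod_atlas A B) C (\<lambda>(x, y). F x y)" and a: "a \<in> A" and b: "b \<in> B" and c: "c \<in> C"
  defines "D \<equiv> {z. fst z \<in> coords a ` dom_of a \<and> snd z \<in> coords b ` dom_of b \<and>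
      F (point_of a (fst z)) (point_of b (snd z)) \<in> dom_of c}"
  shows "open D" "smooth_on D (\<lambda>z. coords c (F (point_of a (fst z)) (point_of b (snd z))))"
proof -
  let ?F = "\<lambda>(x, y). F x y"
  note P = smooth_atlas_prod[OF A B]
  have ab: "prod_chart a b \<in> prod_atlas A B" using a b unfolding prod_atlas_alt by blast
  have pt: "?F (point_of (prod_chart a b) z) = F (point_of a (fst z)) (point_of b (snd z))"
    if "fst z \<in> coords a ` dom_of a" "snd z \<in> coords b ` dom_of b" for z
    using point_of_prod[OF A B a b that] by simp
  have D: "D = {u \<in> coords (prod_chart a b) ` dom_of (prod_chart a b).
      ?F (point_of (prod_chart a b) u) \<in> dom_of c}" (is "_ = ?E")
  proof (rule Set.set_eqI)
    fix z :: "'e \<times> 'f"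
    have "z \<in> coords (prod_chart a b) ` dom_of (prod_chart a b) \<longleftrightarrow>
        fst z \<in> coords a ` dom_of a \<and> snd z \<in> coords b ` dom_of b"
      by (simp add: image_prod_chart mem_Times_iff)
    then show "z \<in> D \<longleftrightarrow> z \<in> ?E" unfolding D_def using pt[of z] by auto
  qed
  have sm: "smooth_at (prod_atlas A B) C ?F p" if p: "p \<in> dom_of (prod_chart a b)" for p
  proof -
    have "p \<in> points (prod_atlas A B)" using p ab unfolding points_def by blast
    then show ?thesis by (rule smooth_mapD(1)[OF F])
  qed
  note r = smooth_rep[OF P C ab c sm]
  show op: "open D" unfolding D by (rule r(1))
  show "smooth_on D (\<lambda>z. coords c (F (point_of a (fst z)) (point_of b (snd z))))"
    by (rule smooth_on_cong[OF op _ r(2)[folded D]]) (use pt in \<open>auto simp: D_def\<close>)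
qed

lemma partial_derivative:
  assumes "(g has_derivative g') (at (x, y))"
  shows "((\<lambda>y. g (x, y)) has_derivative (\<lambda>h. g' (0, h))) (at y)"
    "((\<lambda>x. g (x, y)) has_derivative (\<lambda>h. g' (h, 0))) (at x)"
proof -
  have "((\<lambda>y. (x, y)) has_derivative (\<lambda>h. (0, h))) (at y)"
    "((\<lambda>x. (x, y)) has_derivative (\<lambda>h. (h, 0))) (at x)"
    by (auto intro!: derivative_eq_intros)
  then show "((\<lambda>y. g (x, y)) has_derivative (\<lambda>h. g' (0, h))) (at y)"
    "((\<lambda>x. g (x, y)) has_derivative (\<lambda>h. g' (h, 0))) (at x)"
    using has_derivative_compose[of "\<lambda>y. (x, y)" _ y UNIV g g']
      has_derivative_compose[of "\<lambda>x. (x, y)" _ x UNIV g g'] assms by auto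
qed

text \<open>Completeness of the model space, which finite dimension guarantees, enters as the class
  \<open>banach\<close> for the Picard iteration on the group.\<close>

locale lie_grp =
  fixes G :: "('g, 'x) monoid_scheme" (structure) and AG :: "('g, 'k::banach) atlas"
  assumes lie: "lie_group G AG"
begin

lemma grp: "group G" and AG: "smooth_atlas AG" and pts: "points AG = carrier G"
  and mult_smooth: "smooth_map (prod_atlas AG AG) AG (\<lambda>(x, y). x \<otimes> y)"
  and inv_smooth: "smooth_map AG AG (\<lambda>x. inv x)"
  using lie unfolding lie_group_def by (auto intro: smooth_manifold_atlas)

sublocale group G by (rule grp)

lemma smooth_at_mult:
  assumes P: "smooth_atlas P" and f: "smooth_at P AG f x" and g: "smooth_at P AG g x"
  shows "smooth_at P AG (\<lambda>x. f x \<otimes> g x) x"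
proof -
  have "(f x, g x) \<in> points (prod_atlas AG AG)" using smooth_at_points[OF f] smooth_at_points[OF g] by simp
  from smooth_at_compose[OF P smooth_atlas_prod[OF AG AG] AG smooth_at_Pair[OF P AG AG f g]
      smooth_mapD(1)[OF mult_smooth this]]
  show ?thesis by simp
qed

lemma smooth_at_inv:
  assumes P: "smooth_atlas P" and f: "smooth_at P AG f x"
  shows "smooth_at P AG (\<lambda>x. inv (f x)) x"
  using smooth_at_compose[OF P AG AG f smooth_mapD(1)[OF inv_smooth]] smooth_at_points[OF f] by simp

lemma smooth_at_pow:
  assumes P: "smooth_atlas P" and f: "smooth_at P AG f x"
  shows "smooth_at P AG (\<lambda>x. f x [^] (n::nat)) x"
proof (induction n)
  case 0
  then show ?case using smooth_at_const[OF P AG] smooth_at_points[OF f] pts by simp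
next
  case (Suc n)
  then show ?case using smooth_at_mult[OF P Suc f] by simp
qed

end

section \<open>The group multiplication in a chart at the identity\<close>

locale lie_chart = lie_grp G AG
  for G :: "('g, 'x) monoid_scheme" (structure) and AG :: "('g, 'k::banach) atlas" +
  fixes a :: "('g, 'k) chart"
  assumes a1: "a \<in> charts_at AG \<one>"
begin

lemma a: "a \<in> AG" "\<one> \<in> dom_of a" using a1 by (auto simp: charts_at_iff)

text \<open>\<open>m\<close> is the group multiplication in the chart \<open>a\<close> around the identity, defined on \<open>O2\<close>, and
  \<open>left_field h\<close> is the left-invariant vector field whose value at the identity is \<open>h\<close>.\<close>
abbreviation "pt \<equiv> point_of a"
definition "K = coords a ` dom_of a"
definition "O2 = {z. fst z \<in> K \<and> snd z \<in> K \<and> pt (fst z) \<otimes> pt (snd z) \<in> dom_of a}"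
definition "m z = coords a (pt (fst z) \<otimes> pt (snd z))"
definition "e1 = coords a \<one>"
definition "left_field h \<kappa> = frechet_derivative m (at (\<kappa>, e1)) (0, h)"

lemma K_open: "open K" unfolding K_def by (rule smooth_atlasD(3)[OF AG a(1)])
lemma pt_dom: "\<kappa> \<in> K \<Longrightarrow> pt \<kappa> \<in> dom_of a" "\<kappa> \<in> K \<Longrightarrow> coords a (pt \<kappa>) = \<kappa>" "x \<in> dom_of a \<Longrightarrow> pt (coords a x) = x"
  "x \<in> dom_of a \<Longrightarrow> coords a x \<in> K"
  unfolding K_def using point_of_in_dom[of \<kappa> a] coords_point_of[of \<kappa> a] point_of_coords[OF AG a(1)] by auto
lemma dom_carrier: "x \<in> dom_of a \<Longrightarrow> x \<in> carrier G"
  using a(1) unfolding pts[symmetric] points_def by blast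
lemma pt_carrier: "\<kappa> \<in> K \<Longrightarrow> pt \<kappa> \<in> carrier G" using pt_dom(1) dom_carrier by blast
lemma e1: "e1 \<in> K" "pt e1 = \<one>" unfolding e1_def using pt_dom a(2) by auto

lemma O2_open: "open O2" and m_smooth: "smooth_on O2 m"
  using prod_rep[OF AG AG AG mult_smooth a(1) a(1) a(1)] unfolding O2_def m_def K_def by auto

lemma m_K: "z \<in> O2 \<Longrightarrow> m z \<in> K" "z \<in> O2 \<Longrightarrow> pt (m z) = pt (fst z) \<otimes> pt (snd z)"
  unfolding O2_def m_def using pt_dom by auto
lemma O2_e1: "\<kappa> \<in> K \<Longrightarrow> (\<kappa>, e1) \<in> O2" "\<kappa> \<in> K \<Longrightarrow> (e1, \<kappa>) \<in> O2"
  unfolding O2_def using e1 pt_dom pt_carrier by auto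
lemma m_e1: "\<kappa> \<in> K \<Longrightarrow> m (\<kappa>, e1) = \<kappa>" "\<kappa> \<in> K \<Longrightarrow> m (e1, \<kappa>) = \<kappa>"
  unfolding m_def using e1 pt_dom pt_carrier by auto

lemma m_deriv: "z \<in> O2 \<Longrightarrow> (m has_derivative frechet_derivative m (at z)) (at z)"
  by (rule smooth_on_has_derivative[OF m_smooth])

lemma left_field_smooth: "smooth_on K (left_field h)"
  unfolding left_field_def
proof (rule smooth_on_compose[OF finite_dim_prod[OF smooth_atlasD(1)[OF AG] smooth_atlasD(1)[OF AG]]
      K_open O2_open _ _ smooth_on_frechet[OF m_smooth]])
  show "smooth_on K (\<lambda>\<kappa>. (\<kappa>, e1))"
    by (intro smooth_on_Pair K_open smooth_on_const smooth_on_linear bounded_linear_ident)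
qed (use O2_e1 in auto)

lemma left_field_e1: "left_field h e1 = h"
proof -
  have "((\<lambda>\<kappa>. m (e1, \<kappa>)) has_derivative (\<lambda>h. frechet_derivative m (at (e1, e1)) (0, h))) (at e1)"
    by (rule partial_derivative(1)[OF m_deriv[OF O2_e1(1)[OF e1(1)]]])
  then have "((\<lambda>\<kappa>. \<kappa>) has_derivative (\<lambda>h. frechet_derivative m (at (e1, e1)) (0, h))) (at e1)"
    by (rule has_derivative_transform_within_open[OF _ K_open e1(1) m_e1(2)])
  from has_derivative_unique[OF this has_derivative_ident] show ?thesis
    unfolding left_field_def by metis
qed

text \<open>Associativity of \<open>m\<close>, read as an identity in its last argument and
  differentiated at \<open>e1\<close>.\<close>

lemma left_field_invariant:
  assumes z: "(\<kappa>, \<mu>) \<in> O2"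
  shows "frechet_derivative m (at (\<kappa>, \<mu>)) (0, left_field h \<mu>) = left_field h (m (\<kappa>, \<mu>))"
proof -
  have \<mu>: "\<mu> \<in> K" and \<kappa>: "\<kappa> \<in> K" using z by (auto simp: O2_def)
  \<comment> \<open>The arguments for which all products in the associativity law stay inside the
    chart.\<close>
  define N where "N = {\<nu> \<in> {\<nu> \<in> {\<nu> \<in> UNIV. (\<mu>, \<nu>) \<in> O2}. (\<kappa>, m (\<mu>, \<nu>)) \<in> O2}. (m (\<kappa>, \<mu>), \<nu>) \<in> O2}"
  have o1: "open {\<nu> \<in> UNIV. (\<mu>, \<nu>) \<in> O2}" by (intro open_preimage_on O2_open continuous_intros open_UNIV)
  have cm: "continuous_on {\<nu> \<in> UNIV. (\<mu>, \<nu>) \<in> O2} (\<lambda>\<nu>. m (\<mu>, \<nu>))"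
    by (rule continuous_on_compose2[OF smooth_on_continuous[OF m_smooth]]) (auto intro: continuous_intros)
  have o2: "open {\<nu> \<in> {\<nu> \<in> UNIV. (\<mu>, \<nu>) \<in> O2}. (\<kappa>, m (\<mu>, \<nu>)) \<in> O2}"
    by (rule open_preimage_on[OF continuous_on_Pair[OF continuous_on_const cm] o1 O2_open])
  have N: "open N" unfolding N_def
    by (rule open_preimage_on[OF continuous_on_Pair[OF continuous_on_const continuous_on_id] o2 O2_open])
  have e1N: "e1 \<in> N" unfolding N_def using O2_e1 m_e1 \<mu> z m_K by auto
  have assoc: "m (\<kappa>, m (\<mu>, \<nu>)) = m (m (\<kappa>, \<mu>), \<nu>)" if "\<nu> \<in> N" for \<nu>
  proof -
    have "\<nu> \<in> K" "(\<mu>, \<nu>) \<in> O2" using that by (auto simp: N_def O2_def)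
    then show ?thesis
      using m_K(2)[of "(\<mu>, \<nu>)"] m_K(2)[OF z] pt_carrier \<mu> \<kappa> by (simp add: m_def[of "(\<kappa>, m (\<mu>, \<nu>))"] m_def[of "(m (\<kappa>, \<mu>), \<nu>)"] m_assoc)
  qed
  have d1: "((\<lambda>\<nu>. m (\<mu>, \<nu>)) has_derivative (\<lambda>h. frechet_derivative m (at (\<mu>, e1)) (0, h))) (at e1)"
    by (rule partial_derivative(1)[OF m_deriv[OF O2_e1(1)[OF \<mu>]]])
  have d2: "((\<lambda>\<nu>. m (\<kappa>, \<nu>)) has_derivative (\<lambda>h. frechet_derivative m (at (\<kappa>, \<mu>)) (0, h))) (at (m (\<mu>, e1)))"
    using partial_derivative(1)[OF m_deriv[OF z]] by (simp add: m_e1 \<mu>)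
  have "((\<lambda>\<nu>. m (\<kappa>, m (\<mu>, \<nu>))) has_derivative (\<lambda>h. frechet_derivative m (at (\<kappa>, \<mu>))
      (0, frechet_derivative m (at (\<mu>, e1)) (0, h)))) (at e1)"
    by (rule has_derivative_compose[OF d1 d2])
  then have "((\<lambda>\<nu>. m (m (\<kappa>, \<mu>), \<nu>)) has_derivative (\<lambda>h. frechet_derivative m (at (\<kappa>, \<mu>))
      (0, frechet_derivative m (at (\<mu>, e1)) (0, h)))) (at e1)"
    by (rule has_derivative_transform_within_open[OF _ N e1N assoc])
  from has_derivative_unique[OF this partial_derivative(1)[OF m_deriv[OF O2_e1(1)[OF m_K(1)[OF z]]]]]
  show ?thesis unfolding left_field_def by metis
qed

text \<open>Left translation preserves integral curves of a left-invariant field. In the next lemma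
  this makes \<open>m (u s, u t)\<close> and \<open>u (s + t)\<close>, as functions of
  \<open>t\<close>, solutions of the same equation.\<close>

lemma left_field_curve:
  assumes u: "(u has_vector_derivative left_field h (u t)) (at t)" and z: "(\<kappa>, u t) \<in> O2"
  shows "((\<lambda>t. m (\<kappa>, u t)) has_vector_derivative left_field h (m (\<kappa>, u t))) (at t)"
proof -
  note d = partial_derivative(1)[OF m_deriv[OF z]]
  have "((\<lambda>t. m (\<kappa>, u t)) has_derivative
     (\<lambda>r. frechet_derivative m (at (\<kappa>, u t)) (0, r *\<^sub>R left_field h (u t)))) (at t)"
    using has_derivative_compose[OF u[unfolded has_vector_derivative_def] d] .
  then show ?thesis
    using linear_scale[OF has_derivative_linear[OF d]]
    by (simp add: has_vector_derivative_def left_field_invariant[OF z])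
qed

text \<open>The integral curve of the left-invariant field through the identity is multiplicative
  near 0, by uniqueness of solutions.\<close>

lemma local_one_parameter:
  assumes \<xi>: "\<xi> \<in> tangent_space AG \<one>"
  obtains \<epsilon> \<gamma> where "\<epsilon> > 0" "\<And>t. \<bar>t\<bar> < \<epsilon> \<Longrightarrow> smooth_at euclid_atlas AG \<gamma> t" "\<gamma> 0 = \<one>" "velocity AG \<gamma> 0 = \<xi>"
    "\<And>s t. \<bar>s\<bar> < \<epsilon> \<Longrightarrow> \<bar>t\<bar> < \<epsilon> \<Longrightarrow> \<gamma> (s + t) = \<gamma> s \<otimes> \<gamma> t"
proof -
  let ?f = "left_field (\<xi> a)"
  note fd = smooth_atlasD(1)[OF AG] and f = left_field_smooth[of "\<xi> a"]
  obtain \<delta> u where \<delta>: "\<delta> > 0" and u0: "u 0 = e1"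
    and u: "\<And>t::real. \<bar>t\<bar> < \<delta> \<Longrightarrow> u t \<in> K \<and> (u has_vector_derivative ?f (u t)) (at t)"
    by (rule ode_exists[OF fd K_open f e1(1)]) (rule that)
  have I: "t \<in> ball 0 \<delta> \<longleftrightarrow> \<bar>t\<bar> < \<delta>" for t :: real by (simp add: dist_real_def)
  have us: "smooth_on (ball 0 \<delta>) u"
    by (rule ode_solution_smooth[OF fd K_open f open_ball]) (use u I in blast)
  have uc: "continuous_on (ball 0 \<delta>) u" by (rule smooth_on_continuous[OF us])
  have "open (ball (0::real) \<delta> \<times> ball (0::real) \<delta>)" by (intro open_Times open_ball)
  moreover have "continuous_on (ball 0 \<delta> \<times> ball 0 \<delta>) (\<lambda>z. (u (fst z), u (snd z)))"
    by (intro continuous_on_Pair continuous_on_compose2[OF uc] continuous_intros) auto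
  ultimately have "open {z \<in> ball 0 \<delta> \<times> ball 0 \<delta>. (u (fst z), u (snd z)) \<in> O2}"
    by (intro open_preimage_on O2_open)
  moreover have "(0, 0) \<in> {z \<in> ball 0 \<delta> \<times> ball 0 \<delta>. (u (fst z), u (snd z)) \<in> O2}"
    using \<delta> u0 O2_e1 e1 by simp
  ultimately obtain A B where AB: "open A" "open B" "(0, 0) \<in> A \<times> B"
    "A \<times> B \<subseteq> {z \<in> ball 0 \<delta> \<times> ball 0 \<delta>. (u (fst z), u (snd z)) \<in> O2}"
    by (rule open_prod_elim) (rule that)
  then have "open (A \<inter> B)" "0 \<in> A \<inter> B" by auto
  then obtain r where r: "r > 0" "ball 0 r \<subseteq> A \<inter> B" unfolding open_contains_ball by blast
  \<comment> \<open>At most \<open>\<delta> / 2\<close> so that \<open>s + t\<close> stays where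
    \<open>u\<close> solves the equation, and at most \<open>r\<close> so that the products stay in
    the chart.\<close>
  define \<epsilon> where "\<epsilon> = min r (\<delta> / 2)"
  have \<epsilon>: "\<epsilon> > 0" "\<epsilon> \<le> \<delta> / 2" "\<epsilon> \<le> r" using r \<delta> by (auto simp: \<epsilon>_def)
  have uO: "(u s, u t) \<in> O2" if "\<bar>s\<bar> < \<epsilon>" "\<bar>t\<bar> < \<epsilon>" for s t
  proof -
    have "s \<in> A" "t \<in> B" using that r(2) \<epsilon>(3) by (auto simp: subset_iff dist_real_def)
    then show ?thesis using AB(4) by auto
  qed
  have add: "m (u s, u t) = u (s + t)" if s: "\<bar>s\<bar> < \<epsilon>" and t: "\<bar>t\<bar> < \<epsilon>" for s t
  proof (rule ode_unique[where u = "\<lambda>t. m (u s, u t)" and v = "\<lambda>t. u (s + t)" and I = "ball 0 \<epsilon>",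
        OF fd K_open f open_ball connected_ball])
    fix r :: real assume "r \<in> ball 0 \<epsilon>"
    then have r: "\<bar>r\<bar> < \<epsilon>" by simp
    have r\<delta>: "\<bar>r\<bar> < \<delta>" "\<bar>s + r\<bar> < \<delta>" using r s \<epsilon>(2) by linarith+
    show "m (u s, u r) \<in> K \<and> ((\<lambda>t. m (u s, u t)) has_vector_derivative ?f (m (u s, u r))) (at r)"
      using m_K(1)[OF uO[OF s r]] left_field_curve[OF conjunct2[OF u[OF r\<delta>(1)]] uO[OF s r]] by simp
    have "((\<lambda>t. s + t) has_vector_derivative 1) (at r)"
      by (auto intro!: derivative_eq_intros)
    from vector_diff_chain_at[OF this, of u] u[OF r\<delta>(2)]
    show "u (s + r) \<in> K \<and> ((\<lambda>t. u (s + t)) has_vector_derivative ?f (u (s + r))) (at r)"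
      by (simp add: o_def)
    next
    show "m (u s, u 0) = u (s + 0)" using m_e1(1) u[of s] u0 s \<epsilon> by simp
  qed (use \<epsilon> t in auto)
  define \<gamma> where "\<gamma> t = pt (u t)" for t
  have cg: "\<gamma> t \<in> dom_of a" "coords a (\<gamma> t) = u t" if "\<bar>t\<bar> < \<delta>" for t
    using u[OF that] pt_dom unfolding \<gamma>_def by auto
  have sm: "smooth_at euclid_atlas AG \<gamma> t" if "\<bar>t\<bar> < \<delta>" for t
  proof (rule smooth_at_curveI[of a _ _ _ "ball 0 \<delta>"])
    show "smooth_on (ball 0 \<delta>) (\<lambda>s. coords a (\<gamma> s))"
      by (rule smooth_on_cong[OF open_ball _ us]) (use cg in auto)
  qed (use cg that a in \<open>auto simp: charts_at_iff\<close>)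
  have g0: "\<gamma> 0 = \<one>" unfolding \<gamma>_def u0 by (rule e1(2))
  have "velocity AG \<gamma> 0 = \<xi>"
  proof (rule tangent_eqI[of _ AG \<one> _ a])
    have s0: "smooth_at euclid_atlas AG \<gamma> 0" using sm \<delta> by simp
    show "velocity AG \<gamma> 0 \<in> tangent_space AG \<one>" using velocity_in[OF AG s0] g0 by simp
    show "velocity AG \<gamma> 0 a = \<xi> a"
    proof (rule velocity_eqI[OF AG s0])
      have "(u has_vector_derivative \<xi> a) (at 0)" using u[of 0] \<delta> u0 left_field_e1 by simp
      then show "((\<lambda>s. coords a (\<gamma> s)) has_vector_derivative \<xi> a) (at 0)"
        by (rule has_vector_derivative_transform_within_open[OF _ open_ball[of 0 \<delta>]]) (use \<delta> cg in auto)
    qed (use a1 g0 in simp)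
  qed (use \<xi> a1 in auto)
  moreover have "\<gamma> (s + t) = \<gamma> s \<otimes> \<gamma> t" if "\<bar>s\<bar> < \<epsilon>" "\<bar>t\<bar> < \<epsilon>" for s t
    unfolding \<gamma>_def add[OF that, symmetric] m_K(2)[OF uO[OF that]] by simp
  ultimately show thesis using sm g0 \<epsilon> by (intro that[of \<epsilon> \<gamma>]) auto
qed

text \<open>Converse of the local construction, for uniqueness: the homomorphism law for
  \<open>t + s\<close>, differentiated at \<open>s = 0\<close>, is the left-invariant
  equation.\<close>

lemma one_parameter_chart_ode:
  assumes \<gamma>: "one_parameter_subgroup G AG \<gamma>" and v: "velocity AG \<gamma> 0 = \<xi>" and t: "\<gamma> t \<in> dom_of a"
  shows "((\<lambda>s. coords a (\<gamma> s)) has_vector_derivative left_field (\<xi> a) (coords a (\<gamma> t))) (at t)"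
proof -
  let ?u = "\<lambda>s. coords a (\<gamma> s)"
  have sm: "smooth_at euclid_atlas AG \<gamma> s" for s
    using \<gamma> smooth_mapD(1) unfolding one_parameter_subgroup_def by (metis UNIV_I points_euclid)
  have g0: "\<gamma> 0 = \<one>" and add: "\<And>s t. \<gamma> (s + t) = \<gamma> s \<otimes> \<gamma> t"
    using \<gamma> unfolding one_parameter_subgroup_def by auto
  have u0: "(?u has_vector_derivative \<xi> a) (at 0)"
    using velocity_chart[OF AG sm, of a 0] a1 v g0 by simp
  obtain W where W: "open W" "0 \<in> W" "\<And>s. s \<in> W \<Longrightarrow> \<gamma> s \<in> dom_of a" "smooth_on W ?u"
    by (rule smooth_at_curveE[OF finite_dim_euclidean AG sm[of 0]]) (use a1 g0 in simp, rule that)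
  have at: "a \<in> charts_at AG (\<gamma> t)" using t a by (simp add: charts_at_iff)
  obtain V where V: "open V" "t \<in> V" "\<And>s. s \<in> V \<Longrightarrow> \<gamma> s \<in> dom_of a"
    by (rule smooth_at_curveE[OF finite_dim_euclidean AG sm[of t] at]) (rule that)
  define N where "N = W \<inter> (\<lambda>s. t + s) -` V"
  have N: "open N" "0 \<in> N" unfolding N_def using W V by (auto intro!: open_Int open_vimage continuous_intros)
  have utK: "?u t \<in> K" using t pt_dom by simp
  note d = partial_derivative(1)[OF m_deriv[OF O2_e1(1)[OF utK]]]
  have "((\<lambda>s. m (?u t, ?u s)) has_derivative (\<lambda>r. frechet_derivative m (at (?u t, e1)) (0, r *\<^sub>R \<xi> a))) (at 0)"
    by (rule has_derivative_compose[OF u0[unfolded has_vector_derivative_def]])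
       (use d g0 e1_def in simp)
  then have "((\<lambda>s. m (?u t, ?u s)) has_vector_derivative left_field (\<xi> a) (?u t)) (at 0)"
    unfolding has_vector_derivative_def left_field_def using linear_scale[OF has_derivative_linear[OF d]] by simp
  then have "((\<lambda>s. ?u (t + s)) has_vector_derivative left_field (\<xi> a) (?u t)) (at 0)"
    by (rule has_vector_derivative_transform_within_open[OF _ N])
       (use W V t in \<open>auto simp: N_def m_def pt_dom add\<close>)
  then have "((\<lambda>s. ?u (t + s)) has_vector_derivative left_field (\<xi> a) (?u t)) (at (t - t))" by simp
  moreover have "((\<lambda>s. s - t) has_vector_derivative 1) (at t)" by (auto intro!: derivative_eq_intros)
  ultimately show ?thesis using vector_diff_chain_at[of "\<lambda>s. s - t" 1 t "\<lambda>s. ?u (t + s)"] by (simp add: o_def)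
qed

end

section \<open>One-parameter subgroups on the whole line and the exponential map\<close>

context lie_grp begin

text \<open>The bound \<open>\<epsilon>\<close> lets one statement serve local subgroups, where the
  intermediate multiples of \<open>x\<close> stay below \<open>\<epsilon>\<close> in size, and
  global ones, where \<open>\<epsilon>\<close> is taken large.\<close>

lemma one_parameter_power:
  assumes "\<gamma> 0 = \<one>" "\<And>t. \<bar>t\<bar> < \<epsilon> \<Longrightarrow> \<gamma> t \<in> carrier G"
    and add: "\<And>s t. \<bar>s\<bar> < \<epsilon> \<Longrightarrow> \<bar>t\<bar> < \<epsilon> \<Longrightarrow> \<gamma> (s + t) = \<gamma> s \<otimes> \<gamma> t"
    and "\<bar>real k * x\<bar> < \<epsilon>" and "\<bar>x\<bar> < \<epsilon>"
  shows "\<gamma> (real k * x) = \<gamma> x [^] k"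
  using assms(4)
proof (induction k)
  case 0
  then show ?case using assms(1) by simp
next
  case (Suc k)
  have "\<bar>real k * x\<bar> \<le> \<bar>real (Suc k) * x\<bar>" unfolding abs_mult by (intro mult_right_mono) auto
  then have k: "\<bar>real k * x\<bar> < \<epsilon>" using Suc.prems by linarith
  have "\<gamma> (real (Suc k) * x) = \<gamma> (real k * x + x)" by (simp add: algebra_simps)
  also have "\<dots> = \<gamma> x [^] k \<otimes> \<gamma> x" using add[OF k assms(5)] Suc.IH[OF k] by simp
  finally show ?case by simp
qed

text \<open>Uniqueness for the equation in a chart gives agreement near 0, and the value at
  \<open>t\<close> is the \<open>n\<close>-th power of the value at \<open>t / n\<close>.\<close>

lemma one_parameter_unique:
  assumes \<gamma>: "one_parameter_subgroup G AG \<gamma>" and \<delta>: "one_parameter_subgroup G AG \<delta>"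
    and v: "velocity AG \<gamma> 0 = velocity AG \<delta> 0"
  shows "\<gamma> = \<delta>"
proof
  fix t :: real
  obtain a where "a \<in> charts_at AG \<one>" using points_iff[of \<one> AG] pts by auto
  then interpret lie_chart G AG a by unfold_locales
  have P: "smooth_at euclid_atlas AG \<beta> s" "\<beta> 0 = \<one>" "\<beta> (s + r) = \<beta> s \<otimes> \<beta> r" "\<beta> s \<in> carrier G"
    if "one_parameter_subgroup G AG \<beta>" for \<beta> s r
    using that smooth_mapD[of euclid_atlas AG \<beta> s] unfolding one_parameter_subgroup_def by (auto simp: pts)
  obtain V where V: "open V" "0 \<in> V" "\<And>s. s \<in> V \<Longrightarrow> \<gamma> s \<in> dom_of a"
    by (rule smooth_at_curveE[OF finite_dim_euclidean AG P(1)[OF \<gamma>, of 0]])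
      (use a1 P(2)[OF \<gamma>] in simp, rule that)
  obtain W where W: "open W" "0 \<in> W" "\<And>s. s \<in> W \<Longrightarrow> \<delta> s \<in> dom_of a"
    by (rule smooth_at_curveE[OF finite_dim_euclidean AG P(1)[OF \<delta>, of 0]])
      (use a1 P(2)[OF \<delta>] in simp, rule that)
  have "\<exists>r>0. \<forall>s\<in>cball 0 r. coords a (\<gamma> s) = coords a (\<delta> s)"
    by (rule ode_unique_near[OF smooth_atlasD(1)[OF AG] K_open left_field_smooth open_Int[OF V(1) W(1)]])
       (use V W P(2)[OF \<gamma>] P(2)[OF \<delta>] pt_dom(4) one_parameter_chart_ode[OF \<gamma> v]
         one_parameter_chart_ode[OF \<delta> refl] in auto)
  then obtain r0 where r0: "r0 > 0" "\<And>s. s \<in> cball 0 r0 \<Longrightarrow> coords a (\<gamma> s) = coords a (\<delta> s)" by blast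
  obtain r1 where r1: "r1 > 0" "ball 0 r1 \<subseteq> V \<inter> W" using V W open_Int open_contains_ball by (metis IntI)
  define r where "r = min r0 r1"
  have r: "r > 0" using r0 r1 by (simp add: r_def)
  have near: "\<gamma> s = \<delta> s" if "\<bar>s\<bar> < r" for s
  proof -
    have "s \<in> V \<inter> W" using r1(2) that by (auto simp: r_def subset_iff dist_real_def)
    then show ?thesis
      using r0(2)[of s] that V(3) W(3) inj_onD[OF smooth_atlasD(2)[OF AG a(1)], of "\<gamma> s" "\<delta> s"]
      by (auto simp: r_def dist_real_def)
  qed
  obtain n where n: "\<bar>t\<bar> / r < real n" using reals_Archimedean2 by blast
  then have n0: "real n > 0" using r by (smt (verit) divide_nonneg_nonneg abs_ge_zero)
  have s: "\<bar>t / real n\<bar> < r" using n n0 r by (simp add: field_simps)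
  \<comment> \<open>Any bound exceeding both \<open>\<bar>t\<bar>\<close> and
    \<open>\<bar>t / real n\<bar>\<close> will do, since the law holds for all times.\<close>
  have "\<beta> t = \<beta> (t / real n) [^] n" if "one_parameter_subgroup G AG \<beta>" for \<beta>
    using one_parameter_power[of \<beta> "\<bar>t\<bar> + \<bar>t / real n\<bar> + 1" n "t / real n"] P[OF that] n0
    by (simp add: add_nonneg_pos)
  then show "\<gamma> t = \<delta> t" using \<gamma> \<delta> near[OF s] by metis
qed

lemma one_parameter_exists:
  assumes \<xi>: "\<xi> \<in> lie_algebra G AG"
  obtains \<Gamma> where "one_parameter_subgroup G AG \<Gamma>" "velocity AG \<Gamma> 0 = \<xi>"
proof -
  obtain a where "a \<in> charts_at AG \<one>" using points_iff[of \<one> AG] pts by auto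
  then interpret lie_chart G AG a by unfold_locales
  obtain \<epsilon> \<gamma> where \<epsilon>: "\<epsilon> > 0" and sm: "\<And>t. \<bar>t\<bar> < \<epsilon> \<Longrightarrow> smooth_at euclid_atlas AG \<gamma> t"
    and g0: "\<gamma> 0 = \<one>" and v: "velocity AG \<gamma> 0 = \<xi>"
    and add: "\<And>s t. \<bar>s\<bar> < \<epsilon> \<Longrightarrow> \<bar>t\<bar> < \<epsilon> \<Longrightarrow> \<gamma> (s + t) = \<gamma> s \<otimes> \<gamma> t"
    by (rule local_one_parameter[OF \<xi>[unfolded lie_algebra_def]]) (rule that)
  have car: "\<gamma> t \<in> carrier G" if "\<bar>t\<bar> < \<epsilon>" for t using smooth_at_points[OF sm[OF that]] pts by simp
  \<comment> \<open>The local subgroup is extended by \<open>\<Gamma> t = \<gamma> (t / n)\<^sup>n\<close>, which does not depend on the large \<open>n\<close> chosen.\<close>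
  define n where "n t = nat \<lceil>\<bar>t\<bar> / \<epsilon>\<rceil> + 1" for t :: real
  define \<Gamma> where "\<Gamma> t = \<gamma> (t / real (n t)) [^] n t" for t
  have n: "\<bar>t / real (n t)\<bar> < \<epsilon>" "n t > 0" for t
  proof -
    have "\<bar>t\<bar> / \<epsilon> < real (n t)" unfolding n_def using \<epsilon> by linarith
    then have "\<bar>t\<bar> < real (n t) * \<epsilon>" using \<epsilon> by (simp add: pos_divide_less_eq)
    moreover have "real (n t) > 0" by (simp add: n_def)
    ultimately show "\<bar>t / real (n t)\<bar> < \<epsilon>" by (simp add: pos_divide_less_eq mult.commute)
  qed (simp add: n_def)
  \<comment> \<open>Two admissible numbers of pieces are compared through their product, which
    refines both.\<close>
  have refine: "\<gamma> (t / real k) [^] k = \<gamma> (t / real (k * l)) [^] (k * l)"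
    if "k > 0" "l > 0" "\<bar>t / real k\<bar> < \<epsilon>" for t k l
  proof -
    have "\<bar>t / real (k * l)\<bar> = \<bar>t / real k\<bar> / real l" by simp
    also have "\<dots> \<le> \<bar>t / real k\<bar> / 1" using that(2) by (intro divide_left_mono) auto
    finally have s: "\<bar>t / real (k * l)\<bar> < \<epsilon>" using that(3) by linarith
    have "real l * (t / real (k * l)) = t / real k" using that by (simp add: field_simps)
    then have "\<gamma> (t / real k) = \<gamma> (t / real (k * l)) [^] l"
      using one_parameter_power[where k = l and x = "t / real (k * l)", OF g0 car add] s that(3) by simp
    then show ?thesis using nat_pow_pow[OF car[OF s], of l k] by (simp add: mult.commute)
  qed
  have \<Gamma>: "\<Gamma> t = \<gamma> (t / real k) [^] k" if "k > 0" "\<bar>t / real k\<bar> < \<epsilon>" for t k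
    unfolding \<Gamma>_def refine[OF that(1) n(2)[of t] that(2)] refine[OF n(2)[of t] that(1) n(1)]
    by (simp add: mult.commute)
  have large: "\<exists>k>0. \<forall>t. \<bar>t\<bar> \<le> R \<longrightarrow> \<bar>t / real k\<bar> < \<epsilon>" if "R \<ge> 0" for R
  proof -
    obtain k where k0: "R / \<epsilon> < real k" using reals_Archimedean2 by blast
    have "R / \<epsilon> \<ge> 0" using that \<epsilon> by simp
    then have k: "R < \<epsilon> * real k" "real k > 0"
      using k0 \<epsilon> by (simp add: field_simps, linarith)
    then have "\<bar>t / real k\<bar> < \<epsilon>" if "\<bar>t\<bar> \<le> R" for t using that by (simp add: field_simps)
    then show ?thesis using k(2) by auto
  qed
  have "smooth_at euclid_atlas AG \<Gamma> t" for t
  proof -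
    \<comment> \<open>One \<open>k\<close> serves a whole neighbourhood of \<open>t\<close>, so
      \<open>\<Gamma>\<close> is there a fixed power of a smooth curve although \<open>n\<close>
      jumps.\<close>
    obtain k where k: "k > 0" "\<And>s. \<bar>s\<bar> \<le> \<bar>t\<bar> + 1 \<Longrightarrow> \<bar>s / real k\<bar> < \<epsilon>" using large[of "\<bar>t\<bar> + 1"] by auto
    have "smooth_at euclid_atlas euclid_atlas (\<lambda>s. s / real k) t"
      by (rule smooth_at_fun[of "(UNIV, \<lambda>x. x)" _ _ UNIV])
         (auto intro: smooth_on_linear bounded_linear_divide)
    from smooth_at_pow[OF smooth_atlas_real smooth_at_compose[OF smooth_atlas_real smooth_atlas_real AG this sm], of k]
    have 1: "smooth_at euclid_atlas AG (\<lambda>s. \<gamma> (s / real k) [^] k) t" using k(2)[of t] by simp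
    show ?thesis
    proof (rule smooth_at_cong[OF smooth_atlas_real AG 1, of "(UNIV, \<lambda>x. x)" "ball t 1"])
      fix s assume "coords (UNIV, \<lambda>x. x) s \<in> ball t 1"
      then have "\<bar>s / real k\<bar> < \<epsilon>" by (intro k(2)) (auto simp: dist_real_def)
      then show "\<gamma> (s / real k) [^] k = \<Gamma> s" using \<Gamma>[OF k(1)] by simp
    qed auto
  qed
  then have smooth: "smooth_map euclid_atlas AG \<Gamma>" by (intro smooth_mapI) auto
  have near: "\<Gamma> t = \<gamma> t" if "\<bar>t\<bar> < \<epsilon>" for t using \<Gamma>[of 1 t] that car[OF that] by simp
  have "\<Gamma> (s + t) = \<Gamma> s \<otimes> \<Gamma> t" for s t
  proof -
    obtain k where k: "k > 0" "\<And>r. \<bar>r\<bar> \<le> \<bar>s\<bar> + \<bar>t\<bar> \<Longrightarrow> \<bar>r / real k\<bar> < \<epsilon>" using large[of "\<bar>s\<bar> + \<bar>t\<bar>"] by auto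
    have b: "\<bar>s / real k\<bar> < \<epsilon>" "\<bar>t / real k\<bar> < \<epsilon>" "\<bar>(s + t) / real k\<bar> < \<epsilon>" 
      by (rule k(2); linarith)+
    \<comment> \<open>Commutativity of addition makes \<open>\<gamma> (s / real k)\<close> and
      \<open>\<gamma> (t / real k)\<close> commute, as the power of a product requires.\<close>
    have 1: "\<gamma> ((s + t) / real k) = \<gamma> (s / real k) \<otimes> \<gamma> (t / real k)"
      "\<gamma> ((s + t) / real k) = \<gamma> (t / real k) \<otimes> \<gamma> (s / real k)"
      using add[OF b(1,2)] add[OF b(2,1)] by (simp_all add: add_divide_distrib add.commute)
    have "(\<gamma> (s / real k) \<otimes> \<gamma> (t / real k)) [^] k = \<gamma> (s / real k) [^] k \<otimes> \<gamma> (t / real k) [^] k"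
      by (rule pow_mult_distrib) (use 1 car b in auto)
    then show ?thesis unfolding \<Gamma>[OF k(1) b(1)] \<Gamma>[OF k(1) b(2)] \<Gamma>[OF k(1) b(3)] 1(1) .
  qed
  then have "one_parameter_subgroup G AG \<Gamma>"
    unfolding one_parameter_subgroup_def using smooth near[of 0] \<epsilon> g0 by simp
  moreover have "velocity AG \<Gamma> 0 = \<xi>"
    unfolding v[symmetric] by (rule velocity_cong[of "ball 0 \<epsilon>"]) (use near \<epsilon> in auto)
  ultimately show thesis by (rule that)
qed

lemma one_parameterD:
  assumes "one_parameter_subgroup G AG \<gamma>"
  shows "smooth_map euclid_atlas AG \<gamma>" "smooth_at euclid_atlas AG \<gamma> t" "\<gamma> 0 = \<one>"
    "\<gamma> (s + t) = \<gamma> s \<otimes> \<gamma> t" "\<gamma> t \<in> carrier G" "inv (\<gamma> t) = \<gamma> (- t)"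
proof -
  show 1: "smooth_map euclid_atlas AG \<gamma>" "\<gamma> 0 = \<one>" "\<gamma> (s + t) = \<gamma> s \<otimes> \<gamma> t" for s t
    using assms unfolding one_parameter_subgroup_def by auto
  show "smooth_at euclid_atlas AG \<gamma> t" using smooth_mapD(1)[OF 1(1)] by simp
  show c: "\<gamma> t \<in> carrier G" for t using smooth_mapD(2)[OF 1(1), of t] pts by simp
  show "inv (\<gamma> t) = \<gamma> (- t)" by (rule inv_equality) (use 1(2) 1(3)[of "- t" t] c in auto)
qed

text \<open>\<open>lie_exp\<close> evaluates at time 1 the subgroup whose velocity is
  \<open>t\<close> times \<open>\<xi>\<close>, and this subgroup is
  \<open>s \<mapsto> \<gamma> (t * s)\<close>.\<close>

lemma lie_exp_eq:
  assumes \<gamma>: "one_parameter_subgroup G AG \<gamma>" and v: "velocity AG \<gamma> 0 = \<xi>"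
  shows "lie_exp G AG (\<lambda>c. t *\<^sub>R \<xi> c) = \<gamma> t"
proof -
  note P = one_parameterD[OF \<gamma>]
  have lin: "smooth_at euclid_atlas euclid_atlas (\<lambda>s::real. t * s) s" for s
    by (rule smooth_at_fun[of "(UNIV, \<lambda>x. x)" _ _ UNIV]) (auto intro: smooth_on_linear bounded_linear_mult_right)
  have sm: "smooth_at euclid_atlas AG (\<lambda>s. \<gamma> (t * s)) s" for s
    by (rule smooth_at_compose[OF smooth_atlas_real smooth_atlas_real AG lin P(2)])
  have 1: "one_parameter_subgroup G AG (\<lambda>s. \<gamma> (t * s))"
    unfolding one_parameter_subgroup_def using sm P(3,4) by (auto intro: smooth_mapI simp: distrib_left)
  have "velocity AG (\<lambda>s. \<gamma> (t * s)) 0 = (\<lambda>c. t *\<^sub>R \<xi> c)"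
  proof
    fix c
    show "velocity AG (\<lambda>s. \<gamma> (t * s)) 0 c = t *\<^sub>R \<xi> c"
    proof (cases "c \<in> charts_at AG \<one>")
      case True
      have "((\<lambda>s. t * s) has_vector_derivative t) (at 0)" by (auto intro!: derivative_eq_intros)
      moreover have "((\<lambda>s. coords c (\<gamma> s)) has_vector_derivative \<xi> c) (at (t * 0))"
        using velocity_chart[OF AG P(2), of c 0] True v P(3) by simp
      ultimately have "((\<lambda>s. coords c (\<gamma> (t * s))) has_vector_derivative t *\<^sub>R \<xi> c) (at 0)"
        using vector_diff_chain_at[of "\<lambda>s. t * s" t 0 "\<lambda>s. coords c (\<gamma> s)"] by (simp add: o_def)
      then show ?thesis by (intro velocity_eqI[OF AG sm]) (use True P(3) in auto)
    next
      case False
      then show ?thesis using P(3) v velocity_outside[of c AG \<gamma> 0] by (simp add: velocity_def)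
    qed
  qed
  then have "(THE \<gamma>. one_parameter_subgroup G AG \<gamma> \<and> velocity AG \<gamma> 0 = (\<lambda>c. t *\<^sub>R \<xi> c)) = (\<lambda>s. \<gamma> (t * s))"
    using 1 by (intro the_equality) (auto intro: one_parameter_unique)
  then show ?thesis by (simp add: lie_exp_def)
qed

end

section \<open>Symmetries of vector fields\<close>

text \<open>The manifold is left abstract because the theory is applied both to \<open>Q\<close> and
  to its cotangent bundle with the lifted action.\<close>

locale lie_action = lie_grp G AG
  for G :: "('g, 'x) monoid_scheme" (structure) and AG :: "('g, 'k::banach) atlas" +
  fixes M :: "('m, 'e::real_normed_vector) atlas" and \<Phi> :: "'g \<Rightarrow> 'm \<Rightarrow> 'm"
  assumes M: "smooth_atlas M" and action: "smooth_action G AG M \<Phi>"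
begin

lemma \<Phi>_one: "x \<in> points M \<Longrightarrow> \<Phi> \<one> x = x"
  and \<Phi>_mult: "g \<in> carrier G \<Longrightarrow> g' \<in> carrier G \<Longrightarrow> x \<in> points M \<Longrightarrow> \<Phi> (g \<otimes> g') x = \<Phi> g (\<Phi> g' x)"
  and \<Phi>_smooth: "smooth_map (prod_atlas AG M) M (\<lambda>(g, x). \<Phi> g x)"
  using action unfolding smooth_action_def by blast+

lemma \<Phi>_points: "g \<in> carrier G \<Longrightarrow> x \<in> points M \<Longrightarrow> \<Phi> g x \<in> points M"
  using smooth_mapD(2)[OF \<Phi>_smooth, of "(g, x)"] pts by simp

lemma \<Phi>_inv: "g \<in> carrier G \<Longrightarrow> x \<in> points M \<Longrightarrow> \<Phi> (inv g) (\<Phi> g x) = x"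
  by (simp add: \<Phi>_mult[symmetric] \<Phi>_one)

lemma smooth_at_action:
  assumes P: "smooth_atlas P" and f: "smooth_at P AG f p" and h: "smooth_at P M h p"
  shows "smooth_at P M (\<lambda>p. \<Phi> (f p) (h p)) p"
proof -
  have "(f p, h p) \<in> points (prod_atlas AG M)" using smooth_at_points[OF f] smooth_at_points[OF h] by simp
  from smooth_at_compose[OF P smooth_atlas_prod[OF AG M] M smooth_at_Pair[OF P AG M f h]
      smooth_mapD(1)[OF \<Phi>_smooth this]]
  show ?thesis by simp
qed

lemma \<Phi>_smooth_at: "g \<in> carrier G \<Longrightarrow> x \<in> points M \<Longrightarrow> smooth_at M M (\<Phi> g) x"
  by (rule smooth_at_action[OF M smooth_at_const[OF M AG] smooth_at_id[OF M]]) (auto simp: pts)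

lemma \<Phi>_smooth_map: "g \<in> carrier G \<Longrightarrow> smooth_map M M (\<Phi> g)"
  by (rule smooth_mapI) (rule \<Phi>_smooth_at)

lemma orbit_smooth_at: "g \<in> carrier G \<Longrightarrow> x \<in> points M \<Longrightarrow> smooth_at AG M (\<lambda>g. \<Phi> g x) g"
  by (rule smooth_at_action[OF AG smooth_at_id[OF AG] smooth_at_const[OF AG M]]) (auto simp: pts)

lemma generator_eq:
  assumes "one_parameter_subgroup G AG \<gamma>" "velocity AG \<gamma> 0 = \<xi>"
  shows "generator G AG M \<Phi> \<xi> x = velocity M (\<lambda>t. \<Phi> (\<gamma> t) x) 0"
  unfolding generator_def lie_exp_eq[OF assms] ..

lemma curve_action_smooth_at:
  assumes "one_parameter_subgroup G AG \<gamma>" "x \<in> points M"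
  shows "smooth_at euclid_atlas M (\<lambda>t. \<Phi> (\<gamma> t) x) t"
  by (rule smooth_at_action[OF smooth_atlas_real one_parameterD(2)[OF assms(1)]
        smooth_at_const[OF smooth_atlas_real M _ assms(2)]]) simp

lemma generator_in:
  assumes \<xi>: "\<xi> \<in> lie_algebra G AG" and x: "x \<in> points M"
  shows "generator G AG M \<Phi> \<xi> x \<in> tangent_space M x"
proof -
  obtain \<gamma> where \<gamma>: "one_parameter_subgroup G AG \<gamma>" "velocity AG \<gamma> 0 = \<xi>"
    by (rule one_parameter_exists[OF \<xi>]) (rule that)
  show ?thesis
    using velocity_in[OF M curve_action_smooth_at[OF \<gamma>(1) x], of 0]
    unfolding generator_eq[OF \<gamma>] by (simp add: one_parameterD(3)[OF \<gamma>(1)] \<Phi>_one x)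
qed

end

text \<open>One chart serves as source and target: the bracket is computed in it at a single point,
  whose orbit stays in it for small times.\<close>

locale one_parameter_action = lie_action G AG M \<Phi>
  for G :: "('g, 'x) monoid_scheme" (structure) and AG :: "('g, 'k::banach) atlas"
  and M :: "('m, 'e::real_normed_vector) atlas" and \<Phi> +
  fixes \<gamma> :: "real \<Rightarrow> 'g" and c :: "('m, 'e) chart"
  assumes \<gamma>: "one_parameter_subgroup G AG \<gamma>" and c: "c \<in> M"
begin

definition "D = {z. snd z \<in> coords c ` dom_of c \<and> \<Phi> (\<gamma> (fst z)) (point_of c (snd z)) \<in> dom_of c}"
definition "\<Psi> z = coords c (\<Phi> (\<gamma> (fst z)) (point_of c (snd z)))"

lemma D_open: "open D" and \<Psi>_smooth: "smooth_on D \<Psi>"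
proof -
  have F: "smooth_map (prod_atlas euclid_atlas M) M (\<lambda>(t, x). \<Phi> (\<gamma> t) x)"
  proof (rule smooth_mapI)
    fix p :: "real \<times> 'm" assume "p \<in> points (prod_atlas euclid_atlas M)"
    then have p: "fst p \<in> points (euclid_atlas :: (real, real) atlas)" "snd p \<in> points M" by auto
    note P = smooth_atlas_prod[OF smooth_atlas_real M]
    have 1: "smooth_at (prod_atlas euclid_atlas M) AG (\<lambda>p. \<gamma> (fst p)) p"
      using smooth_at_compose[OF P smooth_atlas_real AG smooth_at_fst[OF smooth_atlas_real M p] one_parameterD(2)[OF \<gamma>]]
      by simp
    have 2: "smooth_at (prod_atlas euclid_atlas M) M snd p"
      using smooth_at_snd[OF smooth_atlas_real M p] by simp
    show "smooth_at (prod_atlas euclid_atlas M) M (\<lambda>(t, x). \<Phi> (\<gamma> t) x) p"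
      using smooth_at_action[OF P 1 2] by (simp add: split_def)
  qed
  have e: "(UNIV, \<lambda>x. x) \<in> (euclid_atlas :: (real, real) atlas)" by (simp add: euclid_atlas_def)
  show "open D" "smooth_on D \<Psi>"
    using prod_rep[OF smooth_atlas_real M M F e c c] unfolding D_def \<Psi>_def by simp_all
qed

lemma point_in:
  assumes "u \<in> coords c ` dom_of c"
  shows "point_of c u \<in> dom_of c" "point_of c u \<in> points M" "coords c (point_of c u) = u" "c \<in> charts_at M (point_of c u)"
  using point_of_in_dom[OF assms] coords_point_of[OF assms] c unfolding points_def charts_at_iff by auto

lemma D_zero: "u \<in> coords c ` dom_of c \<Longrightarrow> (0, u) \<in> D" "u \<in> coords c ` dom_of c \<Longrightarrow> \<Psi> (0, u) = u"
  unfolding D_def \<Psi>_def using point_in by (auto simp: one_parameterD(3)[OF \<gamma>] \<Phi>_one)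

lemma \<Psi>_deriv: "z \<in> D \<Longrightarrow> (\<Psi> has_derivative frechet_derivative \<Psi> (at z)) (at z)"
  by (rule smooth_on_has_derivative[OF \<Psi>_smooth])

lemma fd_prod: "finite_dim TYPE(real \<times> 'e)"
  by (rule finite_dim_prod[OF finite_dim_euclidean smooth_atlasD(1)[OF M]])

lemma velocity_rep:
  assumes u: "u \<in> coords c ` dom_of c"
  shows "velocity M (\<lambda>t. \<Phi> (\<gamma> t) (point_of c u)) 0 c = frechet_derivative \<Psi> (at (0, u)) (1, 0)"
proof (rule velocity_eqI[OF M curve_action_smooth_at[OF \<gamma> point_in(2)[OF u]]])
  show "c \<in> charts_at M (\<Phi> (\<gamma> 0) (point_of c u))"
    using point_in[OF u] by (simp add: one_parameterD(3)[OF \<gamma>] \<Phi>_one)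
  note d = partial_derivative(2)[OF \<Psi>_deriv[OF D_zero(1)[OF u]]]
  have "(\<lambda>h. frechet_derivative \<Psi> (at (0, u)) (h, 0)) = (\<lambda>h. h *\<^sub>R frechet_derivative \<Psi> (at (0, u)) (1, 0))"
  proof
    fix h :: real
    show "frechet_derivative \<Psi> (at (0, u)) (h, 0) = h *\<^sub>R frechet_derivative \<Psi> (at (0, u)) (1, 0)"
      using linear_scale[OF has_derivative_linear[OF d], of h 1] by simp
  qed
  then show "((\<lambda>s. coords c (\<Phi> (\<gamma> s) (point_of c u))) has_vector_derivative
      frechet_derivative \<Psi> (at (0, u)) (1, 0)) (at 0)"
    using d by (simp add: has_vector_derivative_def \<Psi>_def)
qed

lemma velocity_rep_smooth:
  "smooth_on (coords c ` dom_of c) (\<lambda>u. velocity M (\<lambda>t. \<Phi> (\<gamma> t) (point_of c u)) 0 c)"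
proof -
  note K = smooth_atlasD(3)[OF M c]
  have "smooth_on (coords c ` dom_of c) (\<lambda>u. (0::real, u))"
    by (intro smooth_on_Pair K smooth_on_const smooth_on_linear bounded_linear_ident)
  then have "smooth_on (coords c ` dom_of c) (\<lambda>u. frechet_derivative \<Psi> (at (0, u)) (1, 0))"
    by (rule smooth_on_compose[OF fd_prod K D_open _ _ smooth_on_frechet[OF \<Psi>_smooth], rotated]) (use D_zero in blast)
  then show ?thesis by (rule smooth_on_cong[OF K, rotated]) (simp add: velocity_rep)
qed

lemma partial_frechet:
  assumes "(t, u) \<in> D"
  shows "frechet_derivative (\<lambda>u. coords c (\<Phi> (\<gamma> t) (point_of c u))) (at u) w = frechet_derivative \<Psi> (at (t, u)) (0, w)"
  using frechet_derivative_at[OF partial_derivative(1)[OF \<Psi>_deriv[OF assms]]] by (simp add: \<Psi>_def fun_eq_iff)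

text \<open>The derivative at \<open>t = 0\<close> of the pullback of \<open>X\<close> along \<open>\<Phi> (\<gamma> t)\<close> is the bracket of the
  generator with \<open>X\<close>; the mixed second derivatives of \<open>\<Psi>\<close> are exchanged here.\<close>
lemma pullback_derivative:
  assumes X: "X \<in> vector_fields M" and x: "x \<in> dom_of c"
    and br: "lie_bracket M X (\<lambda>y. velocity M (\<lambda>t. \<Phi> (\<gamma> t) y) 0) x = (\<lambda>c. 0)"
  shows "((\<lambda>t. tangent_map M M (\<Phi> (inv (\<gamma> t))) (\<Phi> (\<gamma> t) x) (X (\<Phi> (\<gamma> t) x)) c) has_vector_derivative 0) (at 0)"
proof -
  define u0 where "u0 = coords c x"
  let ?X = "\<lambda>u. X (point_of c u) c" and ?\<eta> = "\<lambda>u. velocity M (\<lambda>t. \<Phi> (\<gamma> t) (point_of c u)) 0 c"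
  note X' = vector_fieldsD(2)[OF X c] and K = smooth_atlasD(3)[OF M c]
  have u0: "u0 \<in> coords c ` dom_of c" "point_of c u0 = x" unfolding u0_def using x point_of_coords[OF M c] by auto
  have xM: "x \<in> points M" using point_in(2)[OF u0(1)] u0(2) by simp
  have cx: "c \<in> charts_at M x" using c x by (simp add: charts_at_iff)
  \<comment> \<open>\<open>H (s, u)\<close> is the field \<open>X\<close> at \<open>u\<close> pushed
    forward by \<open>\<Phi> (\<gamma> s)\<close>, in coordinates. The pull-back is
    \<open>H (- t, ?x t)\<close>, with \<open>?x\<close> the orbit of \<open>x\<close>, so the chain
    rule splits its derivative into a time part at a fixed point and a space part at time 0.\<close>
  define H where "H z = frechet_derivative \<Psi> (at z) (0, ?X (snd z))" for z
  have H: "smooth_on D H" unfolding H_def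
  proof (rule smooth_on_frechet_field[OF fd_prod D_open D_open _ _ _ \<Psi>_smooth])
    show "smooth_on D (\<lambda>z. z)" by (intro smooth_on_linear bounded_linear_ident D_open)
    have "smooth_on D (\<lambda>z. ?X (snd z))"
      by (rule smooth_on_compose[OF smooth_atlasD(1)[OF M] D_open K _ _ X'])
         (auto simp: D_def intro: smooth_on_linear bounded_linear_snd D_open[unfolded D_def])
    then show "smooth_on D (\<lambda>z. (0, ?X (snd z)))" by (intro smooth_on_Pair D_open smooth_on_const)
  qed auto
  define H' where "H' = frechet_derivative H (at (0, u0))"
  have dH: "(H has_derivative H') (at (0, u0))"
    unfolding H'_def by (rule smooth_on_has_derivative[OF H D_zero(1)[OF u0(1)]])
  have H0: "H (0, u) = ?X u" if u: "u \<in> coords c ` dom_of c" for u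
  proof -
    have "((\<lambda>u. u) has_derivative (\<lambda>h. frechet_derivative \<Psi> (at (0, u)) (0, h))) (at u)"
      by (rule has_derivative_transform_within_open[OF partial_derivative(1)[OF \<Psi>_deriv[OF D_zero(1)[OF u]]] K u])
         (rule D_zero(2))
    from has_derivative_unique[OF this has_derivative_ident] show ?thesis unfolding H_def by (metis snd_conv)
  qed
  have "((\<lambda>u. ?X u) has_derivative (\<lambda>h. H' (0, h))) (at u0)"
    by (rule has_derivative_transform_within_open[OF partial_derivative(1)[OF dH] K u0(1) H0])
  from has_derivative_unique[OF this smooth_on_has_derivative[OF X' u0(1)]]
  have H1: "H' (0, w) = frechet_derivative ?X (at u0) w" for w by metis
  \<comment> \<open>The time part: with \<open>u\<close> fixed at \<open>u0\<close> the vector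
    \<open>?v\<close> is constant, so the derivative of \<open>H\<close> is a mixed second
    derivative of \<open>\<Psi>\<close>.\<close>
  let ?v = "?X u0"
  have "((\<lambda>t. H (t, u0)) has_derivative (\<lambda>h. H' (h, 0))) (at 0)" by (rule partial_derivative(2)[OF dH])
  moreover have "((\<lambda>t. H (t, u0)) has_derivative (\<lambda>h. frechet_derivative
      (\<lambda>z. frechet_derivative \<Psi> (at z) (0, ?v)) (at (0, u0)) (h, 0))) (at 0)"
    using partial_derivative(2)[OF smooth_on_has_derivative[OF smooth_on_frechet[OF \<Psi>_smooth] D_zero(1)[OF u0(1)]]]
    by (simp add: H_def)
  ultimately have "H' (1, 0) = frechet_derivative (\<lambda>z. frechet_derivative \<Psi> (at z) (0, ?v)) (at (0, u0)) (1, 0)"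
    using has_derivative_unique by (metis (no_types, lifting))
  also have "\<dots> = frechet_derivative (\<lambda>z. frechet_derivative \<Psi> (at z) (1, 0)) (at (0, u0)) (0, ?v)"
    by (rule second_derivative_symmetric[OF D_open \<Psi>_smooth D_zero(1)[OF u0(1)]])
  also have "\<dots> = frechet_derivative ?\<eta> (at u0) ?v"
  proof -
    have "(?\<eta> has_derivative (\<lambda>h. frechet_derivative (\<lambda>z. frechet_derivative \<Psi> (at z) (1, 0)) (at (0, u0)) (0, h))) (at u0)"
      by (rule has_derivative_transform_within_open[OF partial_derivative(1)[OF
            smooth_on_has_derivative[OF smooth_on_frechet[OF \<Psi>_smooth] D_zero(1)[OF u0(1)]]] K u0(1)])
         (simp add: velocity_rep)
    from has_derivative_unique[OF this smooth_on_has_derivative[OF velocity_rep_smooth u0(1)]]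
    show ?thesis by metis
  qed
  finally have H2: "H' (1, 0) = frechet_derivative ?\<eta> (at u0) ?v" .
  have lb: "frechet_derivative ?\<eta> (at u0) ?v - frechet_derivative ?X (at u0) (?\<eta> u0) = 0"
    using fun_cong[OF br, of c] cx u0(2) unfolding lie_bracket_def by (simp add: u0_def)
  let ?x = "\<lambda>t. coords c (\<Phi> (\<gamma> t) x)"
  note orb = curve_action_smooth_at[OF \<gamma> xM]
  have g0: "\<Phi> (\<gamma> 0) x = x" by (simp add: one_parameterD(3)[OF \<gamma>] \<Phi>_one xM)
  have dx: "(?x has_vector_derivative ?\<eta> u0) (at 0)"
    using velocity_chart[OF M orb, of c 0] cx g0 u0(2) by simp
  have "((\<lambda>t. (- t, ?x t)) has_derivative (\<lambda>h. (- h, h *\<^sub>R ?\<eta> u0))) (at 0)"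
    by (intro has_derivative_Pair has_derivative_minus has_derivative_ident dx[unfolded has_vector_derivative_def])
  moreover have "(H has_derivative H') (at (- 0, ?x 0))" using dH g0 by (simp add: u0_def)
  ultimately have "((\<lambda>t. H (- t, ?x t)) has_derivative (\<lambda>h. H' (- h, h *\<^sub>R ?\<eta> u0))) (at 0)"
    by (rule has_derivative_compose[where f = "\<lambda>t. (- t, ?x t)"])
  moreover have "H' (- h, h *\<^sub>R ?\<eta> u0) = 0" for h
  proof -
    have l: "linear H'" using dH has_derivative_linear by blast
    have "H' (- h, h *\<^sub>R ?\<eta> u0) = H' ((- h) *\<^sub>R (1, 0) + h *\<^sub>R (0, ?\<eta> u0))" by simp
    also have "\<dots> = (- h) *\<^sub>R H' (1, 0) + h *\<^sub>R H' (0, ?\<eta> u0)" by (simp only: linear_add[OF l] linear_scale[OF l])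
    \<comment> \<open>The difference of the time part and the space part is the bracket, and
      \<open>lb\<close> says that it vanishes.\<close>
    also have "\<dots> = - (h *\<^sub>R (H' (1, 0) - H' (0, ?\<eta> u0)))" by (simp add: algebra_simps)
    also have "\<dots> = 0" unfolding H1 H2 lb by simp
    finally show ?thesis .
  qed
  ultimately have dH0: "((\<lambda>t. H (- t, ?x t)) has_vector_derivative 0) (at 0)"
    by (simp add: has_vector_derivative_def)
  \<comment> \<open>\<open>H\<close> represents the pull-back as long as the orbit of
    \<open>x\<close> stays in the chart.\<close>
  obtain W where W: "open W" "0 \<in> W" "\<And>t. t \<in> W \<Longrightarrow> \<Phi> (\<gamma> t) x \<in> dom_of c"
    by (rule smooth_at_curveE[OF finite_dim_euclidean M orb, of c 0]) (use cx g0 in simp, rule that)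
  show ?thesis
  proof (rule has_vector_derivative_transform_within_open[OF dH0 W(1,2)])
    fix t assume t: "t \<in> W"
    let ?y = "\<Phi> (\<gamma> t) x"
    note ct = one_parameterD(5)[OF \<gamma>]
    have y: "?y \<in> points M" "c \<in> charts_at M ?y" "point_of c (?x t) = ?y"
      using \<Phi>_points[OF ct xM] W(3)[OF t] c point_of_coords[OF M c] by (auto simp: charts_at_iff)
    have returns: "\<Phi> (inv (\<gamma> t)) ?y = x" by (rule \<Phi>_inv[OF ct xM])
    have zD: "(- t, ?x t) \<in> D"
      unfolding D_def using W(3)[OF t] y(3) returns x by (simp add: one_parameterD(6)[OF \<gamma>])
    have "tangent_map M M (\<Phi> (inv (\<gamma> t))) ?y (X ?y) c =
        frechet_derivative (\<lambda>u. coords c (\<Phi> (inv (\<gamma> t)) (point_of c u))) (at (coords c ?y)) (X ?y c)"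
      by (rule tangent_map_chart[OF M M \<Phi>_smooth_at[OF inv_closed[OF ct] y(1)] vector_fieldsD(1)[OF X y(1)] y(2)])
         (use returns cx in simp)
    also have "\<dots> = H (- t, ?x t)"
      unfolding one_parameterD(6)[OF \<gamma>] partial_frechet[OF zD] H_def by (simp add: y(3))
    finally show "H (- t, ?x t) = tangent_map M M (\<Phi> (inv (\<gamma> t))) ?y (X ?y) c" by simp
  qed
qed

end

section \<open>From vanishing brackets to invariance under the group\<close>

context lie_action begin

lemma generator_smooth:
  assumes \<xi>: "\<xi> \<in> lie_algebra G AG" and c: "c \<in> M"
  shows "smooth_on (coords c ` dom_of c) (\<lambda>u. generator G AG M \<Phi> \<xi> (point_of c u) c)"
proof -
  obtain \<gamma> where gam: "one_parameter_subgroup G AG \<gamma>" "velocity AG \<gamma> 0 = \<xi>"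
    by (rule one_parameter_exists[OF \<xi>]) (rule that)
  interpret one_parameter_action G AG M \<Phi> \<gamma> c by unfold_locales (rule gam(1), rule c)
  show ?thesis unfolding generator_eq[OF gam] by (rule velocity_rep_smooth)
qed

text \<open>Only the component in a chart \<open>c\<close> around the fixed point \<open>x\<close>
  is kept: it determines the tangent vector and has values in the model space, so it can be
  differentiated in \<open>g\<close>.\<close>

definition pullback where
  "pullback X x c g = tangent_map M M (\<Phi> (inv g)) (\<Phi> g x) (X (\<Phi> g x)) c"

text \<open>Derivatives along one-parameter subgroups do not by themselves make a function
  differentiable, so smoothness near the identity is established first, from the two-variable
  representative of the action.\<close>

lemma pullback_differentiable:
  assumes X: "X \<in> vector_fields M" and c: "c \<in> charts_at M x" and a: "a \<in> charts_at AG \<one>"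
  shows "(\<lambda>\<kappa>. pullback X x c (point_of a \<kappa>)) differentiable (at (coords a \<one>))"
proof -
  have aA: "a \<in> AG" "\<one> \<in> dom_of a" and cM: "c \<in> M" "x \<in> dom_of c" and xM: "x \<in> points M"
    using a c charts_at_points[OF c] by (auto simp: charts_at_iff)
  have dom: "g \<in> carrier G" if "g \<in> dom_of a" for g using that aA(1) unfolding pts[symmetric] points_def by blast
  let ?pt = "point_of a" and ?\<iota> = "\<lambda>\<kappa>. coords a (inv (point_of a \<kappa>))"
    and ?x = "\<lambda>\<kappa>. coords c (\<Phi> (point_of a \<kappa>) x)"
  let ?X = "\<lambda>u. X (point_of c u) c"
  define D where "D = {z. fst z \<in> coords a ` dom_of a \<and> snd z \<in> coords c ` dom_of c \<and>
      \<Phi> (?pt (fst z)) (point_of c (snd z)) \<in> dom_of c}"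
  define \<Theta> where "\<Theta> = (\<lambda>z. coords c (\<Phi> (?pt (fst z)) (point_of c (snd z))))"
  have D: "open D" and \<Theta>: "smooth_on D \<Theta>"
    using prod_rep[OF AG M M \<Phi>_smooth aA(1) cM(1) cM(1)] unfolding D_def \<Theta>_def by auto
  define N1 where "N1 = {u \<in> coords a ` dom_of a. inv (?pt u) \<in> dom_of a}"
  have N1: "open N1" "smooth_on N1 ?\<iota>"
    using smooth_rep[OF AG AG aA(1) aA(1), of "\<lambda>x. inv x"] smooth_at_inv[OF AG smooth_at_id[OF AG]] dom pts
    unfolding N1_def by auto
  define N2 where "N2 = {u \<in> coords a ` dom_of a. \<Phi> (?pt u) x \<in> dom_of c}"
  have N2: "open N2" "smooth_on N2 ?x"
    using smooth_rep[OF AG M aA(1) cM(1), of "\<lambda>g. \<Phi> g x"] orbit_smooth_at[OF _ xM] dom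
    unfolding N2_def by auto
  \<comment> \<open>Here the inverse stays in the chart \<open>a\<close> and the orbit point stays
    in the chart \<open>c\<close>.\<close>
  let ?N = "N1 \<inter> N2"
  have N: "open ?N" using N1 N2 by blast
  have ptN: "?pt \<kappa> \<in> dom_of a" "?pt \<kappa> \<in> carrier G" "inv (?pt \<kappa>) \<in> dom_of a" "\<Phi> (?pt \<kappa>) x \<in> dom_of c"
    "?pt (?\<iota> \<kappa>) = inv (?pt \<kappa>)" "point_of c (?x \<kappa>) = \<Phi> (?pt \<kappa>) x" if "\<kappa> \<in> ?N" for \<kappa>
    using that point_of_in_dom[of \<kappa> a] dom point_of_coords[OF AG aA(1)] point_of_coords[OF M cM(1)]
    unfolding N1_def N2_def by auto
  have zD: "(?\<iota> \<kappa>, ?x \<kappa>) \<in> D" if "\<kappa> \<in> ?N" for \<kappa>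
    unfolding D_def using ptN[OF that] \<Phi>_inv[OF _ xM] cM by auto
  have "smooth_on ?N (\<lambda>\<kappa>. frechet_derivative \<Theta> (at (?\<iota> \<kappa>, ?x \<kappa>)) (0, ?X (?x \<kappa>)))"
  proof (rule smooth_on_frechet_field[OF finite_dim_prod[OF smooth_atlasD(1)[OF AG] smooth_atlasD(1)[OF M]] N D _ _ _ \<Theta>])
    show "(\<lambda>\<kappa>. (?\<iota> \<kappa>, ?x \<kappa>)) ` ?N \<subseteq> D" using zD by blast
    show "smooth_on ?N (\<lambda>\<kappa>. (?\<iota> \<kappa>, ?x \<kappa>))"
      by (intro smooth_on_Pair N smooth_on_subset[OF N1(2)] smooth_on_subset[OF N2(2)]) auto
    have "smooth_on ?N (\<lambda>\<kappa>. ?X (?x \<kappa>))"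
    proof (rule smooth_on_compose[OF smooth_atlasD(1)[OF M] N smooth_atlasD(3)[OF M cM(1)] _ _ vector_fieldsD(2)[OF X cM(1)]])
      show "?x ` ?N \<subseteq> coords c ` dom_of c" using ptN(4) by blast
      show "smooth_on ?N ?x" by (rule smooth_on_subset[OF N2(2)]) auto
    qed
    then show "smooth_on ?N (\<lambda>\<kappa>. (0, ?X (?x \<kappa>)))" by (intro smooth_on_Pair N smooth_on_const)
  qed
  then have "smooth_on ?N (\<lambda>\<kappa>. pullback X x c (?pt \<kappa>))"
  proof (rule smooth_on_cong[OF N, rotated])
    fix \<kappa> assume \<kappa>: "\<kappa> \<in> ?N"
    let ?g = "?pt \<kappa>" and ?y = "\<Phi> (?pt \<kappa>) x"
    note k = ptN[OF \<kappa>]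
    have y: "?y \<in> points M" "c \<in> charts_at M ?y" using \<Phi>_points[OF k(2) xM] k(4) cM(1) by (auto simp: charts_at_iff)
    have "pullback X x c ?g =
        frechet_derivative (\<lambda>u. coords c (\<Phi> (inv ?g) (point_of c u))) (at (?x \<kappa>)) (X ?y c)"
      unfolding pullback_def
      by (rule tangent_map_chart[OF M M \<Phi>_smooth_at[OF inv_closed[OF k(2)] y(1)] vector_fieldsD(1)[OF X y(1)] y(2)])
         (use \<Phi>_inv[OF k(2) xM] c in simp)
    also have "\<dots> = frechet_derivative \<Theta> (at (?\<iota> \<kappa>, ?x \<kappa>)) (0, X ?y c)"
      using frechet_derivative_at[OF partial_derivative(1)[OF smooth_on_has_derivative[OF \<Theta> zD[OF \<kappa>]]]]
      by (simp add: \<Theta>_def fun_eq_iff k(5))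
    finally show "frechet_derivative \<Theta> (at (?\<iota> \<kappa>, ?x \<kappa>)) (0, ?X (?x \<kappa>)) = pullback X x c ?g"
      by (simp add: k(6))
  qed
  moreover have "coords a \<one> \<in> ?N" "?pt (coords a \<one>) = \<one>"
    unfolding N1_def N2_def using aA point_of_coords[OF AG aA] xM cM \<Phi>_one by auto
  ultimately show ?thesis using smooth_on_differentiable by blast
qed

text \<open>A derivative that exists is determined by one curve in each direction \<open>h\<close>;
  one-parameter subgroups provide all directions, and along them the derivative is the vanishing
  bracket.\<close>

lemma pullback_derivative_one:
  assumes X: "X \<in> vector_fields M" and c: "c \<in> charts_at M x" and a: "a \<in> charts_at AG \<one>"
    and br: "\<And>\<xi>. \<xi> \<in> lie_algebra G AG \<Longrightarrow> lie_bracket M X (generator G AG M \<Phi> \<xi>) x = (\<lambda>c. 0)"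
  shows "((\<lambda>\<kappa>. pullback X x c (point_of a \<kappa>)) has_derivative (\<lambda>_. 0)) (at (coords a \<one>))"
proof -
  let ?P = "\<lambda>\<kappa>. pullback X x c (point_of a \<kappa>)"
  obtain P' where P': "(?P has_derivative P') (at (coords a \<one>))"
    using pullback_differentiable[OF X c a] unfolding differentiable_def by blast
  have aA: "a \<in> AG" and cM: "c \<in> M" "x \<in> dom_of c" using a c by (auto simp: charts_at_iff)
  have "P' h = 0" for h
  proof -
    let ?\<xi> = "coord_vec AG a \<one> h"
    have \<xi>: "?\<xi> \<in> lie_algebra G AG" unfolding lie_algebra_def by (rule coord_vec_in[OF AG a])
    obtain \<gamma> where gam: "one_parameter_subgroup G AG \<gamma>" "velocity AG \<gamma> 0 = ?\<xi>"
      by (rule one_parameter_exists[OF \<xi>]) (rule that)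
    interpret one_parameter_action G AG M \<Phi> \<gamma> c by unfold_locales (rule gam(1), rule cM(1))
    have gen: "generator G AG M \<Phi> ?\<xi> = (\<lambda>y. velocity M (\<lambda>t. \<Phi> (\<gamma> t) y) 0)"
      by (rule ext) (rule generator_eq[OF gam])
    have 1: "((\<lambda>t. pullback X x c (\<gamma> t)) has_vector_derivative 0) (at 0)"
      unfolding pullback_def by (rule pullback_derivative[OF X cM(2)]) (use br[OF \<xi>] gen in simp)
    note g0 = one_parameterD(3)[OF gam(1)]
    obtain W where W: "open W" "0 \<in> W" "\<And>t. t \<in> W \<Longrightarrow> \<gamma> t \<in> dom_of a"
      by (rule smooth_at_curveE[OF finite_dim_euclidean AG one_parameterD(2)[OF gam(1)], of a 0])
        (use a g0 in simp, rule that)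
    have "((\<lambda>t. coords a (\<gamma> t)) has_vector_derivative h) (at 0)"
      using velocity_chart[OF AG one_parameterD(2)[OF gam(1)], of a 0] a g0 gam(2) coord_vec_self[OF AG a] by simp
    then have "((\<lambda>t. ?P (coords a (\<gamma> t))) has_derivative (\<lambda>r. P' (r *\<^sub>R h))) (at 0)"
      unfolding has_vector_derivative_def
      by (rule has_derivative_compose) (use P' g0 in simp)
    then have "((\<lambda>t. ?P (coords a (\<gamma> t))) has_vector_derivative P' h) (at 0)"
      unfolding has_vector_derivative_def using linear_scale[OF has_derivative_linear[OF P']] by simp
    then have "((\<lambda>t. pullback X x c (\<gamma> t)) has_vector_derivative P' h) (at 0)"
      by (rule has_vector_derivative_transform_within_open[OF _ W(1,2)])
         (use W(3) point_of_coords[OF AG aA] in simp)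
    with 1 show ?thesis using vector_derivative_unique_at by blast
  qed
  then have "P' = (\<lambda>_. 0)" by (rule ext)
  with P' show ?thesis by (simp only:)
qed

text \<open>The outer map is linear and does not depend on \<open>k\<close>, so a derivative
  vanishing at the identity for the base point \<open>\<Phi> g x\<close> becomes one vanishing at
  \<open>g\<close> for the base point \<open>x\<close>.\<close>

lemma pullback_translate:
  assumes X: "X \<in> vector_fields M" and x: "x \<in> points M" and g: "g \<in> carrier G" and k: "k \<in> carrier G"
    and c: "c \<in> charts_at M x" and c': "c' \<in> charts_at M (\<Phi> g x)"
  shows "pullback X x c (k \<otimes> g) = frechet_derivative (\<lambda>u. coords c (\<Phi> (inv g) (point_of c' u)))
    (at (coords c' (\<Phi> g x))) (pullback X (\<Phi> g x) c' k)"
proof -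
  let ?y = "\<Phi> g x" and ?z = "\<Phi> k (\<Phi> g x)"
  have y: "?y \<in> points M" and z: "?z \<in> points M" using \<Phi>_points g k x by auto
  have kz: "\<Phi> (inv k) ?z = ?y" by (rule \<Phi>_inv[OF k y])
  note sk = \<Phi>_smooth_at[OF inv_closed[OF k] z] and sg = \<Phi>_smooth_at[OF inv_closed[OF g] y]
  have "pullback X x c (k \<otimes> g) = tangent_map M M (\<Phi> (inv (k \<otimes> g))) ?z (X ?z) c"
    unfolding pullback_def \<Phi>_mult[OF k g x] ..
  also have "tangent_map M M (\<Phi> (inv (k \<otimes> g))) ?z (X ?z) =
      tangent_map M M (\<lambda>x. \<Phi> (inv g) (\<Phi> (inv k) x)) ?z (X ?z)"
    by (rule tangent_map_cong[OF M z]) (simp add: inv_mult_group g k \<Phi>_mult)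
  also have "\<dots> = tangent_map M M (\<Phi> (inv g)) (\<Phi> (inv k) ?z) (tangent_map M M (\<Phi> (inv k)) ?z (X ?z))"
    by (rule tangent_map_compose[OF M M M sk _ vector_fieldsD(1)[OF X z]]) (use sg kz in simp)
  also have "\<dots> c = frechet_derivative (\<lambda>u. coords c (\<Phi> (inv g) (point_of c' u)))
    (at (coords c' ?y)) (tangent_map M M (\<Phi> (inv k)) ?z (X ?z) c')"
    unfolding kz
    by (rule tangent_map_chart[OF M M sg _ c'])
       (use tangent_map_in[OF M M sk vector_fieldsD(1)[OF X z]] kz \<Phi>_inv[OF g x] c in auto)
  finally show ?thesis unfolding pullback_def .
qed

text \<open>A group element near \<open>g\<close> is written as \<open>k \<otimes> g\<close> with
  \<open>k\<close> near the identity. The base point moves to \<open>\<Phi> g x\<close>, which is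
  why the bracket is assumed to vanish at every point.\<close>

lemma pullback_derivative_zero:
  assumes X: "X \<in> vector_fields M" and c: "c \<in> charts_at M x" and b: "b \<in> charts_at AG g"
    and br: "\<And>\<xi> y. \<xi> \<in> lie_algebra G AG \<Longrightarrow> y \<in> points M \<Longrightarrow>
      lie_bracket M X (generator G AG M \<Phi> \<xi>) y = (\<lambda>c. 0)"
  shows "((\<lambda>\<kappa>. pullback X x c (point_of b \<kappa>)) has_derivative (\<lambda>_. 0)) (at (coords b g))"
proof -
  have x: "x \<in> points M" and g: "g \<in> carrier G" using charts_at_points[OF c] charts_at_points[OF b] pts by auto
  have bA: "b \<in> AG" "g \<in> dom_of b" using b by (auto simp: charts_at_iff)
  have y: "\<Phi> g x \<in> points M" by (rule \<Phi>_points[OF g x])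
  obtain a where a: "a \<in> charts_at AG \<one>" using points_iff[of \<one> AG] pts by auto
  have aA: "a \<in> AG" using a by (simp add: charts_at_iff)
  obtain c' where c': "c' \<in> charts_at M (\<Phi> g x)" using y points_iff by metis
  let ?L = "frechet_derivative (\<lambda>u. coords c (\<Phi> (inv g) (point_of c' u))) (at (coords c' (\<Phi> g x)))"
  have L: "bounded_linear ?L"
    by (rule rep_derivative_linear[OF M M \<Phi>_smooth_at[OF inv_closed[OF g] y] c']) (use \<Phi>_inv[OF g x] c in simp)
  let ?\<rho> = "\<lambda>\<kappa>. coords a (point_of b \<kappa> \<otimes> inv g)"
  have R: "smooth_at AG AG (\<lambda>k. k \<otimes> inv g) g"
    by (intro smooth_at_mult[OF AG] smooth_at_id[OF AG] smooth_at_const[OF AG AG]) (use g pts in auto)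
  have a': "a \<in> charts_at AG (g \<otimes> inv g)" using a g by simp
  obtain W where W: "open W" "coords b g \<in> W" "W \<subseteq> coords b ` dom_of b"
    "\<And>u. u \<in> W \<Longrightarrow> point_of b u \<otimes> inv g \<in> dom_of a"
    by (rule smooth_at_chart[OF AG AG R b a']) (rule that)
  have \<rho>: "(?\<rho> has_derivative frechet_derivative ?\<rho> (at (coords b g))) (at (coords b g))"
    by (rule rep_derivative[OF AG AG R b a'])
  have \<rho>g: "?\<rho> (coords b g) = coords a \<one>" using point_of_coords[OF AG bA] g by simp
  have "((\<lambda>\<kappa>. pullback X (\<Phi> g x) c' (point_of a \<kappa>)) has_derivative (\<lambda>_. 0)) (at (?\<rho> (coords b g)))"
    unfolding \<rho>g by (rule pullback_derivative_one[OF X c' a br[OF _ y]])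
  from has_derivative_compose[OF \<rho> this]
  have "((\<lambda>\<kappa>. pullback X (\<Phi> g x) c' (point_of a (?\<rho> \<kappa>))) has_derivative (\<lambda>_. 0)) (at (coords b g))" .
  from bounded_linear.has_derivative[OF L this]
  have "((\<lambda>\<kappa>. ?L (pullback X (\<Phi> g x) c' (point_of a (?\<rho> \<kappa>)))) has_derivative (\<lambda>_. 0)) (at (coords b g))"
    by (simp add: linear_0[OF bounded_linear.linear[OF L]])
  then show ?thesis
  proof (rule has_derivative_transform_within_open[OF _ W(1,2)])
    fix \<kappa> assume \<kappa>: "\<kappa> \<in> W"
    have "point_of b \<kappa> \<in> dom_of b" using W(3) \<kappa> by (intro point_of_in_dom) blast
    then have k: "point_of b \<kappa> \<in> carrier G" using bA(1) unfolding pts[symmetric] points_def by blast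
    have "pullback X x c (point_of b \<kappa>) = pullback X x c ((point_of b \<kappa> \<otimes> inv g) \<otimes> g)"
      using k g by (simp add: m_assoc)
    also have "\<dots> = ?L (pullback X (\<Phi> g x) c' (point_of b \<kappa> \<otimes> inv g))"
      by (rule pullback_translate[OF X x g _ c c']) (use k g in simp)
    finally show "?L (pullback X (\<Phi> g x) c' (point_of a (?\<rho> \<kappa>))) = pullback X x c (point_of b \<kappa>)"
      using point_of_coords[OF AG aA W(4)[OF \<kappa>]] by simp
  qed
qed

theorem invariant_vector_field:
  assumes conn: "connected_space (manifold_topology AG)" and X: "X \<in> vector_fields M"
    and br: "\<And>\<xi> y. \<xi> \<in> lie_algebra G AG \<Longrightarrow> y \<in> points M \<Longrightarrow>
      lie_bracket M X (generator G AG M \<Phi> \<xi>) y = (\<lambda>c. 0)"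
    and g: "g \<in> carrier G" and x: "x \<in> points M"
  shows "tangent_map M M (\<Phi> g) x (X x) = X (\<Phi> g x)"
proof -
  let ?y = "\<Phi> g x"
  have y: "?y \<in> points M" by (rule \<Phi>_points[OF g x])
  have returns: "\<Phi> (inv g) ?y = x" by (rule \<Phi>_inv[OF g x])
  obtain c where c: "c \<in> charts_at M ?y" using y points_iff by metis
  \<comment> \<open>Based at \<open>?y\<close>, the pull-back by \<open>inv g\<close> is the
    push-forward of \<open>X x\<close> by \<open>\<Phi> g\<close>, and the pull-back by the identity
    is \<open>X ?y\<close>.\<close>
  have "pullback X ?y c (inv g) = pullback X ?y c \<one>"
    by (rule constant_if_derivative_zero[OF AG conn])
       (use pullback_derivative_zero[OF X c _ br] g pts in auto)
  also have "\<dots> = tangent_map M M (\<lambda>x. x) ?y (X ?y) c"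
    unfolding pullback_def using tangent_map_cong[OF M y, of "\<Phi> \<one>" "\<lambda>x. x" M "X ?y"] \<Phi>_one y by simp
  also have "\<dots> = X ?y c" using tangent_map_id[OF M y vector_fieldsD(1)[OF X y]] by simp
  finally have "tangent_map M M (\<Phi> g) x (X x) c = X ?y c"
    unfolding pullback_def returns using g by simp
  then show ?thesis
    by (intro tangent_eqI[OF tangent_map_in[OF M M \<Phi>_smooth_at[OF g x] vector_fieldsD(1)[OF X x]]
          vector_fieldsD(1)[OF X y] c])
qed

end

section \<open>The cotangent bundle\<close>

lemma smooth_on_inner:
  "open S \<Longrightarrow> smooth_on S f \<Longrightarrow> smooth_on S g \<Longrightarrow> smooth_on S (\<lambda>x. f x \<bullet> (g x :: 'a::real_inner))"
  unfolding smooth_on_def by (simp add: Ck_on_bilinear[OF bounded_bilinear_inner])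

lemma coord_vec_linear:
  assumes A: "smooth_atlas A" and c: "c \<in> charts_at A x"
  shows "coord_vec A c x (r *\<^sub>R u + s *\<^sub>R w) = (\<lambda>c'. r *\<^sub>R coord_vec A c x u c' + s *\<^sub>R coord_vec A c x w c')"
  by (rule tangent_eqI[OF coord_vec_in[OF A c] tangent_space_combination[OF A charts_at_points[OF c]
        coord_vec_in[OF A c] coord_vec_in[OF A c]] c])
     (simp add: coord_vec_self[OF A c])

lemma tangent_map_combination:
  assumes A: "smooth_atlas A" and B: "smooth_atlas B" and F: "smooth_at A B F x"
    and v: "v \<in> tangent_space A x" and w: "w \<in> tangent_space A x"
  shows "tangent_map A B F x (\<lambda>c. r *\<^sub>R v c + s *\<^sub>R w c) =
    (\<lambda>c. r *\<^sub>R tangent_map A B F x v c + s *\<^sub>R tangent_map A B F x w c)"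
proof
  fix d
  have x: "x \<in> points A" using smooth_at_points[OF F] by blast
  then obtain c where c: "c \<in> charts_at A x" using points_iff by metis
  show "tangent_map A B F x (\<lambda>c. r *\<^sub>R v c + s *\<^sub>R w c) d =
    r *\<^sub>R tangent_map A B F x v d + s *\<^sub>R tangent_map A B F x w d"
  proof (cases "d \<in> charts_at B (F x)")
    case True
    have "linear (frechet_derivative (\<lambda>u. coords d (F (point_of c u))) (at (coords c x)))"
      using rep_derivative_linear[OF A B F c True] bounded_linear.linear by blast
    then show ?thesis
      unfolding tangent_map_chart[OF A B F tangent_space_combination[OF A x v w] c True]
        tangent_map_chart[OF A B F v c True] tangent_map_chart[OF A B F w c True]
      by (simp add: linear_add linear_scale)
  qed (simp add: tangent_map_outside)
qed

section \<open>Cotangent spaces in coordinates\<close>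

lemma cotangent_linear:
  assumes "p \<in> cotangent_space A x" "v \<in> tangent_space A x" "w \<in> tangent_space A x"
  shows "p (\<lambda>c. r *\<^sub>R v c + s *\<^sub>R w c) = r * p v + s * p w"
  using assms unfolding cotangent_space_def by blast

lemma cotangent_outside: "p \<in> cotangent_space A x \<Longrightarrow> v \<notin> tangent_space A x \<Longrightarrow> p v = 0"
  unfolding cotangent_space_def by blast

lemma cotangentI:
  assumes "\<And>v w r s. v \<in> tangent_space A x \<Longrightarrow> w \<in> tangent_space A x \<Longrightarrow>
      p (\<lambda>c. r *\<^sub>R v c + s *\<^sub>R w c) = r * p v + s * p w"
    and "\<And>v. v \<notin> tangent_space A x \<Longrightarrow> p v = 0"
  shows "p \<in> cotangent_space A x"
  using assms unfolding cotangent_space_def by blast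

lemma cotangent_combination:
  assumes p: "p \<in> cotangent_space A x" and q: "q \<in> cotangent_space A x"
  shows "(\<lambda>v. r * p v + s * q v) \<in> cotangent_space A x"
  by (rule cotangentI)
     (simp_all add: cotangent_linear[OF p] cotangent_linear[OF q] cotangent_outside[OF p] cotangent_outside[OF q]
       algebra_simps)

lemma cotangent_zero: "(\<lambda>v. 0) \<in> cotangent_space A x"
  by (rule cotangentI) simp_all

lemma cotangent_sum:
  assumes "\<And>i. i \<in> I \<Longrightarrow> k i \<in> cotangent_space A x"
  shows "(\<lambda>v. \<Sum>i\<in>I. r i * k i v) \<in> cotangent_space A x"
  using assms
proof (induction I rule: infinite_finite_induct)
  case (insert i I)
  then show ?case using cotangent_combination[of "k i" A x "\<lambda>v. \<Sum>i\<in>I. r i * k i v" "r i" 1] by simp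
qed (auto intro: cotangent_zero)

definition covector_coords :: "('m, 'e::euclidean_space) atlas \<Rightarrow> ('m, 'e) chart \<Rightarrow> 'm \<Rightarrow> ('m, 'e) covec \<Rightarrow> 'e" where
  "covector_coords A c x p = (\<Sum>b\<in>Basis. p (coord_vec A c x b) *\<^sub>R b)"

text \<open>Inverse of \<open>covector_coords\<close> on the fibre. The value 0 off the tangent
  space follows the convention of \<open>cotangent_space\<close>, which makes equality of covectors
  an equality of functions.\<close>

definition covector :: "('m, 'e::euclidean_space) atlas \<Rightarrow> ('m, 'e) chart \<Rightarrow> 'm \<Rightarrow> 'e \<Rightarrow> ('m, 'e) covec" where
  "covector A c x \<eta> = (\<lambda>v. if v \<in> tangent_space A x then v c \<bullet> \<eta> else 0)"

lemma covector_coords_apply: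
  assumes A: "smooth_atlas A" and c: "c \<in> charts_at A x"
    and p: "p \<in> cotangent_space A x" and v: "v \<in> tangent_space A x"
  shows "p v = v c \<bullet> covector_coords A c x p"
proof -
  note cv = coord_vec_in[OF A c]
  have l: "linear (\<lambda>w. p (coord_vec A c x w))"
  proof (rule linearI)
    show "p (coord_vec A c x (u + w)) = p (coord_vec A c x u) + p (coord_vec A c x w)" for u w
      using cotangent_linear[OF p cv cv, of 1 u 1 w] coord_vec_linear[OF A c, of 1 u 1 w] by simp
    show "p (coord_vec A c x (r *\<^sub>R u)) = r *\<^sub>R p (coord_vec A c x u)" for r u
      using cotangent_linear[OF p cv cv, of r u 0 u] coord_vec_linear[OF A c, of r u 0 u] by simp
  qed
  have "p v = p (coord_vec A c x (v c))" by (simp only: coord_vec_of_tangent[OF A c v])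
  also have "\<dots> = p (coord_vec A c x (\<Sum>b\<in>Basis. (v c \<bullet> b) *\<^sub>R b))" by (simp only: euclidean_representation)
  also have "\<dots> = (\<Sum>b\<in>Basis. (v c \<bullet> b) * p (coord_vec A c x b))"
    by (simp add: linear_sum[OF l] linear_scale[OF l])
  finally show ?thesis by (simp add: covector_coords_def inner_sum_right mult.commute)
qed

lemma covector_in:
  assumes A: "smooth_atlas A" and c: "c \<in> charts_at A x"
  shows "covector A c x \<eta> \<in> cotangent_space A x"
  by (rule cotangentI)
     (simp_all add: covector_def tangent_space_combination[OF A charts_at_points[OF c]] inner_add_left)

lemma covector_coords_covector:
  assumes A: "smooth_atlas A" and c: "c \<in> charts_at A x"
  shows "covector_coords A c x (covector A c x \<eta>) = \<eta>"
  unfolding covector_coords_def covector_def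
  by (simp add: coord_vec_in[OF A c] coord_vec_self[OF A c] inner_commute[of _ \<eta>] euclidean_representation)

lemma covector_coords_inject:
  assumes "smooth_atlas A" "c \<in> charts_at A x" "p \<in> cotangent_space A x" "p' \<in> cotangent_space A x"
    and "covector_coords A c x p = covector_coords A c x p'"
  shows "p = p'"
proof
  fix v show "p v = p' v"
    using covector_coords_apply[OF assms(1,2,3), of v] covector_coords_apply[OF assms(1,2,4), of v] assms(5)
      cotangent_outside[OF assms(3), of v] cotangent_outside[OF assms(4), of v]
    by (cases "v \<in> tangent_space A x") auto
qed

lemma covector_coords_combination:
  "covector_coords A c x (\<lambda>v. p v + t * q v) = covector_coords A c x p + t *\<^sub>R covector_coords A c x q"
  by (simp add: covector_coords_def scaleR_add_left sum.distrib scaleR_sum_right)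

lemma cot_chart_simps:
  "dom_of (cot_chart A c) = {z. fst z \<in> dom_of c \<and> snd z \<in> cotangent_space A (fst z)}"
  "coords (cot_chart A c) = (\<lambda>z. (coords c (fst z), covector_coords A c (fst z) (snd z)))"
  by (auto simp: cot_chart_def covector_coords_def split_def)

lemma cot_chart_charts_at:
  "c \<in> charts_at A q \<Longrightarrow> p \<in> cotangent_space A q \<Longrightarrow> cot_chart A c \<in> charts_at (cot_atlas A) (q, p)"
  by (simp add: charts_at_iff cot_chart_simps cot_atlas_def)

lemma charts_at_cotE:
  assumes "C \<in> charts_at (cot_atlas A) z"
  obtains c where "C = cot_chart A c" "c \<in> A" "c \<in> charts_at A (fst z)" "snd z \<in> cotangent_space A (fst z)"
  using assms unfolding cot_atlas_def charts_at_iff by (auto simp: cot_chart_simps)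

lemma points_cot: "z \<in> points (cot_atlas A) \<longleftrightarrow> fst z \<in> points A \<and> snd z \<in> cotangent_space A (fst z)"
  unfolding points_def cot_atlas_def by (auto simp: cot_chart_simps)

section \<open>The cotangent atlas and vertical vectors\<close>

context
  fixes A :: "('m, 'e::euclidean_space) atlas"
  assumes A: "smooth_atlas A"
begin

lemma cot_chart_inj:
  assumes c: "c \<in> A"
  shows "inj_on (coords (cot_chart A c)) (dom_of (cot_chart A c))"
proof (rule inj_onI)
  fix z z' assume z: "z \<in> dom_of (cot_chart A c)" "z' \<in> dom_of (cot_chart A c)"
    and eq: "coords (cot_chart A c) z = coords (cot_chart A c) z'"
  have q: "fst z = fst z'"
    using eq z smooth_atlasD(2)[OF A c] by (auto simp: cot_chart_simps dest: inj_onD)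
  moreover have "snd z = snd z'"
    by (rule covector_coords_inject[OF A, of c "fst z"]) (use z eq q c in \<open>auto simp: cot_chart_simps charts_at_iff\<close>)
  ultimately show "z = z'" by (rule prod_eqI)
qed

lemma cot_chart_image:
  assumes c: "c \<in> A" and S: "S \<subseteq> dom_of c"
  shows "coords (cot_chart A c) ` {z. fst z \<in> S \<and> snd z \<in> cotangent_space A (fst z)} = coords c ` S \<times> UNIV"
proof (intro equalityI subsetI)
  fix u :: "'e \<times> 'e" assume "u \<in> coords c ` S \<times> UNIV"
  then obtain q where q: "q \<in> S" "fst u = coords c q" by auto
  then have "c \<in> charts_at A q" using c S by (auto simp: charts_at_iff)
  from covector_in[OF A this] covector_coords_covector[OF A this]
  show "u \<in> coords (cot_chart A c) ` {z. fst z \<in> S \<and> snd z \<in> cotangent_space A (fst z)}"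
    using q by (intro image_eqI[of _ _ "(q, covector A c q (snd u))"]) (auto simp: cot_chart_simps prod_eq_iff)
qed (auto simp: cot_chart_simps)

lemma point_of_cot:
  assumes c: "c \<in> A" and x: "x \<in> coords c ` dom_of c"
  shows "point_of (cot_chart A c) (x, \<eta>) = (point_of c x, covector A c (point_of c x) \<eta>)"
proof -
  note x' = point_of_in_dom[OF x] coords_point_of[OF x]
  have cx: "c \<in> charts_at A (point_of c x)" using c x' by (simp add: charts_at_iff)
  from inv_into_f_f[OF cot_chart_inj[OF c], of "(point_of c x, covector A c (point_of c x) \<eta>)"]
  show ?thesis
    using x' covector_in[OF A cx] covector_coords_covector[OF A cx]
    by (simp add: point_of_def[of "cot_chart A c"] cot_chart_simps)
qed

text \<open>Fibre coordinates transform by the transpose of the derivative of the inverse coordinate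
  change \<open>?\<sigma>\<close>, taken at the image point under \<open>?\<tau>\<close>. Written
  out in a basis, this involves derivatives in fixed directions only.\<close>

lemma smooth_atlas_cot: "smooth_atlas (cot_atlas A)"
  unfolding smooth_atlas_def
proof (intro conjI ballI)
  show "finite_dim TYPE('e \<times> 'e)" by (rule finite_dim_euclidean)
  fix C assume "C \<in> cot_atlas A"
  then obtain c where C: "C = cot_chart A c" and c: "c \<in> A" by (auto simp: cot_atlas_def)
  note K = smooth_atlasD(3)[OF A c]
  show "inj_on (coords C) (dom_of C)" unfolding C by (rule cot_chart_inj[OF c])
  show "open (coords C ` dom_of C)"
    using cot_chart_image[OF c subset_refl] K unfolding C cot_chart_simps(1) by (auto intro: open_Times)
  fix C' assume "C' \<in> cot_atlas A"
  then obtain c' where C': "C' = cot_chart A c'" and c': "c' \<in> A" by (auto simp: cot_atlas_def)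
  let ?S = "coords c ` (dom_of c \<inter> dom_of c')" and ?S' = "coords c' ` (dom_of c' \<inter> dom_of c)"
  note \<tau> = smooth_atlasD(4,5)[OF A c c'] and \<sigma> = smooth_atlasD(4,5)[OF A c' c]
  let ?\<tau> = "\<lambda>u. coords c' (point_of c u)" and ?\<sigma> = "\<lambda>u. coords c (point_of c' u)"
  have "dom_of C \<inter> dom_of C' = {z. fst z \<in> dom_of c \<inter> dom_of c' \<and> snd z \<in> cotangent_space A (fst z)}"
    unfolding C C' cot_chart_simps by auto
  then have img: "coords C ` (dom_of C \<inter> dom_of C') = ?S \<times> (UNIV :: 'e set)"
    using cot_chart_image[OF c, of "dom_of c \<inter> dom_of c'"] unfolding C by simp
  have op: "open (?S \<times> (UNIV :: 'e set))" by (intro open_Times \<tau>(1) open_UNIV)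
  then show "open (coords C ` (dom_of C \<inter> dom_of C'))" unfolding img .
  have t: "smooth_on (?S \<times> (UNIV :: 'e set)) (\<lambda>z. ?\<tau> (fst z))"
    by (rule smooth_on_compose[OF finite_dim_euclidean op \<tau>(1) _ _ \<tau>(2)])
       (auto intro: smooth_on_linear bounded_linear_fst op)
  have tS: "(\<lambda>z. ?\<tau> (fst z)) ` (?S \<times> (UNIV :: 'e set)) \<subseteq> ?S'"
    using point_of_coords[OF A c] by auto
  have "smooth_on (?S \<times> (UNIV :: 'e set))
      (\<lambda>z. (?\<tau> (fst z), \<Sum>b\<in>Basis. (frechet_derivative ?\<sigma> (at (?\<tau> (fst z))) b \<bullet> snd z) *\<^sub>R b))"
    by (intro smooth_on_Pair[OF op t] smooth_on_sum smooth_on_scaleR smooth_on_inner op smooth_on_const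
        smooth_on_compose[OF finite_dim_euclidean op \<sigma>(1) tS t smooth_on_frechet[OF \<sigma>(2)]]
        smooth_on_linear bounded_linear_snd)
  then show "smooth_on (coords C ` (dom_of C \<inter> dom_of C')) (\<lambda>u. coords C' (point_of C u))"
    unfolding img
  proof (rule smooth_on_cong[OF op, rotated])
    fix z assume z: "z \<in> ?S \<times> (UNIV :: 'e set)"
    let ?q = "point_of c (fst z)"
    have x: "fst z \<in> coords c ` dom_of c" using z by auto
    have "?q \<in> dom_of c \<inter> dom_of c'" using z point_of_coords[OF A c] by auto
    then have q: "c \<in> charts_at A ?q" "c' \<in> charts_at A ?q" using c c' by (auto simp: charts_at_iff)
    have cv: "coord_vec A c' ?q b c = frechet_derivative ?\<sigma> (at (?\<tau> (fst z))) b" for b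
      by (simp add: coord_vec_def q(1) o_def)
    have "coords C' (point_of C z) = (?\<tau> (fst z), covector_coords A c' ?q (covector A c ?q (snd z)))"
      using point_of_cot[OF c x, of "snd z"] by (simp add: C C' cot_chart_simps)
    also have "covector_coords A c' ?q (covector A c ?q (snd z)) =
      (\<Sum>b\<in>Basis. (frechet_derivative ?\<sigma> (at (?\<tau> (fst z))) b \<bullet> snd z) *\<^sub>R b)"
      unfolding covector_coords_def covector_def
      by (intro sum.cong refl) (simp add: coord_vec_in[OF A q(2)] cv)
    finally show "(?\<tau> (fst z), \<Sum>b\<in>Basis. (frechet_derivative ?\<sigma> (at (?\<tau> (fst z))) b \<bullet> snd z) *\<^sub>R b) =
      coords C' (point_of C z)" by simp
  qed
qed

text \<open>Points over different base points are separated by preimages of open sets of the base;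
  points over the same base point share a cotangent chart and are separated by their
  coordinates.\<close>

lemma Hausdorff_cot:
  assumes T2: "Hausdorff_space (manifold_topology A)"
  shows "Hausdorff_space (manifold_topology (cot_atlas A))"
  unfolding Hausdorff_space_def topspace_manifold_topology[OF smooth_atlas_cot]
proof (intro allI impI, elim conjE)
  fix z w assume z: "z \<in> points (cot_atlas A)" and w: "w \<in> points (cot_atlas A)" and ne: "z \<noteq> w"
  have zq: "fst z \<in> points A" "snd z \<in> cotangent_space A (fst z)"
    "fst w \<in> points A" "snd w \<in> cotangent_space A (fst w)" using z w points_cot by blast+
  show "\<exists>U V. openin (manifold_topology (cot_atlas A)) U \<and> openin (manifold_topology (cot_atlas A)) V \<and>
      z \<in> U \<and> w \<in> V \<and> disjnt U V"
  proof (cases "fst z = fst w")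
    case False
    have lift: "openin (manifold_topology (cot_atlas A)) {z. fst z \<in> U \<and> snd z \<in> cotangent_space A (fst z)}"
      if U: "openin (manifold_topology A) U" for U
      unfolding openin_manifold_topology[OF smooth_atlas_cot]
    proof (intro conjI ballI)
      show "{z. fst z \<in> U \<and> snd z \<in> cotangent_space A (fst z)} \<subseteq> points (cot_atlas A)"
        using U unfolding openin_manifold_topology[OF A] by (auto simp: points_cot)
      fix C assume "C \<in> cot_atlas A"
      then obtain c where C: "C = cot_chart A c" and c: "c \<in> A" by (auto simp: cot_atlas_def)
      have "{z. fst z \<in> U \<and> snd z \<in> cotangent_space A (fst z)} \<inter> dom_of C =
          {z. fst z \<in> U \<inter> dom_of c \<and> snd z \<in> cotangent_space A (fst z)}"
        unfolding C cot_chart_simps by auto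
      then have "coords C ` ({z. fst z \<in> U \<and> snd z \<in> cotangent_space A (fst z)} \<inter> dom_of C) =
          coords c ` (U \<inter> dom_of c) \<times> UNIV"
        using cot_chart_image[OF c, of "U \<inter> dom_of c"] unfolding C by simp
      then show "open (coords C ` ({z. fst z \<in> U \<and> snd z \<in> cotangent_space A (fst z)} \<inter> dom_of C))"
        using U c unfolding openin_manifold_topology[OF A] by (auto intro: open_Times)
    qed
    have "fst z \<in> topspace (manifold_topology A)" "fst w \<in> topspace (manifold_topology A)"
      using zq by (simp_all add: topspace_manifold_topology[OF A])
    then obtain U V where "openin (manifold_topology A) U" "openin (manifold_topology A) V"
      "fst z \<in> U" "fst w \<in> V" "disjnt U V"
      using T2 False unfolding Hausdorff_space_def by meson
    then show ?thesis
      using lift[of U] lift[of V] zq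
      by (intro exI[of _ "{z. fst z \<in> U \<and> snd z \<in> cotangent_space A (fst z)}"]
            exI[of _ "{z. fst z \<in> V \<and> snd z \<in> cotangent_space A (fst z)}"])
         (auto simp: disjnt_iff)
  next
    case True
    obtain c where c: "c \<in> A" "fst z \<in> dom_of c" using zq(1) unfolding points_def by blast
    let ?C = "cot_chart A c"
    have C: "?C \<in> cot_atlas A" using c by (simp add: cot_atlas_def)
    have d: "z \<in> dom_of ?C" "w \<in> dom_of ?C" using c zq True by (auto simp: cot_chart_simps)
    then have "coords ?C z \<noteq> coords ?C w" using cot_chart_inj[OF c(1)] ne by (meson inj_onD)
    then obtain U V where "open U" "open V" "coords ?C z \<in> U" "coords ?C w \<in> V" "U \<inter> V = {}"
      by (meson hausdorff)
    then show ?thesis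
      using openin_chart_preimage[OF smooth_atlas_cot C, of U] openin_chart_preimage[OF smooth_atlas_cot C, of V] d
      by (intro exI[of _ "{x \<in> dom_of ?C. coords ?C x \<in> U}"] exI[of _ "{x \<in> dom_of ?C. coords ?C x \<in> V}"])
         (auto simp: disjnt_iff)
  qed
qed

lemma fibre_line_smooth_at:
  assumes q: "q \<in> points A" and p: "p \<in> cotangent_space A q" and \<beta>: "\<beta> \<in> cotangent_space A q"
  shows "smooth_at euclid_atlas (cot_atlas A) (\<lambda>t. (q, \<lambda>v. p v + t * \<beta> v)) t"
proof -
  obtain c where c: "c \<in> charts_at A q" using q points_iff by metis
  have cp: "(\<lambda>v. p v + t * \<beta> v) \<in> cotangent_space A q" for t
    using cotangent_combination[OF p \<beta>, of 1 t] by simp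
  show ?thesis
  proof (rule smooth_at_curveI[OF cot_chart_charts_at[OF c cp] open_UNIV UNIV_I])
    show "smooth_on UNIV (\<lambda>s. coords (cot_chart A c) (q, \<lambda>v. p v + s * \<beta> v))"
      unfolding cot_chart_simps fst_conv snd_conv covector_coords_combination
      by (intro smooth_on_Pair smooth_on_add smooth_on_const open_UNIV smooth_on_linear bounded_linear_scaleR_left)
  qed (use c cp in \<open>auto simp: cot_chart_simps charts_at_iff\<close>)
qed

text \<open>A line in a fibre is straight in a cotangent chart, with constant base
  coordinate.\<close>

lemma vert_chart:
  assumes c: "c \<in> charts_at A q" and p: "p \<in> cotangent_space A q"
  shows "vert A (q, p) \<beta> (cot_chart A c) = (0, covector_coords A c q \<beta>)"
proof -
  have "((\<lambda>s. (coords c q, covector_coords A c q p + s *\<^sub>R covector_coords A c q \<beta>)) has_vector_derivative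
      (0, covector_coords A c q \<beta>)) (at 0)"
    by (auto intro!: derivative_eq_intros has_vector_derivative_Pair)
  from vector_derivative_at[OF this]
  show ?thesis
    using cot_chart_charts_at[OF c p]
    by (simp add: vert_def velocity_def o_def cot_chart_simps covector_coords_combination)
qed

lemma vert_in:
  assumes q: "q \<in> points A" and p: "p \<in> cotangent_space A q" and \<beta>: "\<beta> \<in> cotangent_space A q"
  shows "vert A (q, p) \<beta> \<in> tangent_space (cot_atlas A) (q, p)"
  using velocity_in[OF smooth_atlas_cot fibre_line_smooth_at[OF assms, of 0]] by (simp add: vert_def)

text \<open>Gives meaning to the description in \<open>fibre_field\<close>: a vertical tangent
  vector is determined by its fibre component in one chart, and that component is the coordinate
  vector of exactly one covector.\<close>

lemma fibre_field:
  assumes X: "X \<in> vector_fields (cot_atlas A)" and q: "q \<in> points A" and p: "p \<in> cotangent_space A q"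
    and vertical: "\<And>C. C \<in> charts_at (cot_atlas A) (q, p) \<Longrightarrow> fst (X (q, p) C) = 0"
  shows "fibre_field A X q p \<in> cotangent_space A q" "X (q, p) = vert A (q, p) (fibre_field A X q p)"
    "\<beta> \<in> cotangent_space A q \<Longrightarrow> X (q, p) = vert A (q, p) \<beta> \<Longrightarrow> fibre_field A X q p = \<beta>"
proof -
  obtain c where c: "c \<in> charts_at A q" using q points_iff by metis
  note C = cot_chart_charts_at[OF c p]
  have Xz: "X (q, p) \<in> tangent_space (cot_atlas A) (q, p)"
    by (rule vector_fieldsD(1)[OF X]) (simp add: points_cot q p)
  define \<beta>0 where "\<beta>0 = covector A c q (snd (X (q, p) (cot_chart A c)))"
  have \<beta>0: "\<beta>0 \<in> cotangent_space A q" unfolding \<beta>0_def by (rule covector_in[OF A c])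
  have X0: "X (q, p) = vert A (q, p) \<beta>0"
    by (rule tangent_eqI[OF Xz vert_in[OF q p \<beta>0] C])
       (use vertical[OF C] in \<open>simp add: vert_chart[OF c p] \<beta>0_def covector_coords_covector[OF A c] prod_eq_iff\<close>)
  have uniq: "\<beta> = \<beta>0" if "\<beta> \<in> cotangent_space A q" "X (q, p) = vert A (q, p) \<beta>" for \<beta>
  proof -
    have "vert A (q, p) \<beta> (cot_chart A c) = vert A (q, p) \<beta>0 (cot_chart A c)"
      unfolding X0[symmetric] that(2)[symmetric] ..
    then show ?thesis
      unfolding vert_chart[OF c p] by (intro covector_coords_inject[OF A c that(1) \<beta>0]) simp
  qed
  have "fibre_field A X q p = \<beta>0"
    unfolding fibre_field_def by (rule the_equality) (use \<beta>0 X0 uniq in blast)+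
  then show "fibre_field A X q p \<in> cotangent_space A q" "X (q, p) = vert A (q, p) (fibre_field A X q p)"
    "\<beta> \<in> cotangent_space A q \<Longrightarrow> X (q, p) = vert A (q, p) \<beta> \<Longrightarrow> fibre_field A X q p = \<beta>"
    using \<beta>0 X0 uniq by blast+
qed

end

section \<open>The lifted action\<close>

locale cot_action = lie_action G AG Q \<phi>
  for G :: "('g, 'x) monoid_scheme" (structure) and AG :: "('g, 'k::banach) atlas"
  and Q :: "('q, 'e::euclidean_space) atlas" and \<phi> :: "'g \<Rightarrow> 'q \<Rightarrow> 'q"
begin

abbreviation "L \<equiv> lifted_action G Q \<phi>"

lemma fst_L: "fst (L g z) = \<phi> g (fst z)"
  by (simp add: lifted_action_def split_def)

lemma snd_L: "snd (L g z) v = (if v \<in> tangent_space Q (\<phi> g (fst z))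
    then snd z (tangent_map Q Q (\<phi> (inv g)) (\<phi> g (fst z)) v) else 0)"
  by (simp add: lifted_action_def split_def)

lemma inverse_tangent:
  assumes g: "g \<in> carrier G" and q: "q \<in> points Q" and v: "v \<in> tangent_space Q (\<phi> g q)"
  shows "smooth_at Q Q (\<phi> (inv g)) (\<phi> g q)" "tangent_map Q Q (\<phi> (inv g)) (\<phi> g q) v \<in> tangent_space Q q"
proof -
  show s: "smooth_at Q Q (\<phi> (inv g)) (\<phi> g q)" using \<Phi>_smooth_at \<Phi>_points g q by simp
  show "tangent_map Q Q (\<phi> (inv g)) (\<phi> g q) v \<in> tangent_space Q q"
    using tangent_map_in[OF M M s v] \<Phi>_inv[OF g q] by simp
qed

lemma L_cotangent:
  assumes g: "g \<in> carrier G" and q: "q \<in> points Q" and p: "p \<in> cotangent_space Q q"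
  shows "snd (L g (q, p)) \<in> cotangent_space Q (\<phi> g q)"
proof (rule cotangentI)
  fix v w r s assume v: "v \<in> tangent_space Q (\<phi> g q)" and w: "w \<in> tangent_space Q (\<phi> g q)"
  show "snd (L g (q, p)) (\<lambda>c. r *\<^sub>R v c + s *\<^sub>R w c) = r * snd (L g (q, p)) v + s * snd (L g (q, p)) w"
    using v w tangent_space_combination[OF M \<Phi>_points[OF g q] v w, of r s]
    by (simp add: snd_L tangent_map_combination[OF M M inverse_tangent(1)[OF g q v] v w]
        cotangent_linear[OF p inverse_tangent(2)[OF g q v] inverse_tangent(2)[OF g q w]])
qed (simp add: snd_L)

lemma L_one:
  assumes z: "z \<in> points (cot_atlas Q)"
  shows "L \<one> z = z"
proof (rule prod_eqI)
  have q: "fst z \<in> points Q" and p: "snd z \<in> cotangent_space Q (fst z)" using z points_cot by blast+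
  show "fst (L \<one> z) = fst z" by (simp add: fst_L \<Phi>_one q)
  show "snd (L \<one> z) = snd z"
  proof
    fix v show "snd (L \<one> z) v = snd z v"
      using tangent_map_cong[OF M q, of "\<phi> \<one>" "\<lambda>x. x" Q v] tangent_map_id[OF M q, of v] cotangent_outside[OF p, of v]
      by (simp add: snd_L \<Phi>_one q)
  qed
qed

lemma L_mult:
  assumes g: "g \<in> carrier G" and k: "k \<in> carrier G" and z: "z \<in> points (cot_atlas Q)"
  shows "L (g \<otimes> k) z = L g (L k z)"
proof (rule prod_eqI)
  have q: "fst z \<in> points Q" using z points_cot by blast
  let ?q = "fst z"
  note kq = \<Phi>_points[OF k q] and gkq = \<Phi>_points[OF g \<Phi>_points[OF k q]]
  show "fst (L (g \<otimes> k) z) = fst (L g (L k z))" by (simp add: fst_L \<Phi>_mult g k q)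
  show "snd (L (g \<otimes> k) z) = snd (L g (L k z))"
  proof
    fix v
    show "snd (L (g \<otimes> k) z) v = snd (L g (L k z)) v"
    proof (cases "v \<in> tangent_space Q (\<phi> g (\<phi> k ?q))")
      case True
      have "tangent_map Q Q (\<phi> (inv (g \<otimes> k))) (\<phi> g (\<phi> k ?q)) v =
          tangent_map Q Q (\<lambda>x. \<phi> (inv k) (\<phi> (inv g) x)) (\<phi> g (\<phi> k ?q)) v"
        by (rule tangent_map_cong[OF M gkq]) (simp add: inv_mult_group g k \<Phi>_mult)
      also have "\<dots> = tangent_map Q Q (\<phi> (inv k)) (\<phi> (inv g) (\<phi> g (\<phi> k ?q)))
          (tangent_map Q Q (\<phi> (inv g)) (\<phi> g (\<phi> k ?q)) v)"
        by (rule tangent_map_compose[OF M M M inverse_tangent(1)[OF g kq True] _ True])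
           (use \<Phi>_smooth_at kq k \<Phi>_inv[OF g kq] in simp)
      finally show ?thesis
        using True inverse_tangent(2)[OF g kq True] by (simp add: snd_L fst_L \<Phi>_mult g k q \<Phi>_inv[OF g kq])
    qed (simp add: snd_L fst_L \<Phi>_mult g k q)
  qed
qed

text \<open>In coordinates the base moves by \<open>\<Theta>\<close> and the fibre by the transpose
  of the derivative, in the second argument, of \<open>\<Theta>'\<close>, which represents the
  action of the inverse element. Only derivatives along basis vectors and inner products occur in
  this formula.\<close>

lemma L_smooth: "smooth_map (prod_atlas AG (cot_atlas Q)) (cot_atlas Q) (\<lambda>(g, z). L g z)"
proof (rule smooth_mapI)
  fix w0 assume "w0 \<in> points (prod_atlas AG (cot_atlas Q))"
  then obtain g0 q0 p0 where w0: "w0 = (g0, (q0, p0))" and g0: "g0 \<in> carrier G"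
    and q0: "q0 \<in> points Q" and p0: "p0 \<in> cotangent_space Q q0"
    by (cases w0) (auto simp: pts points_cot)
  note y0 = \<Phi>_points[OF g0 q0]
  obtain b where b: "b \<in> charts_at AG g0" using g0 pts points_iff[of g0 AG] by auto
  \<comment> \<open>A separate chart at \<open>inv g0\<close>, since the inverse may lie outside the
    domain of \<open>b\<close>.\<close>
  obtain b' where b': "b' \<in> charts_at AG (inv g0)" using g0 pts points_iff[of "inv g0" AG] by auto
  obtain c where c: "c \<in> charts_at Q q0" using q0 points_iff by metis
  obtain c' where c': "c' \<in> charts_at Q (\<phi> g0 q0)" using y0 points_iff by metis
  have bA: "b \<in> AG" "b' \<in> AG" "c \<in> Q" "c' \<in> Q" "g0 \<in> dom_of b" "inv g0 \<in> dom_of b'" "q0 \<in> dom_of c" "\<phi> g0 q0 \<in> dom_of c'"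
    using b b' c c' by (auto simp: charts_at_iff)
  have dom: "g \<in> carrier G" if "g \<in> dom_of b" for g using that bA(1) unfolding pts[symmetric] points_def by blast
  define D where "D = {z. fst z \<in> coords b ` dom_of b \<and> snd z \<in> coords c ` dom_of c \<and>
      \<phi> (point_of b (fst z)) (point_of c (snd z)) \<in> dom_of c'}"
  define \<Theta> where "\<Theta> = (\<lambda>z. coords c' (\<phi> (point_of b (fst z)) (point_of c (snd z))))"
  have D: "open D" and \<Theta>: "smooth_on D \<Theta>"
    using prod_rep[OF AG M M \<Phi>_smooth bA(1,3,4)] unfolding D_def \<Theta>_def by auto
  define D' where "D' = {z. fst z \<in> coords b' ` dom_of b' \<and> snd z \<in> coords c' ` dom_of c' \<and>
      \<phi> (point_of b' (fst z)) (point_of c' (snd z)) \<in> dom_of c}"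
  define \<Theta>' where "\<Theta>' = (\<lambda>z. coords c (\<phi> (point_of b' (fst z)) (point_of c' (snd z))))"
  have D': "open D'" and \<Theta>': "smooth_on D' \<Theta>'"
    using prod_rep[OF AG M M \<Phi>_smooth bA(2,4,3)] unfolding D'_def \<Theta>'_def by auto
  let ?\<iota> = "\<lambda>\<kappa>. coords b' (inv (point_of b \<kappa>))"
  define N where "N = {u \<in> coords b ` dom_of b. inv (point_of b u) \<in> dom_of b'}"
  have N: "open N" "smooth_on N ?\<iota>"
    using smooth_rep[OF AG AG bA(1,2), of "\<lambda>x. inv x"] smooth_at_inv[OF AG smooth_at_id[OF AG]] dom pts
    unfolding N_def by auto
  \<comment> \<open>The fibre variable is unrestricted, because the lifted action maps whole fibres
    to whole fibres.\<close>
  define W where "W = {w :: 'k \<times> 'e \<times> 'e. fst w \<in> N \<and> (fst w, fst (snd w)) \<in> D}"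
  have "W = fst -` N \<inter> (\<lambda>w. (fst w, fst (snd w))) -` D" unfolding W_def by auto
  then have W: "open W"
    by (auto intro!: open_Int open_vimage N D continuous_intros)
  have fdW: "finite_dim TYPE('k \<times> 'e)" by (rule finite_dim_prod[OF smooth_atlasD(1)[OF AG] finite_dim_euclidean])
  have pW: "smooth_on W (\<lambda>w. (fst w, fst (snd w)))"
    by (intro smooth_on_linear W bounded_linear_Pair bounded_linear_fst bounded_linear_compose[OF bounded_linear_fst bounded_linear_snd])
  have y: "smooth_on W (\<lambda>w. \<Theta> (fst w, fst (snd w)))"
    by (rule smooth_on_compose[OF fdW W D _ pW \<Theta>]) (auto simp: W_def)
  have i: "smooth_on W (\<lambda>w. ?\<iota> (fst w))"
    by (rule smooth_on_compose[OF smooth_atlasD(1)[OF AG] W N(1) _ _ N(2)])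
       (auto simp: W_def intro: smooth_on_linear bounded_linear_fst W[unfolded W_def])
  have facts: "point_of b \<kappa> \<in> carrier G" "point_of c x \<in> dom_of c" "coords c (point_of c x) = x"
      "\<phi> (point_of b \<kappa>) (point_of c x) \<in> dom_of c'" "inv (point_of b \<kappa>) \<in> dom_of b'"
      "x \<in> coords c ` dom_of c" "\<kappa> \<in> coords b ` dom_of b"
      "point_of b' (?\<iota> \<kappa>) = inv (point_of b \<kappa>)" "(?\<iota> \<kappa>, \<Theta> (\<kappa>, x)) \<in> D'"
      "point_of c x \<in> points Q" if w: "(\<kappa>, x, \<eta>) \<in> W" for \<kappa> x \<eta>
  proof -
    show 1: "x \<in> coords c ` dom_of c" "\<kappa> \<in> coords b ` dom_of b" "\<phi> (point_of b \<kappa>) (point_of c x) \<in> dom_of c'"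
      "inv (point_of b \<kappa>) \<in> dom_of b'" using w unfolding W_def D_def N_def by auto
    show 2: "point_of b \<kappa> \<in> carrier G" "point_of c x \<in> dom_of c" "coords c (point_of c x) = x"
      using dom point_of_in_dom[OF 1(2)] point_of_in_dom[OF 1(1)] coords_point_of[OF 1(1)] by auto
    show 3: "point_of c x \<in> points Q" using 2(2) bA(3) unfolding points_def by blast
    show 4: "point_of b' (?\<iota> \<kappa>) = inv (point_of b \<kappa>)" by (rule point_of_coords[OF AG bA(2) 1(4)])
    show "(?\<iota> \<kappa>, \<Theta> (\<kappa>, x)) \<in> D'"
      unfolding D'_def \<Theta>_def using 1(3,4) 2(2) 4 point_of_coords[OF M bA(4) 1(3)] \<Phi>_inv[OF 2(1) 3] by auto
  qed
  let ?F = "\<lambda>w. (?\<iota> (fst w), \<Theta> (fst w, fst (snd w)))"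
  have F: "smooth_on W ?F" by (rule smooth_on_Pair[OF W i y])
  have FD: "?F ` W \<subseteq> D'" using facts(9) by fastforce
  have sm: "smooth_on W (\<lambda>w. (\<Theta> (fst w, fst (snd w)),
      \<Sum>e\<in>Basis. (frechet_derivative \<Theta>' (at (?F w)) (0, e) \<bullet> snd (snd w)) *\<^sub>R e))"
    by (intro smooth_on_Pair[OF W y] smooth_on_sum smooth_on_scaleR smooth_on_inner W smooth_on_const
        smooth_on_compose[OF fdW W D' FD F smooth_on_frechet[OF \<Theta>']] smooth_on_linear
        bounded_linear_compose[OF bounded_linear_snd bounded_linear_snd])
  let ?B = "prod_chart b (cot_chart Q c)" and ?C = "cot_chart Q c'"
  note cotQ = smooth_atlas_cot[OF M]
  have cc: "cot_chart Q c \<in> cot_atlas Q" using bA(3) by (simp add: cot_atlas_def)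
  have cimg: "coords (cot_chart Q c) ` dom_of (cot_chart Q c) = coords c ` dom_of c \<times> UNIV"
    using cot_chart_image[OF M bA(3) subset_refl] unfolding cot_chart_simps(1) by simp
  have img: "coords ?B ` dom_of ?B = coords b ` dom_of b \<times> coords c ` dom_of c \<times> UNIV"
    using image_prod_chart[of "coords b" "coords (cot_chart Q c)" "dom_of b" "dom_of (cot_chart Q c)"] cimg by simp
  have pt: "point_of ?B (\<kappa>, x, \<eta>) = (point_of b \<kappa>, point_of c x, covector Q c (point_of c x) \<eta>)"
    if w: "(\<kappa>, x, \<eta>) \<in> W" for \<kappa> x \<eta>
    using point_of_prod[OF AG cotQ bA(1) cc facts(7)[OF w], of "(x, \<eta>)"] cimg facts(6)[OF w]
      point_of_cot[OF M bA(3) facts(6)[OF w]] by simp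
  have inC: "L (point_of b \<kappa>) (point_of c x, covector Q c (point_of c x) \<eta>) \<in> dom_of ?C"
    if w: "(\<kappa>, x, \<eta>) \<in> W" for \<kappa> x \<eta>
    using L_cotangent[OF facts(1)[OF w] facts(10)[OF w] covector_in[OF M, of c "point_of c x" \<eta>]]
      facts(2,4)[OF w] bA(3) by (simp add: cot_chart_simps fst_L charts_at_iff)
  have rep: "coords ?C (L (point_of b \<kappa>) (point_of c x, covector Q c (point_of c x) \<eta>)) =
      (\<Theta> (\<kappa>, x), \<Sum>e\<in>Basis. (frechet_derivative \<Theta>' (at (?\<iota> \<kappa>, \<Theta> (\<kappa>, x))) (0, e) \<bullet> \<eta>) *\<^sub>R e)"
    if w: "(\<kappa>, x, \<eta>) \<in> W" for \<kappa> x \<eta>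
  proof -
    let ?g = "point_of b \<kappa>" and ?q = "point_of c x"
    note f = facts[OF w]
    have y: "c' \<in> charts_at Q (\<phi> ?g ?q)" using f(4) bA(4) by (simp add: charts_at_iff)
    have cq: "c \<in> charts_at Q (\<phi> (inv ?g) (\<phi> ?g ?q))" using f(2) bA(3) by (simp add: charts_at_iff \<Phi>_inv[OF f(1,10)])
    note cv = coord_vec_in[OF M y]
    have "snd (L ?g (?q, covector Q c ?q \<eta>)) (coord_vec Q c' (\<phi> ?g ?q) e) =
        frechet_derivative \<Theta>' (at (?\<iota> \<kappa>, \<Theta> (\<kappa>, x))) (0, e) \<bullet> \<eta>" for e
    proof -
      have "snd (L ?g (?q, covector Q c ?q \<eta>)) (coord_vec Q c' (\<phi> ?g ?q) e) =
         tangent_map Q Q (\<phi> (inv ?g)) (\<phi> ?g ?q) (coord_vec Q c' (\<phi> ?g ?q) e) c \<bullet> \<eta>"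
        using inverse_tangent(2)[OF f(1,10) cv] by (simp add: snd_L cv covector_def)
      also have "tangent_map Q Q (\<phi> (inv ?g)) (\<phi> ?g ?q) (coord_vec Q c' (\<phi> ?g ?q) e) c =
          frechet_derivative (\<lambda>u. coords c (\<phi> (inv ?g) (point_of c' u))) (at (coords c' (\<phi> ?g ?q))) e"
        using tangent_map_chart[OF M M inverse_tangent(1)[OF f(1,10) cv] cv y cq] coord_vec_self[OF M y] by simp
      also have "\<dots> = frechet_derivative \<Theta>' (at (?\<iota> \<kappa>, \<Theta> (\<kappa>, x))) (0, e)"
        using frechet_derivative_at[OF partial_derivative(1)[OF smooth_on_has_derivative[OF \<Theta>' f(9)]]]
        by (simp add: \<Theta>'_def \<Theta>_def fun_eq_iff f(8))
      finally show ?thesis .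
    qed
    then show ?thesis by (simp add: cot_chart_simps fst_L covector_coords_def \<Theta>_def)
  qed
  show "smooth_at (prod_atlas AG (cot_atlas Q)) (cot_atlas Q) (\<lambda>(g, z). L g z) w0"
  proof (rule smooth_atI[where c = ?B and c' = ?C and W = W])
    show "?B \<in> charts_at (prod_atlas AG (cot_atlas Q)) w0"
      unfolding w0 by (rule prod_chart_in[OF b cot_chart_charts_at[OF c p0]])
    have "(\<phi> g0 q0, snd (L g0 (q0, p0))) = L g0 (q0, p0)" by (rule prod_eqI) (simp_all add: fst_L)
    then show "?C \<in> charts_at (cot_atlas Q) (case w0 of (g, z) \<Rightarrow> L g z)"
      using cot_chart_charts_at[OF c' L_cotangent[OF g0 q0 p0]]
      unfolding w0 by simp
    have "point_of b (coords b g0) = g0" "point_of c (coords c q0) = q0"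
      using point_of_coords[OF AG bA(1,5)] point_of_coords[OF M bA(3,7)] by auto
    then show "coords ?B w0 \<in> W" unfolding w0 W_def N_def D_def using bA by (simp add: cot_chart_simps)
    show "u \<in> coords ?B ` dom_of ?B" if "u \<in> W" for u
      using that facts(6,7)[of "fst u" "fst (snd u)" "snd (snd u)"] unfolding img by (simp add: mem_Times_iff)
    show "(case point_of ?B u of (g, z) \<Rightarrow> L g z) \<in> dom_of ?C" if "u \<in> W" for u
      using that pt[of "fst u" "fst (snd u)" "snd (snd u)"] inC[of "fst u" "fst (snd u)" "snd (snd u)"] by simp
    show "smooth_on W (\<lambda>u. coords ?C (case point_of ?B u of (g, z) \<Rightarrow> L g z))"
    proof (rule smooth_on_cong[OF W _ sm])
      fix u assume "u \<in> W"
      then show "(\<Theta> (fst u, fst (snd u)),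
          \<Sum>e\<in>Basis. (frechet_derivative \<Theta>' (at (?F u)) (0, e) \<bullet> snd (snd u)) *\<^sub>R e) =
        coords ?C (case point_of ?B u of (g, z) \<Rightarrow> L g z)"
        using pt[of "fst u" "fst (snd u)" "snd (snd u)"] rep[of "fst u" "fst (snd u)" "snd (snd u)"] by simp
    qed
  qed (rule W)
qed

text \<open>Puts the cotangent bundle under the theory of \<open>lie_action\<close>: the generators
  of the lifted action are smooth, and fields commuting with them are invariant.\<close>

lemma lifted: "lie_action G AG (cot_atlas Q) L"
proof (unfold_locales)
  show "smooth_atlas (cot_atlas Q)" by (rule smooth_atlas_cot[OF M])
  show "smooth_action G AG (cot_atlas Q) L"
    unfolding smooth_action_def using L_smooth L_one L_mult by blast
qed

end

section \<open>Conservation laws and Runge--Kutta steps\<close>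

lemma vector_fields_combination:
  assumes A: "smooth_atlas A" and X: "X \<in> vector_fields A" and Y: "Y \<in> vector_fields A"
  shows "(\<lambda>x c. r *\<^sub>R X x c + s *\<^sub>R Y x c) \<in> vector_fields A"
  unfolding vector_fields_def mem_Collect_eq
proof (intro conjI ballI)
  show "(\<lambda>c. r *\<^sub>R X x c + s *\<^sub>R Y x c) \<in> tangent_space A x" if "x \<in> points A" for x
    by (rule tangent_space_combination[OF A that vector_fieldsD(1)[OF X that] vector_fieldsD(1)[OF Y that]])
  fix c assume c: "c \<in> A"
  show "smooth_on (coords c ` dom_of c) (\<lambda>u. r *\<^sub>R X (point_of c u) c + s *\<^sub>R Y (point_of c u) c)"
    by (intro smooth_on_add smooth_on_scaleR smooth_atlasD(3)[OF A c] smooth_on_const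
        vector_fieldsD(2)[OF X c] vector_fieldsD(2)[OF Y c])
qed

lemma lie_bracket_combination:
  assumes A: "smooth_atlas A" and X: "X \<in> vector_fields A" and Y: "Y \<in> vector_fields A"
    and Z: "\<And>c. c \<in> charts_at A x \<Longrightarrow> (\<lambda>u. Z (point_of c u) c) differentiable (at (coords c x))"
  shows "lie_bracket A (\<lambda>x c. r *\<^sub>R X x c + s *\<^sub>R Y x c) Z x =
    (\<lambda>c. r *\<^sub>R lie_bracket A X Z x c + s *\<^sub>R lie_bracket A Y Z x c)"
proof
  fix c
  show "lie_bracket A (\<lambda>x c. r *\<^sub>R X x c + s *\<^sub>R Y x c) Z x c =
    r *\<^sub>R lie_bracket A X Z x c + s *\<^sub>R lie_bracket A Y Z x c"
  proof (cases "c \<in> charts_at A x")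
    case True
    then have c: "c \<in> A" "coords c x \<in> coords c ` dom_of c" by (auto simp: charts_at_iff)
    let ?u = "coords c x"
    have dX: "((\<lambda>u. X (point_of c u) c) has_derivative frechet_derivative (\<lambda>u. X (point_of c u) c) (at ?u)) (at ?u)"
      by (rule smooth_on_has_derivative[OF vector_fieldsD(2)[OF X c(1)] c(2)])
    have dY: "((\<lambda>u. Y (point_of c u) c) has_derivative frechet_derivative (\<lambda>u. Y (point_of c u) c) (at ?u)) (at ?u)"
      by (rule smooth_on_has_derivative[OF vector_fieldsD(2)[OF Y c(1)] c(2)])
    have lZ: "linear (frechet_derivative (\<lambda>u. Z (point_of c u) c) (at ?u))"
      using Z[OF True] by (rule linear_frechet_derivative)
    have "((\<lambda>u. r *\<^sub>R X (point_of c u) c + s *\<^sub>R Y (point_of c u) c) has_derivative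
        (\<lambda>h. r *\<^sub>R frechet_derivative (\<lambda>u. X (point_of c u) c) (at ?u) h +
          s *\<^sub>R frechet_derivative (\<lambda>u. Y (point_of c u) c) (at ?u) h)) (at ?u)"
      by (intro has_derivative_add has_derivative_scaleR_right dX dY)
    from frechet_derivative_at[OF this, symmetric] show ?thesis
      using True by (simp add: lie_bracket_def linear_add[OF lZ] linear_scale[OF lZ] algebra_simps)
  qed (simp add: lie_bracket_def)
qed

lemma lie_deriv_combination:
  assumes A: "smooth_atlas A" and f: "smooth_at A euclid_atlas f x"
  shows "lie_deriv A (\<lambda>x c. r *\<^sub>R X x c + s *\<^sub>R Y x c) f x = r * lie_deriv A X f x + s * lie_deriv A Y f x"
proof -
  define c where "c = (SOME c. c \<in> charts_at A x)"
  have c: "c \<in> charts_at A x"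
    unfolding c_def using smooth_at_points[OF f] points_iff[of x A] someI_ex by metis
  have "((\<lambda>u. f (point_of c u)) has_derivative frechet_derivative (\<lambda>u. f (point_of c u)) (at (coords c x))) (at (coords c x))"
    using rep_derivative[where c = c and c' = "(UNIV, \<lambda>x. x)", OF A smooth_atlas_real f c] by simp
  then have "linear (frechet_derivative (\<lambda>u. f (point_of c u)) (at (coords c x)))"
    by (rule has_derivative_linear)
  then show ?thesis
    by (simp add: lie_deriv_def Let_def o_def linear_add linear_scale flip: c_def)
qed

lemma Diff_compose:
  assumes A: "smooth_atlas A" and F: "F \<in> Diff A" and G: "G \<in> Diff A"
  shows "F \<circ> G \<in> Diff A"
proof -
  have bF: "bij_betw F (points A) (points A)" and bG: "bij_betw G (points A) (points A)"
    and s: "smooth_map A A F" "smooth_map A A G"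
      "smooth_map A A (inv_into (points A) F)" "smooth_map A A (inv_into (points A) G)"
    using F G by (auto simp: Diff_def)
  have "smooth_map A A (\<lambda>x. F (G x))" by (rule smooth_map_compose[OF A A A s(2,1)])
  moreover have "smooth_map A A (inv_into (points A) (F \<circ> G))"
  \<comment> \<open>Agreement of \<open>inv_into\<close> of the composite with the composite of the
    inverses is available on \<open>points A\<close> only.\<close>
  proof (rule smooth_map_cong[OF A A])
    show "smooth_map A A (\<lambda>x. inv_into (points A) G (inv_into (points A) F x))"
      by (rule smooth_map_compose[OF A A A s(3,4)])
    fix y assume y: "y \<in> points A"
    define z where "z = inv_into (points A) G (inv_into (points A) F y)"
    have y1: "inv_into (points A) F y \<in> points A" "F (inv_into (points A) F y) = y"
      using bij_betw_inv_into_right[OF bF y] bij_betwE[OF bij_betw_inv_into[OF bF]] y by auto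
    have z: "z \<in> points A" "F (G z) = y"
      using bij_betw_inv_into_right[OF bG y1(1)] bij_betwE[OF bij_betw_inv_into[OF bG]] y1 by (auto simp: z_def)
    have "inv_into (points A) (F \<circ> G) ((F \<circ> G) z) = z"
      by (rule inv_into_f_f[OF bij_betw_imp_inj_on[OF bij_betw_trans[OF bG bF]] z(1)])
    then show "inv_into (points A) G (inv_into (points A) F y) = inv_into (points A) (F \<circ> G) y"
      using z(2) by (simp add: z_def)
  qed
  ultimately show ?thesis
    using bij_betw_trans[OF bG bF] by (simp add: Diff_def o_def)
qed

lemma Diff_points: "F \<in> Diff A \<Longrightarrow> x \<in> points A \<Longrightarrow> F x \<in> points A"
  by (auto simp: Diff_def bij_betw_def)

text \<open>In a cotangent chart the Hamiltonian factors through the base coordinate, so its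
  derivative vanishes on every \<open>(0, b)\<close>.\<close>

lemma X_V_vertical:
  fixes A :: "('m, 'e::euclidean_space) atlas"
  assumes A: "smooth_atlas A" and V: "smooth_map A euclid_atlas V"
    and C: "C \<in> charts_at (cot_atlas A) z"
  shows "fst (X_V A V z C) = 0"
proof -
  obtain c where c: "C = cot_chart A c" "c \<in> A" "c \<in> charts_at A (fst z)"
    by (rule charts_at_cotE[OF C]) (rule that)
  let ?K = "coords c ` dom_of c"
  have K: "open (?K \<times> (UNIV :: 'e set))" by (intro open_Times smooth_atlasD(3)[OF A c(2)] open_UNIV)
  have z: "coords C z \<in> ?K \<times> UNIV" using c(3) by (simp add: c(1) cot_chart_simps charts_at_iff)
  have fz: "fst (coords C z) = coords c (fst z)" by (simp add: c(1) cot_chart_simps)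
  let ?V' = "frechet_derivative (\<lambda>u. V (point_of c u)) (at (coords c (fst z)))"
  have V': "((\<lambda>u. V (point_of c u)) has_derivative ?V') (at (coords c (fst z)))"
    using rep_derivative[where c = c and c' = "(UNIV, \<lambda>x. x)", OF A smooth_atlas_real
        smooth_mapD(1)[OF V charts_at_points[OF c(3)]] c(3)] by simp
  have "((\<lambda>u. V (point_of c (fst u))) has_derivative (\<lambda>h. ?V' (fst h))) (at (coords C z))"
    by (rule has_derivative_compose[OF has_derivative_fst[OF has_derivative_ident]]) (simp add: V' fz)
  then have "(((\<lambda>(q, p). V q) \<circ> point_of C) has_derivative (\<lambda>h. ?V' (fst h))) (at (coords C z))"
  proof (rule has_derivative_transform_within_open[OF _ K z])
    fix u assume "u \<in> ?K \<times> (UNIV :: 'e set)"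
    then show "V (point_of c (fst u)) = ((\<lambda>(q, p). V q) \<circ> point_of C) u"
      using point_of_cot[OF A c(2), of "fst u" "snd u"] by (auto simp: c(1))
  qed
  from frechet_derivative_at[OF this, symmetric] linear_0[OF has_derivative_linear[OF V']] C
  show ?thesis by (simp add: X_V_def ham_vf_def Let_def)
qed

lemma Y_diss_vertical:
  assumes A: "smooth_atlas A" and C: "C \<in> charts_at (cot_atlas A) z"
  shows "fst (Y_diss A g d z C) = 0"
proof -
  obtain c where c: "C = cot_chart A c" "c \<in> charts_at A (fst z)" "snd z \<in> cotangent_space A (fst z)"
    by (rule charts_at_cotE[OF C]) (rule that)
  show ?thesis using vert_chart[OF A c(2,3)] by (simp add: Y_diss_def split_def c(1))
qed

lemma rk_result_unique:
  assumes rk: "rk_diffeo A s a b h X" and "q \<in> points A" "p \<in> cotangent_space A q"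
  shows "\<exists>!p'. rk_result A s a b h X q p p'"
proof -
  have "(q, p) \<in> points (cot_atlas A)" using assms by (simp add: points_cot)
  from bspec[OF conjunct1[OF rk[unfolded rk_diffeo_def]] this] show ?thesis by simp
qed

locale cotangent_symmetry = cot_action G AG Q \<phi>
  for G :: "('g, 'x) monoid_scheme" (structure) and AG :: "('g, 'k::banach) atlas"
  and Q :: "('q, 'e::euclidean_space) atlas" and \<phi> :: "'g \<Rightarrow> 'q \<Rightarrow> 'q" +
  assumes T2: "Hausdorff_space (manifold_topology Q)"
begin

sublocale lift: lie_action G AG "cot_atlas Q" L by (rule lifted)

lemmas cotQ = smooth_atlas_cot[OF M]
lemmas T2_cot = Hausdorff_cot[OF M T2]

abbreviation "J \<equiv> momentum G AG Q \<phi>"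

lemma momentum_rep:
  assumes \<xi>: "\<xi> \<in> lie_algebra G AG" and c: "c \<in> Q" and u: "fst u \<in> coords c ` dom_of c"
  shows "J \<xi> (point_of (cot_chart Q c) u) = generator G AG Q \<phi> \<xi> (point_of c (fst u)) c \<bullet> snd u"
proof -
  have "point_of c (fst u) \<in> points Q" using point_of_in_dom[OF u] c unfolding points_def by blast
  from generator_in[OF \<xi> this] show ?thesis
    using point_of_cot[OF M c u, of "snd u"] by (simp add: momentum_def covector_def)
qed

lemma momentum_rep_smooth:
  assumes \<xi>: "\<xi> \<in> lie_algebra G AG" and c: "c \<in> Q"
  shows "smooth_on (coords c ` dom_of c \<times> UNIV) (\<lambda>u. generator G AG Q \<phi> \<xi> (point_of c (fst u)) c \<bullet> snd u)"
proof -
  note K = smooth_atlasD(3)[OF M c]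
  have op: "open (coords c ` dom_of c \<times> (UNIV :: 'e set))" by (intro open_Times K open_UNIV)
  have "smooth_on (coords c ` dom_of c \<times> (UNIV :: 'e set)) (\<lambda>u. generator G AG Q \<phi> \<xi> (point_of c (fst u)) c)"
    by (rule smooth_on_compose[OF finite_dim_euclidean op K _ _ generator_smooth[OF \<xi> c]])
       (auto intro: smooth_on_linear bounded_linear_fst op)
  then show ?thesis by (rule smooth_on_inner[OF op _ smooth_on_linear[OF bounded_linear_snd op]])
qed

lemma momentum_smooth_at:
  assumes \<xi>: "\<xi> \<in> lie_algebra G AG" and z: "z \<in> points (cot_atlas Q)"
  shows "smooth_at (cot_atlas Q) euclid_atlas (J \<xi>) z"
proof -
  have q: "fst z \<in> points Q" "snd z \<in> cotangent_space Q (fst z)" using z points_cot by blast+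
  obtain c where c: "c \<in> charts_at Q (fst z)" using q points_iff by metis
  then have cQ: "c \<in> Q" "fst z \<in> dom_of c" by (auto simp: charts_at_iff)
  have op: "open (coords c ` dom_of c \<times> (UNIV :: 'e set))"
    by (intro open_Times smooth_atlasD(3)[OF M cQ(1)] open_UNIV)
  show ?thesis
  proof (rule smooth_at_fun[OF _ op])
    show "cot_chart Q c \<in> charts_at (cot_atlas Q) z" using cot_chart_charts_at[OF c q(2)] by simp
    show "coords (cot_chart Q c) z \<in> coords c ` dom_of c \<times> UNIV" using cQ by (simp add: cot_chart_simps)
    show "coords c ` dom_of c \<times> UNIV \<subseteq> coords (cot_chart Q c) ` dom_of (cot_chart Q c)"
      using cot_chart_image[OF M cQ(1) subset_refl] unfolding cot_chart_simps(1) by simp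
    show "smooth_on (coords c ` dom_of c \<times> UNIV) (\<lambda>u. J \<xi> (point_of (cot_chart Q c) u))"
      by (rule smooth_on_cong[OF op _ momentum_rep_smooth[OF \<xi> cQ(1)]]) (use momentum_rep[OF \<xi> cQ(1)] in auto)
  qed
qed

text \<open>The momentum is linear on the fibres, so along a vertical vector its derivative is its value.\<close>
lemma lie_deriv_momentum_vertical:
  assumes \<xi>: "\<xi> \<in> lie_algebra G AG" and q: "q \<in> points Q" and p: "p \<in> cotangent_space Q q"
    and \<beta>: "\<beta> \<in> cotangent_space Q q" and X: "X (q, p) = vert Q (q, p) \<beta>"
  shows "lie_deriv (cot_atlas Q) X (J \<xi>) (q, p) = \<beta> (generator G AG Q \<phi> \<xi> q)"
proof -
  have z: "(q, p) \<in> points (cot_atlas Q)" by (simp add: points_cot q p)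
  define C where "C = (SOME C. C \<in> charts_at (cot_atlas Q) (q, p))"
  have C: "C \<in> charts_at (cot_atlas Q) (q, p)"
    unfolding C_def using z points_iff[of "(q, p)" "cot_atlas Q"] someI_ex by metis
  obtain c where c: "C = cot_chart Q c" "c \<in> Q" "c \<in> charts_at Q q"
    by (rule charts_at_cotE[OF C, unfolded fst_conv]) (rule that)
  let ?S = "coords c ` dom_of c \<times> (UNIV :: 'e set)"
  let ?f = "\<lambda>u. generator G AG Q \<phi> \<xi> (point_of c (fst u)) c \<bullet> snd u"
  have op: "open ?S" by (intro open_Times smooth_atlasD(3)[OF M c(2)] open_UNIV)
  have dom: "q \<in> dom_of c" using c(3) by (simp add: charts_at_iff)
  have z0: "coords C (q, p) = (coords c q, covector_coords Q c q p)" by (simp add: c(1) cot_chart_simps)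
  have zS: "coords C (q, p) \<in> ?S" using dom by (simp add: z0)
  have eq: "frechet_derivative (\<lambda>u. J \<xi> (point_of C u)) (at (coords C (q, p))) = frechet_derivative ?f (at (coords C (q, p)))"
    by (rule frechet_derivative_cong[OF op zS]) (use momentum_rep[OF \<xi> c(2)] c(1) in auto)
  have D: "(?f has_derivative frechet_derivative ?f (at (coords c q, covector_coords Q c q p))) (at (coords c q, covector_coords Q c q p))"
    using smooth_on_has_derivative[OF momentum_rep_smooth[OF \<xi> c(2)] zS] by (simp add: z0)
  have "((\<lambda>\<eta>. ?f (coords c q, \<eta>)) has_derivative (\<lambda>h. frechet_derivative ?f (at (coords c q, covector_coords Q c q p)) (0, h)))
      (at (covector_coords Q c q p))" by (rule partial_derivative(1)[OF D])
  moreover have "((\<lambda>\<eta>. ?f (coords c q, \<eta>)) has_derivative (\<lambda>h. generator G AG Q \<phi> \<xi> q c \<bullet> h)) (at (covector_coords Q c q p))"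
    using point_of_coords[OF M c(2) dom]
    by (simp add: bounded_linear_imp_has_derivative bounded_linear_inner_right)
  ultimately have "(\<lambda>h. frechet_derivative ?f (at (coords c q, covector_coords Q c q p)) (0, h)) = (\<lambda>h. generator G AG Q \<phi> \<xi> q c \<bullet> h)"
    by (rule has_derivative_unique)
  then have "frechet_derivative ?f (at (coords c q, covector_coords Q c q p)) (0, h) = generator G AG Q \<phi> \<xi> q c \<bullet> h" for h
    by (rule fun_cong)
  then have "lie_deriv (cot_atlas Q) X (J \<xi>) (q, p) = generator G AG Q \<phi> \<xi> q c \<bullet> covector_coords Q c q \<beta>"
    using vert_chart[OF M c(3) p, of \<beta>] eq[unfolded z0]
    by (simp add: lie_deriv_def Let_def o_def X z0 flip: C_def) (simp add: c(1))
  then show ?thesis using covector_coords_apply[OF M c(3) \<beta> generator_in[OF \<xi> q]] by simp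
qed

lemma vf_G_combination:
  assumes X: "X \<in> vf_G G AG Q \<phi>" and Y: "Y \<in> vf_G G AG Q \<phi>"
  shows "(\<lambda>x c. r *\<^sub>R X x c + s *\<^sub>R Y x c) \<in> vf_G G AG Q \<phi>"
  unfolding vf_G_def mem_Collect_eq
proof (intro conjI ballI)
  have XY: "X \<in> vector_fields (cot_atlas Q)" "Y \<in> vector_fields (cot_atlas Q)" using X Y by (auto simp: vf_G_def)
  show "(\<lambda>x c. r *\<^sub>R X x c + s *\<^sub>R Y x c) \<in> vector_fields (cot_atlas Q)"
    by (rule vector_fields_combination[OF cotQ XY])
  fix \<xi> z assume \<xi>: "\<xi> \<in> lie_algebra G AG" and z: "z \<in> points (cot_atlas Q)"
  let ?Z = "generator G AG (cot_atlas Q) L \<xi>"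
  have d: "(\<lambda>u. ?Z (point_of C u) C) differentiable (at (coords C z))" if "C \<in> charts_at (cot_atlas Q) z" for C
    using smooth_on_differentiable[OF lift.generator_smooth[OF \<xi>]] that by (simp add: charts_at_iff)
  show "lie_bracket (cot_atlas Q) (\<lambda>x c. r *\<^sub>R X x c + s *\<^sub>R Y x c) ?Z z = (\<lambda>c. 0)"
  proof -
    have "lie_bracket (cot_atlas Q) (\<lambda>x c. r *\<^sub>R X x c + s *\<^sub>R Y x c) ?Z z =
      (\<lambda>c. r *\<^sub>R lie_bracket (cot_atlas Q) X ?Z z c + s *\<^sub>R lie_bracket (cot_atlas Q) Y ?Z z c)"
      by (rule lie_bracket_combination[OF cotQ XY d])
    then show ?thesis using X Y \<xi> z by (simp add: vf_G_def)
  qed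
qed

lemma vf_J_combination:
  assumes X: "X \<in> vf_J G AG Q \<phi>" and Y: "Y \<in> vf_J G AG Q \<phi>"
  shows "(\<lambda>x c. r *\<^sub>R X x c + s *\<^sub>R Y x c) \<in> vf_J G AG Q \<phi>"
  unfolding vf_J_def mem_Collect_eq
proof (intro conjI ballI)
  show "(\<lambda>x c. r *\<^sub>R X x c + s *\<^sub>R Y x c) \<in> vector_fields (cot_atlas Q)"
    using X Y by (intro vector_fields_combination[OF cotQ]) (auto simp: vf_J_def)
  fix \<xi> z assume \<xi>: "\<xi> \<in> lie_algebra G AG" and z: "z \<in> points (cot_atlas Q)"
  show "lie_deriv (cot_atlas Q) (\<lambda>x c. r *\<^sub>R X x c + s *\<^sub>R Y x c) (J \<xi>) z = 0"
    unfolding lie_deriv_combination[OF cotQ momentum_smooth_at[OF \<xi> z]] using X Y \<xi> z by (simp add: vf_J_def)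
qed

lemma Diff_G_compose: "F \<in> Diff_G G Q \<phi> \<Longrightarrow> F' \<in> Diff_G G Q \<phi> \<Longrightarrow> F \<circ> F' \<in> Diff_G G Q \<phi>"
  using Diff_compose[OF cotQ, of F F'] Diff_points[of F' "cot_atlas Q"] by (simp add: Diff_G_def)

lemma Diff_J_compose: "F \<in> Diff_J G AG Q \<phi> \<Longrightarrow> F' \<in> Diff_J G AG Q \<phi> \<Longrightarrow> F \<circ> F' \<in> Diff_J G AG Q \<phi>"
  using Diff_compose[OF cotQ, of F F'] Diff_points[of F' "cot_atlas Q"] by (simp add: Diff_J_def)

lemma vf_G_invariant:
  assumes conn: "connected_space (manifold_topology AG)" and X: "X \<in> vf_G G AG Q \<phi>"
    and "g \<in> carrier G" and "z \<in> points (cot_atlas Q)"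
  shows "tangent_map (cot_atlas Q) (cot_atlas Q) (L g) z (X z) = X (L g z)"
  by (rule lift.invariant_vector_field[OF conn]) (use assms in \<open>auto simp: vf_G_def\<close>)

lemma flow_Diff_G:
  assumes conn: "connected_space (manifold_topology AG)" and X: "X \<in> vf_G G AG Q \<phi>"
    and fl: "flow_of_diffeos (cot_atlas Q) X"
  shows "flow (cot_atlas Q) X t \<in> Diff_G G Q \<phi>"
proof -
  have XV: "X \<in> vector_fields (cot_atlas Q)" using X by (simp add: vf_G_def)
  show ?thesis
    unfolding Diff_G_def
    using fl flow_equivariant[OF cotQ T2_cot XV fl lift.\<Phi>_smooth_map vf_G_invariant[OF conn X]]
    by (auto simp: flow_of_diffeos_def)
qed

lemma flow_Diff_J:
  assumes X: "X \<in> vf_J G AG Q \<phi>" and fl: "flow_of_diffeos (cot_atlas Q) X"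
  shows "flow (cot_atlas Q) X t \<in> Diff_J G AG Q \<phi>"
proof -
  have XV: "X \<in> vector_fields (cot_atlas Q)" using X by (simp add: vf_J_def)
  have "J \<xi> (flow (cot_atlas Q) X t z) = J \<xi> z" if "\<xi> \<in> lie_algebra G AG" "z \<in> points (cot_atlas Q)" for \<xi> z
    by (rule flow_conserves[OF cotQ T2_cot XV fl]) (use momentum_smooth_at X that in \<open>auto simp: vf_J_def\<close>)
  then show ?thesis unfolding Diff_J_def using fl by (auto simp: flow_of_diffeos_def)
qed

section \<open>Runge-Kutta steps of a vertical field\<close>

context
  fixes X :: "('q, 'e) cot_vfield"
  assumes XV: "X \<in> vector_fields (cot_atlas Q)"
    and vertical: "\<And>z C. C \<in> charts_at (cot_atlas Q) z \<Longrightarrow> fst (X z C) = 0"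
begin

lemma stage_in:
  assumes "p \<in> cotangent_space Q q" "\<And>j. j < s \<Longrightarrow> k j \<in> cotangent_space Q q"
  shows "(\<lambda>v. p v + h * (\<Sum>j<s. a j * k j v)) \<in> cotangent_space Q q"
  using cotangent_combination[OF assms(1) cotangent_sum[of "{..<s}" k Q q a], of 1 h] assms(2) by simp

lemma rk_step_Diff_J:
  assumes X: "X \<in> vf_J G AG Q \<phi>" and rk: "rk_diffeo Q s a b h X"
  shows "rk_step Q s a b h X \<in> Diff_J G AG Q \<phi>"
  unfolding Diff_J_def mem_Collect_eq
proof (intro conjI ballI)
  show "rk_step Q s a b h X \<in> Diff (cot_atlas Q)" using rk by (simp add: rk_diffeo_def)
  fix \<xi> z assume \<xi>: "\<xi> \<in> lie_algebra G AG" and "z \<in> points (cot_atlas Q)"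
  then obtain q p where z: "z = (q, p)" and q: "q \<in> points Q" and p: "p \<in> cotangent_space Q q"
    using points_cot by (metis prod.collapse)
  let ?x = "generator G AG Q \<phi> \<xi> q"
  have zero: "fibre_field Q X q r ?x = 0" if r: "r \<in> cotangent_space Q q" for r
  proof -
    note ff = fibre_field[OF M XV q r vertical]
    have "(q, r) \<in> points (cot_atlas Q)" by (simp add: points_cot q r)
    then have "lie_deriv (cot_atlas Q) X (J \<xi>) (q, r) = 0" using X \<xi> by (simp add: vf_J_def)
    then show ?thesis using lie_deriv_momentum_vertical[OF \<xi> q r ff(1), where X = X] ff(2) by simp
  qed
  \<comment> \<open>Stages occur in \<open>rk_result\<close> under an existential quantifier, so
    some family of stages is extracted for the unique end point.\<close>
  have "rk_result Q s a b h X q p (THE p'. rk_result Q s a b h X q p p')"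
    by (rule theI'[OF rk_result_unique[OF rk q p]])
  then obtain k where k: "\<And>i. i < s \<Longrightarrow> k i \<in> cotangent_space Q q"
      "\<And>i. i < s \<Longrightarrow> k i = fibre_field Q X q (\<lambda>v. p v + h * (\<Sum>j<s. a i j * k j v))"
    and p': "(THE p'. rk_result Q s a b h X q p p') = (\<lambda>v. p v + h * (\<Sum>i<s. b i * k i v))"
    unfolding rk_result_def by blast
  have k0: "k i ?x = 0" if i: "i < s" for i
    using zero[OF stage_in[where s = s and h = h and a = "a i" and k = k, OF p k(1)]] fun_cong[OF k(2)[OF i], of ?x] by simp
  show "J \<xi> (rk_step Q s a b h X z) = J \<xi> z"
    by (simp add: rk_step_def z momentum_def p' k0)
qed

text \<open>The lifted action sends an affine line in the fibre over \<open>q\<close> to one over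
  \<open>\<phi> g q\<close>, so its tangent map sends a vertical vector to the vertical vector of
  the transformed covector. Invariance of \<open>X\<close> and uniqueness of the vertical
  representation then identify the fibre field.\<close>

lemma fibre_field_equivariant:
  assumes g: "g \<in> carrier G" and q: "q \<in> points Q" and p: "p \<in> cotangent_space Q q"
    and inv: "tangent_map (cot_atlas Q) (cot_atlas Q) (L g) (q, p) (X (q, p)) = X (L g (q, p))"
  shows "fibre_field Q X (\<phi> g q) (snd (L g (q, p))) = snd (L g (q, fibre_field Q X q p))"
proof -
  note ff = fibre_field[OF M XV q p vertical]
  let ?\<beta> = "fibre_field Q X q p"
  have Lz: "L g (q, r) = (\<phi> g q, snd (L g (q, r)))" for r by (rule prod_eqI) (simp_all add: fst_L)
  have line: "L g (q, \<lambda>v. p v + t * ?\<beta> v) = (\<phi> g q, \<lambda>v. snd (L g (q, p)) v + t * snd (L g (q, ?\<beta>)) v)" for t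
    by (rule prod_eqI) (auto simp: fst_L snd_L)
  have z: "(q, p) \<in> points (cot_atlas Q)" by (simp add: points_cot q p)
  have "X (\<phi> g q, snd (L g (q, p))) = X (L g (q, p))" using Lz[of p] by simp
  also have "\<dots> = tangent_map (cot_atlas Q) (cot_atlas Q) (L g) (q, p) (vert Q (q, p) ?\<beta>)"
    using inv ff(2) by simp
  also have "\<dots> = velocity (cot_atlas Q) (\<lambda>t. L g (q, \<lambda>v. p v + t * ?\<beta> v)) 0"
    using velocity_map[OF cotQ cotQ fibre_line_smooth_at[OF M q p ff(1), of 0]] lift.\<Phi>_smooth_at[OF g z]
    by (simp add: vert_def)
  also have "\<dots> = vert Q (\<phi> g q, snd (L g (q, p))) (snd (L g (q, ?\<beta>)))"
    unfolding line by (simp add: vert_def)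
  finally have e: "X (\<phi> g q, snd (L g (q, p))) = vert Q (\<phi> g q, snd (L g (q, p))) (snd (L g (q, ?\<beta>)))" .
  show ?thesis
    by (rule fibre_field(3)[OF M XV \<Phi>_points[OF g q] L_cotangent[OF g q p] vertical L_cotangent[OF g q ff(1)] e])
qed

lemma rk_step_Diff_G:
  assumes conn: "connected_space (manifold_topology AG)" and X: "X \<in> vf_G G AG Q \<phi>"
    and rk: "rk_diffeo Q s a b h X"
  shows "rk_step Q s a b h X \<in> Diff_G G Q \<phi>"
  unfolding Diff_G_def mem_Collect_eq
proof (intro conjI ballI)
  show "rk_step Q s a b h X \<in> Diff (cot_atlas Q)" using rk by (simp add: rk_diffeo_def)
  fix g z assume g: "g \<in> carrier G" and zM: "z \<in> points (cot_atlas Q)"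
  then obtain q p where z: "z = (q, p)" and q: "q \<in> points Q" and p: "p \<in> cotangent_space Q q"
    using points_cot by (metis prod.collapse)
  define p' where "p' = (THE p'. rk_result Q s a b h X q p p')"
  have "rk_result Q s a b h X q p p'" unfolding p'_def by (rule theI'[OF rk_result_unique[OF rk q p]])
  then obtain k where k: "\<And>i. i < s \<Longrightarrow> k i \<in> cotangent_space Q q"
      "\<And>i. i < s \<Longrightarrow> k i = fibre_field Q X q (\<lambda>v. p v + h * (\<Sum>j<s. a i j * k j v))"
    and p': "p' = (\<lambda>v. p v + h * (\<Sum>i<s. b i * k i v))"
    unfolding rk_result_def by blast
  let ?l = "\<lambda>r. snd (L g (q, r))"
  \<comment> \<open>Stated for arbitrary coefficients \<open>c\<close>, so that it transports both
    the stage arguments and the final combination.\<close>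
  have lin: "?l (\<lambda>v. p v + h * (\<Sum>j<s. c j * k j v)) = (\<lambda>v. ?l p v + h * (\<Sum>j<s. c j * ?l (k j) v))" for c
    by (rule ext) (simp add: snd_L)
  have "rk_result Q s a b h X (\<phi> g q) (?l p) (?l p')"
    unfolding rk_result_def
  proof (intro exI[of _ "\<lambda>i. ?l (k i)"] conjI allI impI)
    fix i assume i: "i < s"
    show "?l (k i) \<in> cotangent_space Q (\<phi> g q)" by (rule L_cotangent[OF g q k(1)[OF i]])
    let ?r = "\<lambda>v. p v + h * (\<Sum>j<s. a i j * k j v)"
    have r: "?r \<in> cotangent_space Q q" by (rule stage_in[OF p k(1)])
    have "(q, ?r) \<in> points (cot_atlas Q)" by (simp add: points_cot q r)
    from fibre_field_equivariant[OF g q r vf_G_invariant[OF conn X g this]]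
    have "fibre_field Q X (\<phi> g q) (?l ?r) = ?l (k i)" by (simp only: k(2)[OF i, symmetric])
    then show "?l (k i) = fibre_field Q X (\<phi> g q) (\<lambda>v. ?l p v + h * (\<Sum>j<s. a i j * ?l (k j) v))"
      by (simp only: lin)
  next
    show "?l p' = (\<lambda>v. ?l p v + h * (\<Sum>i<s. b i * ?l (k i) v))" unfolding p' by (rule lin)
  qed
  \<comment> \<open>The transported stages solve the stage equations at the image point, and
    uniqueness of the end point identifies their result; uniqueness of the stages is not part of
    \<open>rk_diffeo\<close>.\<close>
  then have "(THE p'. rk_result Q s a b h X (\<phi> g q) (?l p) p') = ?l p'"
    using rk_result_unique[OF rk \<Phi>_points[OF g q] L_cotangent[OF g q p]] by (rule the1_equality[rotated])
  then have "rk_step Q s a b h X (L g z) = (\<phi> g q, ?l p')" by (simp add: rk_step_def z split_def fst_L)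
  also have "\<dots> = L g (q, p')" by (rule prod_eqI) (simp_all add: fst_L)
  also have "(q, p') = rk_step Q s a b h X z" by (simp add: rk_step_def z p'_def)
  finally show "rk_step Q s a b h X (L g z) = L g (rk_step Q s a b h X z)" .
qed

end

end

theorem proposition5p2:
  fixes Q :: "('q, 'e::euclidean_space) atlas"
    and \<g> \<d> :: "('q, 'e) tensor2"
    and V :: "'q \<Rightarrow> real"
    and eps h :: real
    and G :: "('g, 'x) monoid_scheme"
    and AG :: "('g, 'k::banach) atlas"
    and \<phi> :: "'g \<Rightarrow> 'q \<Rightarrow> 'q"
    and H :: "('q \<times> ('q, 'e) covec \<Rightarrow> 'q \<times> ('q, 'e) covec) set"
    and \<hh> :: "('q, 'e) cot_vfield set"
  assumes "smooth_manifold Q"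
    and "riemannian_metric Q \<g>"
    and "smooth_map Q euclid_atlas V"
    and "sym_tensor_field Q \<d>" and "positive_semidefinite Q \<d>" and "constant_rank Q \<d>"
    and "0 \<le> eps" and "0 < h"
    and "lie_group G AG" and "smooth_action G AG Q \<phi>"
    and flows: "flow_of_diffeos (cot_atlas Q) (X_T Q \<g>)"
      "flow_of_diffeos (cot_atlas Q) (X_V Q V)"
      "flow_of_diffeos (cot_atlas Q) (vf_scale eps (Y_diss Q \<g> \<d>))"
      "flow_of_diffeos (cot_atlas Q) (X_VY Q \<g> \<d> V eps)"
    and H: "(H = Diff_G G Q \<phi> \<and> \<hh> = vf_G G AG Q \<phi> \<and> connected_space (manifold_topology AG)) \<or>
      (H = Diff_J G AG Q \<phi> \<and> \<hh> = vf_J G AG Q \<phi>) \<or>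
      (H = Diff_GJ G AG Q \<phi> \<and> \<hh> = vf_GJ G AG Q \<phi> \<and> connected_space (manifold_topology AG))"
    and "X_T Q \<g> \<in> \<hh>" and "Y_diss Q \<g> \<d> \<in> \<hh>" and "X_V Q V \<in> \<hh>"
  shows "Phi_3S Q \<g> \<d> V eps h \<in> H \<and>
     Phi_2S Q \<g> \<d> V eps h \<in> H \<and>
     (\<forall>s a b. rk_diffeo Q s a b h (X_VY Q \<g> \<d> V eps) \<longrightarrow> Phi_RKS Q \<g> \<d> V eps s a b h \<in> H)"
proof -
  interpret lie_grp G AG by unfold_locales (rule assms(9))
  have Q: "smooth_atlas Q" and T2: "Hausdorff_space (manifold_topology Q)"
    using assms(1) smooth_manifold_atlas unfolding smooth_manifold_def by blast+
  interpret cotangent_symmetry G AG Q \<phi>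
    by unfold_locales (rule Q, rule assms(10), rule T2)
  let ?M = "cot_atlas Q" and ?T = "X_T Q \<g>" and ?V = "X_V Q V" and ?Y = "vf_scale eps (Y_diss Q \<g> \<d>)"
    and ?VY = "X_VY Q \<g> \<d> V eps"
  \<comment> \<open>The vanishing second term puts the rescaled field in the form of
    \<open>vf_G_combination\<close> and \<open>vf_J_combination\<close>.\<close>
  have Y: "?Y = (\<lambda>x c. eps *\<^sub>R Y_diss Q \<g> \<d> x c + 0 *\<^sub>R Y_diss Q \<g> \<d> x c)"
    by (simp add: vf_scale_def)
  have VY: "?VY = (\<lambda>x c. 1 *\<^sub>R X_V Q V x c + eps *\<^sub>R Y_diss Q \<g> \<d> x c)"
    by (simp add: X_VY_def vf_add_def vf_scale_def)
  have vertical: "fst (?VY z C) = 0" if "C \<in> charts_at ?M z" for z C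
    unfolding VY using X_V_vertical[OF Q assms(3) that] Y_diss_vertical[OF Q that] by simp
  have fields: "?Y \<in> \<hh>" "?VY \<in> \<hh>"
    using H assms(17,18) vf_G_combination vf_J_combination unfolding Y VY vf_GJ_def by blast+
  \<comment> \<open>The three cases for \<open>H\<close> are treated together: the third is the
    intersection of the first two, for diffeomorphisms and for fields alike.\<close>
  have flow_H: "flow ?M X t \<in> H" if "X \<in> \<hh>" "flow_of_diffeos ?M X" for X t
    using H that flow_Diff_G flow_Diff_J unfolding Diff_GJ_def vf_GJ_def by blast
  have compose_H: "F \<circ> F' \<in> H" if "F \<in> H" "F' \<in> H" for F F'
    using H that Diff_G_compose Diff_J_compose unfolding Diff_GJ_def by blast
  have VYV: "?VY \<in> vector_fields ?M"
    using H fields(2) unfolding vf_GJ_def vf_G_def vf_J_def by blast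
  have rk_H: "rk_step Q s a b h ?VY \<in> H" if "rk_diffeo Q s a b h ?VY" for s a b
    using H fields(2) that rk_step_Diff_G[OF VYV vertical] rk_step_Diff_J[OF VYV vertical]
    unfolding Diff_GJ_def vf_GJ_def by blast
  note T_H = flow_H[OF assms(16) flows(1)] and V_H = flow_H[OF assms(18) flows(2)]
    and Y_H = flow_H[OF fields(1) flows(3)] and VY_H = flow_H[OF fields(2) flows(4)]
  show ?thesis
    unfolding Phi_3S_def Phi_2S_def Phi_RKS_def
    by (intro conjI allI impI compose_H T_H V_H Y_H VY_H rk_H)
qed

end
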